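(* For every $n\ge1$ the following holds: for every semisimple Lie algebra $\mathfrak g$ of rank $n$ (with labels $r_i\in\{1,2\}$ symmetrizing its Cartan matrix) and every dominant monomial $m\in\widetilde{\mathcal Y}_{q,t}$, there is a unique element $F(m)\in\mathfrak K\cap\widetilde D(m)$ such that $m$ is the unique dominant monomial of $F(m)$.
   Context: Parameters: $q,t\in\mathbb C^\times$ are not roots of unity, $q^{\mathbb Z}\cap t^{\mathbb Z}=\{1\}$, $\epsilon=e^{i\pi/2}$, and $\mathcal C=q^{\mathbb Z}t^{\mathbb Z}$ (free abelian on $q,t$). For $a=q^lt^m\in\mathcal C$ put $\Pi_q(a)=q^l$, $\Pi_t(a)=\epsilon^lt^m$. Lie-theoretic data: $C=(C_{i,j})_{i,j\in I}$ is the Cartan matrix of $\mathfrak g$, and $r_i\in\{1,2\}$ satisfy $r_iC_{i,j}=r_jC_{j,i}$ (it is not required that $\min_i r_i=1$; there are no $G_2$ factors). $I_k=\{i\in I:r_i=k\}$, $q_i=q^{r_i}$, $r_i^\vee=3-r_i$, and $i\sim j$ means $C_{i,j}<0$. Fix $\phi:I\to\{0,1\}$ with $\phi(i)+\phi(j)=1$ if $i\sim j$, and $\phi(i)=1$ if $C_{i,j}=-2$ for some $j$. Interpolating ring: let $\alpha$ be an indeterminate. Put $W_{i,a}=Y_{i,a}$ for $i\in I_2$, $W_{i,a}=Y_{i,aq^{-1}}Y_{i,aq}$ for $i\in I_1$, and $\mathcal Y_{q,t}=\mathbb Z[W_{i,a}^{\pm1},\alpha Y_{i,a}^{\pm1},\alpha]_{i\in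 I,a\in\mathcal C}\subset\mathbb Z[Y_{i,a}^{\pm1},\alpha]_{i\in I,a\in\mathcal C}$. Let $\mathcal Y_q=\mathbb Z[Y_{i,a}^{\pm1}]_{i\in I,a\in q^{\mathbb Z}}$ and $\mathcal Y_t^L=\mathbb Z[Z_{i,a^{r_i^\vee}}^{\pm1}]_{i\in I,a\in\epsilon^{\mathbb Z}t^{\mathbb Z}}$. There are surjective ring homomorphisms: $\Pi_q:\mathcal Y_{q,t}\to\mathcal Y_q$ (set $t=1$), induced by $\alpha\mapsto1$, $Y_{i,a}\mapsto Y_{i,\Pi_q(a)}$; and $\Pi_t:\mathcal Y_{q,t}\to\mathcal Y_t^L$ (set $q=\epsilon$), given by $\alpha\mapsto0$, $\alpha Y_{i,a}^{\pm1}\mapsto0$, $W_{i,a}\mapsto Z_{i,(-1)^{\phi(i)}\Pi_t(a)}$ for $i\in I_2$, and $W_{i,a}\mapsto Z_{i,-(-1)^{\phi(i)}\Pi_t(a)^2}$ for $i\in I_1$. Let $\widetilde{\mathcal Y}_{q,t}=\mathcal Y_{q,t}/(\ker\Pi_q\cap\ker\Pi_t)$; $\Pi_q,\Pi_t$ descend to it, and $\alpha^2=\alpha$ in it. Subalgebras: for $i\in I$, $a\in\mathcal C$ put $\widetilde A_{i,a}=Y_{i,a(q_it)^{-1}}Y_{i,aq_it}\prod_{C_{j,i}=-1}Y_{j,a}^{-1}\prod_{C_{j,i}=-2}Y_{j,aq^{-1}}^{-1}Y_{j,aq}^{-1}$. Let $\mathfrak K_{i,q,t}$ be the following subalgebra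 (the same notation is used for its image in $\widetilde{\mathcal Y}_{q,t}$): for $i\in I_1$, $\mathbb Z[W_{i,a}(1+\alpha\widetilde A_{i,aq^2t}^{-1}+\widetilde A_{i,aq^2t}^{-1}\widetilde A_{i,at}^{-1}),\ \alpha Y_{i,a}(1+\widetilde A_{i,aqt}^{-1}),\ W_{j,a}^{\pm1},\ \alpha Y_{j,a}^{\pm1},\ \alpha]_{a\in\mathcal C,j\ne i}$; for $i\in I_2$, $\mathbb Z[Y_{i,a}(1+\widetilde A_{i,aq^2t}^{-1}),\ W_{j,a}^{\pm1},\ \alpha Y_{j,a}^{\pm1},\ \alpha]_{a\in\mathcal C,j\neq i}$. Put $\mathfrak K=\bigcap_{i\in I}\mathfrak K_{i,q,t}\subset\widetilde{\mathcal Y}_{q,t}$. Monomials: a monomial of $\widetilde{\mathcal Y}_{q,t}$ is an element of the form $(\lambda+\mu\alpha)M$ with $\lambda,\mu\in\mathbb Z$ and $M=\prod_{i,a}Y_{i,a}^{u_{i,a}}$ a monomial in the $Y_{i,a}^{\pm1}$. It is dominant if it can be written using only $\alpha$ and nonnegative powers of the $Y_{i,a}$. A monomial of $\mathcal Y_q$ or $\mathcal Y_t^L$ is dominant if it involves only nonnegative powers of the variables. Since an element of $\widetilde{\mathcal Y}_{q,t}$ is determined by its images under $\Pi_q$ and $\Pi_t$, "$m$ is the unique dominant monomial of $\chi$" means that no dominant monomial occurs in $\Pi_q(\chi)-\Pi_q(m)$ nor in $\Pi_t(\chi)-\Pi_t(m)$. The set $\widetilde D(m)$: for $m=(\lambda+\mu\alpha)\prod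 Y_{i,a}^{u_{i,a}}$ (written with $u_{i,a}\ge0$) let $C(m)=\{a\in\mathcal C:\exists i,\ u_{i,a}\ne0\}$ and $D(m)=\{m\widetilde A_{i_1,a_1}^{-1}\cdots\widetilde A_{i_N,a_N}^{-1}:N\ge0,\ i_j\in I,\ a_j\in C(m)q^{\mathbb N^*}t^{\mathbb N^*}\}$, where $\mathbb N^*=\{1,2,\dots\}$. $\widetilde D(m)$ is the set of elements of $\widetilde{\mathcal Y}_{q,t}$ represented by elements of $\mathcal Y_{q,t}$ that are finite linear combinations of elements of $D(m)$ with coefficients in $\mathbb Z[\alpha]$. *)

theory Defs
  imports Complex_Main "HOL-Library.Poly_Mapping" "HOL-Computational_Algebra.Polynomial"
begin

section \<open>Laurent polynomials\<close>

text \<open>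
  A Laurent monomial in variables indexed by \<^typ>\<open>'i \<times> complex\<close> is given by its finitely supported
  exponent vector, and a Laurent polynomial is an element of the group ring of the group of
  exponent vectors (multiplication on \<^typ>\<open>'a \<Rightarrow>\<^sub>0 'b\<close> is convolution). The indeterminate
  \<open>\<alpha>\<close> is the polynomial variable of the coefficient ring \<^typ>\<open>int poly\<close>. All variables
  \<open>Y\<^bsub>i,a\<^esub>\<close>, \<open>Z\<^bsub>i,a\<^esub>\<close> exist for every \<open>i\<close> and every complex \<open>a\<close> at the level of types; the
  restriction to the index sets of interest is made where the rings are defined.
\<close>

type_synonym 'i expo = "('i \<times> complex) \<Rightarrow>\<^sub>0 int"
type_synonym 'i laurent = "'i expo \<Rightarrow>\<^sub>0 int"
type_synonym 'i laurent_alpha = "'i expo \<Rightarrow>\<^sub>0 int poly"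

definition dominant_expo :: "'i expo \<Rightarrow> bool"
  where "dominant_expo u \<longleftrightarrow> (\<forall>k. 0 \<le> Poly_Mapping.lookup u k)"

definition no_dominant :: "'i laurent \<Rightarrow> bool"
  where "no_dominant P \<longleftrightarrow> (\<forall>u\<in>Poly_Mapping.keys P. \<not> dominant_expo u)"

definition scalar :: "int poly \<Rightarrow> 'i laurent_alpha"
  where "scalar p = Poly_Mapping.single 0 p"

definition alpha :: "'i laurent_alpha"
  where "alpha = scalar [:0, 1:]"

definition mono :: "'i expo \<Rightarrow> 'i laurent_alpha"
  where "mono u = Poly_Mapping.single u 1"

text \<open>Apply \<open>f\<close> to the monomials and specialise \<open>\<alpha>\<close> to \<open>c\<close>.\<close>

definition specialise :: "int \<Rightarrow> ('i expo \<Rightarrow> 'i expo) \<Rightarrow> 'i laurent_alpha \<Rightarrow> 'i laurent"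
  where "specialise c f P =
    (\<Sum>u\<in>Poly_Mapping.keys P. Poly_Mapping.single (f u) (poly (Poly_Mapping.lookup P u) c))"

lemma specialise_add: "specialise c f (P + Q) = specialise c f P + specialise c f Q"
proof -
  let ?g = "\<lambda>R u. Poly_Mapping.single (f u) (poly (Poly_Mapping.lookup R u) c)"
  let ?K = "Poly_Mapping.keys P \<union> Poly_Mapping.keys Q"
  have *: "specialise c f R = sum (?g R) ?K" if "Poly_Mapping.keys R \<subseteq> ?K" for R
    unfolding specialise_def using that
    by (intro sum.mono_neutral_left) (auto simp: in_keys_iff)
  show ?thesis
    using Poly_Mapping.keys_add[of P Q]
    by (simp add: * lookup_add single_add sum.distrib)
qed

lemma specialise_zero [simp]: "specialise c f 0 = 0"
  by (simp add: specialise_def)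

lemma specialise_single [simp]:
  "specialise c f (Poly_Mapping.single u p) = Poly_Mapping.single (f u) (poly p c)"
  by (simp add: specialise_def)

lemma specialise_uminus: "specialise c f (- P) = - specialise c f P"
  by (metis add_eq_0_iff2 specialise_add specialise_zero add.inverse_inverse)

lemma specialise_diff: "specialise c f (P - Q) = specialise c f P - specialise c f Q"
  using specialise_add[of c f P "- Q"] by (simp add: specialise_uminus)

lemma specialise_sum: "specialise c f (sum g A) = (\<Sum>x\<in>A. specialise c f (g x))"
  by (induction A rule: infinite_finite_induct) (simp_all add: specialise_add)

lemma sum_singles: "(\<Sum>u\<in>Poly_Mapping.keys P. Poly_Mapping.single u (Poly_Mapping.lookup P u)) = P"
proof (rule poly_mapping_eqI)
  fix k
  have "Poly_Mapping.lookup (\<Sum>u\<in>Poly_Mapping.keys P. Poly_Mapping.single u (Poly_Mapping.lookup P u)) k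
      = (\<Sum>u\<in>Poly_Mapping.keys P. if u = k then Poly_Mapping.lookup P u else 0)"
    unfolding lookup_sum by (intro sum.cong) (auto simp: lookup_single)
  also have "\<dots> = Poly_Mapping.lookup P k"
    by (simp add: sum.delta in_keys_iff)
  finally show "Poly_Mapping.lookup (\<Sum>u\<in>Poly_Mapping.keys P. Poly_Mapping.single u (Poly_Mapping.lookup P u)) k
      = Poly_Mapping.lookup P k" .
qed

lemma specialise_mult:
  assumes "\<And>u v. \<lbrakk>u \<in> Poly_Mapping.keys P; v \<in> Poly_Mapping.keys Q;
      poly (Poly_Mapping.lookup P u) c \<noteq> 0; poly (Poly_Mapping.lookup Q v) c \<noteq> 0\<rbrakk>
      \<Longrightarrow> f (u + v) = f u + f v"
  shows "specialise c f (P * Q) = specialise c f P * specialise c f Q"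
proof -
  let ?s = "\<lambda>R u. Poly_Mapping.single u (Poly_Mapping.lookup R u)"
  have "specialise c f (P * Q)
      = specialise c f ((\<Sum>u\<in>Poly_Mapping.keys P. ?s P u) * (\<Sum>v\<in>Poly_Mapping.keys Q. ?s Q v))"
    by (simp only: sum_singles)
  also have "\<dots> = (\<Sum>u\<in>Poly_Mapping.keys P. \<Sum>v\<in>Poly_Mapping.keys Q. specialise c f (?s P u * ?s Q v))"
    by (simp only: sum_product specialise_sum)
  also have "\<dots> = (\<Sum>u\<in>Poly_Mapping.keys P. \<Sum>v\<in>Poly_Mapping.keys Q.
      Poly_Mapping.single (f u) (poly (Poly_Mapping.lookup P u) c) *
      Poly_Mapping.single (f v) (poly (Poly_Mapping.lookup Q v) c))"
    using assms by (intro sum.cong refl) (fastforce simp: mult_single)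
  also have "\<dots> = specialise c f P * specialise c f Q"
    by (simp only: sum_product specialise_def)
  finally show ?thesis .
qed

lemma specialise_scalar:
  "specialise c f (scalar p * P) = Poly_Mapping.single 0 (poly p c) * specialise c f P"
proof -
  have "scalar p * (\<Sum>u\<in>Poly_Mapping.keys P. Poly_Mapping.single u (Poly_Mapping.lookup P u))
      = (\<Sum>u\<in>Poly_Mapping.keys P. Poly_Mapping.single u (p * Poly_Mapping.lookup P u))"
    by (simp only: sum_distrib_left scalar_def mult_single add_0)
  then have "specialise c f (scalar p * P)
      = (\<Sum>u\<in>Poly_Mapping.keys P. Poly_Mapping.single (f u) (poly p c * poly (Poly_Mapping.lookup P u) c))"
    by (simp only: sum_singles specialise_sum specialise_single poly_mult)
  then show ?thesis
    by (simp only: specialise_def sum_distrib_left mult_single add_0)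
qed

text \<open>\<open>\<int>[S]\<close>: the unital subring generated by \<open>S\<close>.\<close>

inductive_set subring_gen :: "'a::comm_ring_1 set \<Rightarrow> 'a set" for S
  where
    one: "1 \<in> subring_gen S"
  | gen: "x \<in> S \<Longrightarrow> x \<in> subring_gen S"
  | diff: "x \<in> subring_gen S \<Longrightarrow> y \<in> subring_gen S \<Longrightarrow> x - y \<in> subring_gen S"
  | mult: "x \<in> subring_gen S \<Longrightarrow> y \<in> subring_gen S \<Longrightarrow> x * y \<in> subring_gen S"


section \<open>Cartan matrices\<close>

text \<open>Cartan matrices of semisimple Lie algebras, i.e. generalised Cartan matrices of finite type.\<close>

definition finite_cartan_matrix :: "'i set \<Rightarrow> ('i \<Rightarrow> 'i \<Rightarrow> int) \<Rightarrow> bool"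
  where "finite_cartan_matrix I C \<longleftrightarrow>
    finite I \<and>
    (\<forall>i\<in>I. C i i = 2) \<and>
    (\<forall>i\<in>I. \<forall>j\<in>I. i \<noteq> j \<longrightarrow> C i j \<le> 0) \<and>
    (\<forall>i\<in>I. \<forall>j\<in>I. C i j = 0 \<longrightarrow> C j i = 0) \<and>
    (\<exists>d :: 'i \<Rightarrow> real.
      (\<forall>i\<in>I. 0 < d i) \<and>
      (\<forall>i\<in>I. \<forall>j\<in>I. d i * of_int (C i j) = d j * of_int (C j i)) \<and>
      (\<forall>x :: 'i \<Rightarrow> real. (\<exists>i\<in>I. x i \<noteq> 0) \<longrightarrow>
        0 < (\<Sum>i\<in>I. \<Sum>j\<in>I. d i * of_int (C i j) * x i * x j)))"


section \<open>The interpolating ring\<close>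

definition epsilon :: complex
  where "epsilon = exp (\<i> * of_real pi / 2)"

locale interpolation =
  fixes I :: "'i set" and C :: "'i \<Rightarrow> 'i \<Rightarrow> int" and r :: "'i \<Rightarrow> nat" and phi :: "'i \<Rightarrow> nat"
    and q t :: complex
  assumes cartan: "finite_cartan_matrix I C"
    and r_values: "\<And>i. i \<in> I \<Longrightarrow> r i \<in> {1, 2}"
    and symmetrised: "\<And>i j. i \<in> I \<Longrightarrow> j \<in> I \<Longrightarrow> int (r i) * C i j = int (r j) * C j i"
    and phi_values: "\<And>i. i \<in> I \<Longrightarrow> phi i \<in> {0, 1}"
    and phi_adjacent: "\<And>i j. i \<in> I \<Longrightarrow> j \<in> I \<Longrightarrow> C i j < 0 \<Longrightarrow> phi i + phi j = 1"
    and phi_double: "\<And>i j. i \<in> I \<Longrightarrow> j \<in> I \<Longrightarrow> C i j = - 2 \<Longrightarrow> phi i = 1"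
    and q_nonzero: "q \<noteq> 0" and t_nonzero: "t \<noteq> 0"
    and q_not_root: "\<And>k::nat. 0 < k \<Longrightarrow> q ^ k \<noteq> 1"
    and t_not_root: "\<And>k::nat. 0 < k \<Longrightarrow> t ^ k \<noteq> 1"
    and q_t_generic: "range (\<lambda>l::int. q powi l) \<inter> range (\<lambda>m::int. t powi m) = {1}"
begin

definition qt_lattice :: "complex set"
  where "qt_lattice = {q powi l * t powi m | l m. True}"

text \<open>The exponents \<open>(l, m)\<close> of \<open>a = q\<^sup>l t\<^sup>m\<close>; they are unique for \<open>a\<close> in \<open>qt_lattice\<close>.\<close>

definition qt_exponents :: "complex \<Rightarrow> int \<times> int"
  where "qt_exponents a = (THE lm. a = q powi (fst lm) * t powi (snd lm))"

definition proj_q :: "complex \<Rightarrow> complex"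
  where "proj_q a = q powi (fst (qt_exponents a))"

definition proj_t :: "complex \<Rightarrow> complex"
  where "proj_t a = epsilon powi (fst (qt_exponents a)) * t powi (snd (qt_exponents a))"

lemma qt_exponents_eq: "qt_exponents (q powi l * t powi m) = (l, m)"
  unfolding qt_exponents_def
proof (rule the_equality)
  fix lm :: "int \<times> int"
  assume eq: "q powi l * t powi m = q powi fst lm * t powi snd lm"
  have "q powi (l - fst lm) = t powi (snd lm - m)"
    using eq q_nonzero t_nonzero by (simp add: power_int_diff field_simps)
  then have one: "q powi (l - fst lm) = 1" "t powi (snd lm - m) = 1"
    using q_t_generic by (metis IntI UNIV_I image_eqI singletonD)+
  have powi_1: "k = 0" if "x powi k = 1" "\<And>j::nat. 0 < j \<Longrightarrow> x ^ j \<noteq> 1" for x :: complex and k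
    using that by (cases k rule: int_cases3) (auto simp: power_int_def power_inverse)
  have "l - fst lm = 0" "snd lm - m = 0"
    using powi_1[OF one(1) q_not_root] powi_1[OF one(2) t_not_root] by blast+
  then show "lm = (l, m)"
    by (simp add: prod_eq_iff)
qed simp

lemma proj_q_eq: "proj_q (q powi l * t powi m) = q powi l"
  and proj_t_eq: "proj_t (q powi l * t powi m) = epsilon powi l * t powi m"
  by (simp_all add: proj_q_def proj_t_def qt_exponents_eq)

abbreviation Yexp :: "'i \<Rightarrow> complex \<Rightarrow> 'i expo"
  where "Yexp i a \<equiv> frag_of (i, a)"

definition Wexp :: "'i \<Rightarrow> complex \<Rightarrow> 'i expo"
  where "Wexp i a = (if r i = 2 then Yexp i a else Yexp i (a / q) + Yexp i (a * q))"

text \<open>The ring \<open>\<Y>\<^bsub>q,t\<^esub>\<close>.\<close>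

definition Yqt :: "'i laurent_alpha set"
  where "Yqt = subring_gen
    ({mono (Wexp i a) | i a. i \<in> I \<and> a \<in> qt_lattice} \<union>
     {mono (- Wexp i a) | i a. i \<in> I \<and> a \<in> qt_lattice} \<union>
     {alpha * mono (Yexp i a) | i a. i \<in> I \<and> a \<in> qt_lattice} \<union>
     {alpha * mono (- Yexp i a) | i a. i \<in> I \<and> a \<in> qt_lattice} \<union>
     {alpha})"

definition Pi_q :: "'i laurent_alpha \<Rightarrow> 'i laurent"
  where "Pi_q = specialise 1 (frag_extend (\<lambda>(i, a). frag_of (i, proj_q a)))"

definition Zindex :: "'i \<Rightarrow> complex \<Rightarrow> complex"
  where "Zindex i a = (if r i = 2 then (- 1) ^ phi i * proj_t a else - ((- 1) ^ phi i) * (proj_t a)\<^sup>2)"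

definition Wmap :: "'i expo \<Rightarrow> 'i expo"
  where "Wmap = frag_extend (\<lambda>(i, a). Wexp i a)"

lemma qt_lattice_q:
  assumes "a \<in> qt_lattice"
  shows "a * q \<in> qt_lattice" "a / q \<in> qt_lattice"
proof -
  obtain l m where a: "a = q powi l * t powi m"
    using assms by (auto simp: qt_lattice_def)
  have "a * q = q powi (l + 1) * t powi m" "a / q = q powi (l - 1) * t powi m"
    using q_nonzero by (simp_all add: a power_int_add power_int_diff)
  then show "a * q \<in> qt_lattice" "a / q \<in> qt_lattice"
    unfolding qt_lattice_def by blast+
qed

lemma Wmap_eq_0:
  assumes supp: "Poly_Mapping.keys w \<subseteq> I \<times> qt_lattice" and "Wmap w = 0"
  shows "w = 0"
proof (rule ccontr)
  assume "w \<noteq> 0"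
  then obtain i a where ia: "(i, a) \<in> Poly_Mapping.keys w"
    by (metis all_not_in_conv keys_eq_empty surj_pair)
  then have "i \<in> I" "a \<noteq> 0"
    using supp q_nonzero t_nonzero by (auto simp: qt_lattice_def)
  have coeff: "Poly_Mapping.lookup (Wmap w) (i, b) = (if r i = 2 then Poly_Mapping.lookup w (i, b)
      else Poly_Mapping.lookup w (i, b * q) + Poly_Mapping.lookup w (i, b / q))" for b
  proof -
    have "Poly_Mapping.lookup (Wmap w) (i, b) = (if r i = 2 then Poly_Mapping.lookup w (i, b)
      else Poly_Mapping.lookup w (i, b * q) + Poly_Mapping.lookup w (i, b / q))"
      using subset_UNIV[of "Poly_Mapping.keys w"]
    proof (induction w rule: frag_induction)
      case (one x)
      then show ?case
        using q_nonzero
        by (cases x) (auto simp: Wmap_def Wexp_def lookup_add field_simps)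
    next
      case (diff x y)
      then show ?case
        by (auto simp: Wmap_def frag_extend_diff lookup_minus)
    qed (auto simp: Wmap_def)
    then show ?thesis .
  qed
  show False
  proof (cases "r i = 2")
    case True
    then show False
      using coeff[of a] \<open>Wmap w = 0\<close> ia by (simp add: in_keys_iff)
  next
    case False
    have "(i, a * q ^ (2 * k)) \<in> Poly_Mapping.keys w" for k
    proof (induction k)
      case (Suc k)
      have *: "a * q ^ (2 * k) * q * q = a * q ^ (2 * Suc k)" "a * q ^ (2 * k) * q / q = a * q ^ (2 * k)"
        using q_nonzero by simp_all
      show ?case
        using coeff[of "a * q ^ (2 * k) * q"] Suc False \<open>Wmap w = 0\<close>
        unfolding * in_keys_iff by simp
    qed (use ia in simp)
    then have "range (\<lambda>k. (i, a * q ^ (2 * k))) \<subseteq> Poly_Mapping.keys w"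
      by blast
    then have "finite (range (\<lambda>k. (i, a * q ^ (2 * k))))"
      by (rule finite_subset) simp
    moreover have "inj (\<lambda>k. (i, a * q ^ (2 * k)))"
    proof (rule linorder_injI)
      fix j k :: nat
      assume "j < k"
      then have "q ^ (2 * k) = q ^ (2 * j) * q ^ (2 * (k - j))"
        by (metis add_diff_inverse_nat distrib_left not_less_iff_gr_or_eq power_add)
      then show "(i, a * q ^ (2 * j)) \<noteq> (i, a * q ^ (2 * k))"
        using q_not_root[of "2 * (k - j)"] q_nonzero \<open>a \<noteq> 0\<close> \<open>j < k\<close>
        by (simp del: power_mult)
    qed
    ultimately show False
      using finite_imageD[of "\<lambda>k. (i, a * q ^ (2 * k))" UNIV] infinite_UNIV_nat by simp
  qed
qed

text \<open>
  \<open>W_coords u\<close> expresses the monomial with exponent vector \<open>u\<close> through the variables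
  \<open>W\<^bsub>i,a\<^esub>\<close>, which are independent (lemma \<open>W_coords_Wmap\<close>). For \<open>u\<close> outside the lattice they span
  the value is irrelevant: for elements of \<open>Yqt\<close> the coefficient of such a monomial vanishes
  at \<open>\<alpha> = 0\<close>.
\<close>

definition W_coords :: "'i expo \<Rightarrow> 'i expo"
  where "W_coords u = (THE w. Poly_Mapping.keys w \<subseteq> I \<times> qt_lattice \<and> Wmap w = u)"

definition Pi_t :: "'i laurent_alpha \<Rightarrow> 'i laurent"
  where "Pi_t = specialise 0 (\<lambda>u. frag_extend (\<lambda>(i, a). frag_of (i, Zindex i a)) (W_coords u))"

lemma W_coords_Wmap:
  assumes "Poly_Mapping.keys w \<subseteq> I \<times> qt_lattice"
  shows "W_coords (Wmap w) = w"
  unfolding W_coords_def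
proof (rule the_equality)
  fix v
  assume v: "Poly_Mapping.keys v \<subseteq> I \<times> qt_lattice \<and> Wmap v = Wmap w"
  have "Poly_Mapping.keys (v - w) \<subseteq> I \<times> qt_lattice"
    using v assms keys_diff[of v w] by blast
  moreover have "Wmap (v - w) = 0"
    using v by (simp add: Wmap_def frag_extend_diff)
  ultimately show "v = w"
    using Wmap_eq_0[of "v - w"] by simp
qed (use assms in simp)

definition W_lattice :: "'i expo set"
  where "W_lattice = Wmap ` {w. Poly_Mapping.keys w \<subseteq> I \<times> qt_lattice}"

lemma W_lattice_zero: "0 \<in> W_lattice"
  unfolding W_lattice_def by (rule image_eqI[of _ _ 0]) (simp_all add: Wmap_def)

lemma W_lattice_add:
  assumes "u \<in> W_lattice" "v \<in> W_lattice"
  shows "u + v \<in> W_lattice" "W_coords (u + v) = W_coords u + W_coords v"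
proof -
  obtain x y where xy: "Poly_Mapping.keys x \<subseteq> I \<times> qt_lattice" "u = Wmap x"
      "Poly_Mapping.keys y \<subseteq> I \<times> qt_lattice" "v = Wmap y"
    using assms by (auto simp: W_lattice_def)
  have sum: "u + v = Wmap (x + y)" "Poly_Mapping.keys (x + y) \<subseteq> I \<times> qt_lattice"
    using xy Poly_Mapping.keys_add[of x y] by (auto simp: Wmap_def frag_extend_add)
  then show "u + v \<in> W_lattice"
    by (auto simp: W_lattice_def)
  show "W_coords (u + v) = W_coords u + W_coords v"
    using W_coords_Wmap[OF sum(2)] W_coords_Wmap[OF xy(1)] W_coords_Wmap[OF xy(3)]
    by (simp only: sum(1)[symmetric] xy(2,4)[symmetric])
qed

lemma W_lattice_uminus: "u \<in> W_lattice \<Longrightarrow> - u \<in> W_lattice"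
  unfolding W_lattice_def Wmap_def image_iff Bex_def mem_Collect_eq
  by (metis frag_extend_minus keys_minus)

lemma Wexp_eq_Wmap: "Wexp i a = Wmap (frag_of (i, a))"
  by (simp add: Wmap_def)

lemma Wexp_in_W_lattice: "i \<in> I \<Longrightarrow> a \<in> qt_lattice \<Longrightarrow> Wexp i a \<in> W_lattice"
  unfolding Wexp_eq_Wmap W_lattice_def by auto

definition W_integral :: "'i laurent_alpha set"
  where "W_integral = {P. \<forall>u. poly (Poly_Mapping.lookup P u) 0 \<noteq> 0 \<longrightarrow> u \<in> W_lattice}"

lemma W_integral_diff: "P \<in> W_integral \<Longrightarrow> Q \<in> W_integral \<Longrightarrow> P - Q \<in> W_integral"
  unfolding W_integral_def mem_Collect_eq lookup_minus poly_diff by (metis diff_0_right)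

lemma W_integral_single:
  "Poly_Mapping.single u p \<in> W_integral \<longleftrightarrow> poly p 0 = 0 \<or> u \<in> W_lattice"
  by (auto simp: W_integral_def lookup_single when_def)

lemma W_integral_add: "P \<in> W_integral \<Longrightarrow> Q \<in> W_integral \<Longrightarrow> P + Q \<in> W_integral"
  unfolding W_integral_def mem_Collect_eq lookup_add poly_add by (metis add_0)

lemma W_integral_zero: "0 \<in> W_integral"
  by (simp add: W_integral_def)

lemma W_integral_sum: "(\<And>x. x \<in> A \<Longrightarrow> g x \<in> W_integral) \<Longrightarrow> sum g A \<in> W_integral"
  by (induction A rule: infinite_finite_induct) (auto intro: W_integral_add W_integral_zero)

lemma W_integral_mult:
  assumes "P \<in> W_integral" "Q \<in> W_integral"
  shows "P * Q \<in> W_integral"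
proof -
  let ?s = "\<lambda>R u. Poly_Mapping.single u (Poly_Mapping.lookup R u)"
  have "?s P u * ?s Q v \<in> W_integral" for u v
    using assms W_lattice_add(1) unfolding mult_single W_integral_single poly_mult
    by (auto simp: W_integral_def)
  then have "(\<Sum>u\<in>Poly_Mapping.keys P. ?s P u) * (\<Sum>v\<in>Poly_Mapping.keys Q. ?s Q v) \<in> W_integral"
    by (simp only: sum_product W_integral_sum)
  then show ?thesis
    by (simp only: sum_singles)
qed

lemma alpha_mono: "alpha * mono u = Poly_Mapping.single u [:0, 1:]"
  by (simp add: alpha_def scalar_def mono_def mult_single)

lemma Yqt_subset_W_integral: "Yqt \<subseteq> W_integral"
proof
  fix P
  assume "P \<in> Yqt"
  then show "P \<in> W_integral"
    unfolding Yqt_def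
  proof (induction rule: subring_gen.induct)
    case one
    then show ?case
      by (simp add: W_integral_single W_lattice_zero flip: single_one)
  next
    case (gen x)
    then show ?case
    proof -
      have "mono u \<in> W_integral" if "u \<in> W_lattice" for u
        using that by (simp add: mono_def W_integral_single)
      moreover have "alpha * mono u \<in> W_integral" for u
        by (simp add: alpha_mono W_integral_single)
      moreover have "alpha \<in> W_integral"
        by (simp add: alpha_def scalar_def W_integral_single)
      ultimately show ?thesis
        using gen Wexp_in_W_lattice W_lattice_uminus by blast
    qed
  qed (auto intro: W_integral_diff W_integral_mult)
qed

text \<open>\<open>Pi_q\<close> and \<open>Pi_t\<close> are ring homomorphisms on \<open>Yqt\<close> with the prescribed values on generators.\<close>

lemma Pi_q_one: "Pi_q 1 = 1"
  by (simp add: Pi_q_def flip: single_one)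

lemma Pi_q_add: "Pi_q (P + Q) = Pi_q P + Pi_q Q"
  and Pi_q_diff: "Pi_q (P - Q) = Pi_q P - Pi_q Q"
  by (simp_all add: Pi_q_def specialise_add specialise_diff)

lemma Pi_q_mult: "Pi_q (P * Q) = Pi_q P * Pi_q Q"
  unfolding Pi_q_def by (rule specialise_mult) (simp add: frag_extend_add)

lemma Pi_q_alpha: "Pi_q alpha = 1"
  and Pi_q_Y: "Pi_q (mono (Yexp i a)) = Poly_Mapping.single (Yexp i (proj_q a)) 1"
  by (simp_all add: Pi_q_def alpha_def scalar_def mono_def)

lemma W_coords_zero: "W_coords 0 = 0"
  using W_coords_Wmap[of 0] by (simp add: Wmap_def)

lemma Pi_t_one: "Pi_t 1 = 1"
  by (simp add: Pi_t_def W_coords_zero flip: single_one)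

lemma Pi_t_add: "Pi_t (P + Q) = Pi_t P + Pi_t Q"
  and Pi_t_diff: "Pi_t (P - Q) = Pi_t P - Pi_t Q"
  by (simp_all add: Pi_t_def specialise_add specialise_diff)

lemma Pi_t_mult:
  assumes "P \<in> W_integral" "Q \<in> W_integral"
  shows "Pi_t (P * Q) = Pi_t P * Pi_t Q"
  unfolding Pi_t_def
  using assms by (intro specialise_mult) (simp add: W_integral_def W_lattice_add(2) frag_extend_add)

lemma Pi_t_alpha: "Pi_t alpha = 0"
  and Pi_t_alpha_Y: "Pi_t (alpha * mono u) = 0"
  by (simp_all add: Pi_t_def alpha_mono) (simp add: alpha_def scalar_def)

lemma Pi_t_W:
  assumes "i \<in> I" "a \<in> qt_lattice"
  shows "Pi_t (mono (Wexp i a)) = Poly_Mapping.single (frag_of (i, Zindex i a)) 1"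
  using assms W_coords_Wmap[of "frag_of (i, a)"] by (simp add: Pi_t_def mono_def Wexp_eq_Wmap)

text \<open>The quotient of \<open>\<Y>\<^bsub>q,t\<^esub>\<close> by the intersection of the two kernels; its elements are cosets.\<close>

definition ker_q :: "'i laurent_alpha set"
  where "ker_q = {P \<in> Yqt. Pi_q P = 0}"

definition ker_t :: "'i laurent_alpha set"
  where "ker_t = {P \<in> Yqt. Pi_t P = 0}"

definition coset_rel :: "('i laurent_alpha \<times> 'i laurent_alpha) set"
  where "coset_rel = {(P, Q). P \<in> Yqt \<and> Q \<in> Yqt \<and> P - Q \<in> ker_q \<inter> ker_t}"

definition Yqt_tilde :: "'i laurent_alpha set set"
  where "Yqt_tilde = Yqt // coset_rel"

definition Pi_q_tilde :: "'i laurent_alpha set \<Rightarrow> 'i laurent"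
  where "Pi_q_tilde x = the_elem (Pi_q ` x)"

definition Pi_t_tilde :: "'i laurent_alpha set \<Rightarrow> 'i laurent"
  where "Pi_t_tilde x = the_elem (Pi_t ` x)"

lemma Yqt_diff: "P \<in> Yqt \<Longrightarrow> Q \<in> Yqt \<Longrightarrow> P - Q \<in> Yqt"
  and Yqt_mult: "P \<in> Yqt \<Longrightarrow> Q \<in> Yqt \<Longrightarrow> P * Q \<in> Yqt"
  and Yqt_one: "1 \<in> Yqt"
  unfolding Yqt_def by (auto intro: subring_gen.intros)

lemma coset_rel_iff:
  "(P, Q) \<in> coset_rel \<longleftrightarrow> P \<in> Yqt \<and> Q \<in> Yqt \<and> Pi_q P = Pi_q Q \<and> Pi_t P = Pi_t Q"
  by (auto simp: coset_rel_def ker_q_def ker_t_def Pi_q_diff Pi_t_diff intro: Yqt_diff)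

lemma equiv_coset_rel: "equiv Yqt coset_rel"
  by (rule equivI) (auto simp: coset_rel_iff refl_on_def intro: symI transI)

lemma Pi_tilde_coset:
  assumes "P \<in> Yqt"
  shows "Pi_q_tilde (coset_rel `` {P}) = Pi_q P" "Pi_t_tilde (coset_rel `` {P}) = Pi_t P"
proof -
  have "Pi_q ` (coset_rel `` {P}) = {Pi_q P}" "Pi_t ` (coset_rel `` {P}) = {Pi_t P}"
    using assms by (auto simp: coset_rel_iff image_iff)
  then show "Pi_q_tilde (coset_rel `` {P}) = Pi_q P" "Pi_t_tilde (coset_rel `` {P}) = Pi_t P"
    by (simp_all add: Pi_q_tilde_def Pi_t_tilde_def)
qed

text \<open>
  The element of the quotient denoted by an expression \<open>P\<close> in \<open>\<int>[Y\<^bsub>i,a\<^esub>\<^sup>\<plusminus>, \<alpha>]\<close>. For \<open>P\<close> in \<open>Yqt\<close> this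
  is the coset of \<open>P\<close>. In general \<open>P\<close> is first rewritten by \<open>\<alpha>\<^sup>2 = \<alpha>\<close> to an element of \<open>Yqt\<close>: an
  expression such as \<open>\<alpha> Y\<^bsub>i,a\<^esub> Y\<^bsub>j,b\<^esub>\<close> need not lie in \<open>Yqt\<close>, but denotes the coset of
  \<open>\<alpha>\<^sup>2 Y\<^bsub>i,a\<^esub> Y\<^bsub>j,b\<^esub> = (\<alpha> Y\<^bsub>i,a\<^esub>) (\<alpha> Y\<^bsub>j,b\<^esub>)\<close>. If no rewriting exists the result is empty, hence not an
  element of \<open>Yqt_tilde\<close>.
\<close>

definition denotes :: "'i laurent_alpha \<Rightarrow> 'i laurent_alpha set"
  where "denotes P = coset_rel `` {Q \<in> Yqt. (alpha\<^sup>2 - alpha) dvd (P - Q)}"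


lemma denotes_eq_coset:
  assumes "Q \<in> Yqt" "(alpha\<^sup>2 - alpha) dvd (P - Q)"
  shows "denotes P = coset_rel `` {Q}"
proof -
  have eq: "(Q', Q) \<in> coset_rel" if "Q' \<in> Yqt" "(alpha\<^sup>2 - alpha) dvd (P - Q')" for Q'
  proof -
    have "(alpha\<^sup>2 - alpha) dvd (Q' - Q)"
      using dvd_diff[OF assms(2) that(2)] by simp
    then obtain R where R: "Q' - Q = (alpha\<^sup>2 - alpha) * R"
      by (elim dvdE)
    have "Pi_q (Q' - Q) = 0"
      by (simp add: R Pi_q_mult Pi_q_diff Pi_q_alpha power2_eq_square)
    moreover have "Pi_t (Q' - Q) = 0"
    proof -
      have "alpha\<^sup>2 - alpha = (scalar [:0, - 1, 1:] :: 'i laurent_alpha)"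
        by (simp add: alpha_def scalar_def power2_eq_square mult_single flip: single_diff)
      then show ?thesis
        unfolding R Pi_t_def by (simp only: specialise_scalar) simp
    qed
    ultimately show ?thesis
      using that(1) assms(1) by (simp add: coset_rel_iff Pi_q_diff Pi_t_diff)
  qed
  show ?thesis
  proof
    show "denotes P \<subseteq> coset_rel `` {Q}"
      using eq unfolding denotes_def coset_rel_iff by (auto simp: coset_rel_iff)
    show "coset_rel `` {Q} \<subseteq> denotes P"
      using assms unfolding denotes_def by blast
  qed
qed

lemma denotes_Yqt: "P \<in> Yqt \<Longrightarrow> denotes P = coset_rel `` {P}"
  by (rule denotes_eq_coset) simp_all


section \<open>The subalgebras\<close>

definition Aexp :: "'i \<Rightarrow> complex \<Rightarrow> 'i expo"
  where "Aexp i a = Yexp i (a / (q ^ r i * t)) + Yexp i (a * (q ^ r i * t))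
    - (\<Sum>j\<in>{j \<in> I. C j i = - 1}. Yexp j a)
    - (\<Sum>j\<in>{j \<in> I. C j i = - 2}. Yexp j (a / q) + Yexp j (a * q))"

lemma qt_lattice_t: "a * t \<in> qt_lattice" "a / t \<in> qt_lattice" if a: "a \<in> qt_lattice"
proof -
  obtain l m where a: "a = q powi l * t powi m"
    using a by (auto simp: qt_lattice_def)
  have "a * t = q powi l * t powi (m + 1)" "a / t = q powi l * t powi (m - 1)"
    using t_nonzero by (simp_all add: a power_int_add power_int_diff)
  then show "a * t \<in> qt_lattice" "a / t \<in> qt_lattice"
    unfolding qt_lattice_def by blast+
qed

lemma qt_lattice_qpow: "a * q ^ k \<in> qt_lattice" "a / q ^ k \<in> qt_lattice" if "a \<in> qt_lattice"
  using qt_lattice_q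
  by (induction k; simp add: that; metis mult.assoc mult.commute divide_divide_eq_left)+

definition supported :: "'i expo \<Rightarrow> bool"
  where "supported u \<longleftrightarrow> Poly_Mapping.keys u \<subseteq> I \<times> qt_lattice"

lemma supported_zero: "supported 0"
  and supported_add: "supported u \<Longrightarrow> supported v \<Longrightarrow> supported (u + v)"
  and supported_diff: "supported u \<Longrightarrow> supported v \<Longrightarrow> supported (u - v)"
  and supported_Y: "i \<in> I \<Longrightarrow> a \<in> qt_lattice \<Longrightarrow> supported (Yexp i a)"
  unfolding supported_def using Poly_Mapping.keys_add[of u v] keys_diff[of u v] by auto

lemma supported_sum: "(\<And>x. x \<in> A \<Longrightarrow> supported (g x)) \<Longrightarrow> supported (sum g A)"
  by (induction A rule: infinite_finite_induct) (auto intro: supported_add supported_zero)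

lemma supported_Wexp: "i \<in> I \<Longrightarrow> a \<in> qt_lattice \<Longrightarrow> supported (Wexp i a)"
  by (simp add: Wexp_def supported_Y supported_add qt_lattice_q)

lemma supported_Aexp: "i \<in> I \<Longrightarrow> a \<in> qt_lattice \<Longrightarrow> supported (Aexp i a)"
proof -
  assume i: "i \<in> I" and a: "a \<in> qt_lattice"
  have "a / (q ^ r i * t) \<in> qt_lattice" "a * (q ^ r i * t) \<in> qt_lattice"
    using qt_lattice_t[OF qt_lattice_qpow(2)[OF a, of "r i"]]
      qt_lattice_t[OF qt_lattice_qpow(1)[OF a, of "r i"]] by (simp_all add: mult.assoc)
  then show ?thesis
    unfolding Aexp_def using i a
    by (intro supported_diff supported_add supported_sum supported_Y) (auto intro: qt_lattice_q)
qed

lemma W_lattice_diff: "u \<in> W_lattice \<Longrightarrow> v \<in> W_lattice \<Longrightarrow> u - v \<in> W_lattice"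
  using W_lattice_add(1)[of u "- v"] W_lattice_uminus[of v] by simp

lemma W_lattice_sum: "(\<And>x. x \<in> A \<Longrightarrow> g x \<in> W_lattice) \<Longrightarrow> sum g A \<in> W_lattice"
  by (induction A rule: infinite_finite_induct) (auto intro: W_lattice_add W_lattice_zero)

lemma W_lattice_Y_pair:
  assumes "j \<in> I" "a \<in> qt_lattice"
  shows "Yexp j (a / q) + Yexp j (a * q) \<in> W_lattice"
proof (cases "r j = 2")
  case True
  then have "Yexp j b = Wexp j b" for b
    by (simp add: Wexp_def)
  then show ?thesis
    using assms by (simp add: W_lattice_add Wexp_in_W_lattice qt_lattice_q)
next
  case False
  then show ?thesis
    using assms Wexp_in_W_lattice[of j a] by (simp add: Wexp_def)
qed

lemma Aexp_in_W_lattice: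
  assumes i: "i \<in> I" "r i = 2" and a: "a \<in> qt_lattice"
  shows "Aexp i a \<in> W_lattice"
proof -
  have "Yexp j b \<in> W_lattice" if "j \<in> I" "r j = 2" "b \<in> qt_lattice" for j b
    using Wexp_in_W_lattice[of j b] that by (simp add: Wexp_def)
  moreover have "r j = 2" if "j \<in> I" "C j i = - 1" for j
    using symmetrised[OF that(1) i(1)] r_values[OF that(1)] that(2) i(2) by auto presburger
  moreover have "a / (q ^ r i * t) \<in> qt_lattice" "a * (q ^ r i * t) \<in> qt_lattice"
    using qt_lattice_t[OF qt_lattice_qpow(2)[OF a, of "r i"]]
      qt_lattice_t[OF qt_lattice_qpow(1)[OF a, of "r i"]] by (simp_all add: mult.assoc)
  ultimately have "Yexp i (a / (q ^ r i * t)) + Yexp i (a * (q ^ r i * t)) \<in> W_lattice"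
    and "\<And>j. j \<in> {j \<in> I. C j i = - 1} \<Longrightarrow> Yexp j a \<in> W_lattice"
    using i a W_lattice_add(1) by simp_all
  moreover have "\<And>j. j \<in> {j \<in> I. C j i = - 2} \<Longrightarrow> Yexp j (a / q) + Yexp j (a * q) \<in> W_lattice"
    using a W_lattice_Y_pair by simp
  ultimately show ?thesis
    unfolding Aexp_def by (intro W_lattice_diff W_lattice_sum)
qed

lemma Aexp_pair_in_W_lattice:
  assumes i: "i \<in> I" "r i = 1" and b: "b \<in> qt_lattice"
  shows "Aexp i (b * q) + Aexp i (b / q) \<in> W_lattice"
proof -
  have bt: "b / t \<in> qt_lattice" "b * t \<in> qt_lattice"
    using qt_lattice_t b by blast+
  let ?P = "\<lambda>j b. Yexp j (b / q) + Yexp j (b * q)"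
  have "Aexp i (b * q) + Aexp i (b / q)
      = ?P i (b / t / q) + ?P i (b * t * q)
        - (\<Sum>j\<in>{j \<in> I. C j i = - 1}. ?P j b)
        - (\<Sum>j\<in>{j \<in> I. C j i = - 2}. ?P j (b / q) + ?P j (b * q))"
    using q_nonzero i(2) by (simp add: Aexp_def sum.distrib algebra_simps divide_simps)
  also have "\<dots> \<in> W_lattice"
  proof -
    have "b / t / q \<in> qt_lattice" "b * t * q \<in> qt_lattice" "b / q \<in> qt_lattice" "b * q \<in> qt_lattice"
      using b bt qt_lattice_q by blast+
    then have "?P i (b / t / q) + ?P i (b * t * q) \<in> W_lattice"
      and "\<And>j. j \<in> {j \<in> I. C j i = - 1} \<Longrightarrow> ?P j b \<in> W_lattice"
      and "\<And>j. j \<in> {j \<in> I. C j i = - 2} \<Longrightarrow> ?P j (b / q) + ?P j (b * q) \<in> W_lattice"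
      using i b by (simp_all only: W_lattice_Y_pair W_lattice_add(1) mem_Collect_eq)
    then show ?thesis
      by (intro W_lattice_diff W_lattice_sum)
  qed
  finally show ?thesis .
qed

abbreviation Ainv :: "'i \<Rightarrow> complex \<Rightarrow> 'i laurent_alpha"
  where "Ainv i a \<equiv> mono (- Aexp i a)"

definition K_generators_self :: "'i \<Rightarrow> 'i laurent_alpha set"
  where "K_generators_self i =
    (if r i = 1 then
       {mono (Wexp i a) *
          (1 + alpha * Ainv i (a * q\<^sup>2 * t) + Ainv i (a * q\<^sup>2 * t) * Ainv i (a * t)) | a.
          a \<in> qt_lattice} \<union>
       {alpha * mono (Yexp i a) * (1 + Ainv i (a * q * t)) | a. a \<in> qt_lattice}
     else
       {mono (Yexp i a) * (1 + Ainv i (a * q\<^sup>2 * t)) | a. a \<in> qt_lattice})"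

definition K_sub :: "'i \<Rightarrow> 'i laurent_alpha set"
  where "K_sub i = subring_gen
    (K_generators_self i \<union>
     {mono (Wexp j a) | j a. j \<in> I - {i} \<and> a \<in> qt_lattice} \<union>
     {mono (- Wexp j a) | j a. j \<in> I - {i} \<and> a \<in> qt_lattice} \<union>
     {alpha * mono (Yexp j a) | j a. j \<in> I - {i} \<and> a \<in> qt_lattice} \<union>
     {alpha * mono (- Yexp j a) | j a. j \<in> I - {i} \<and> a \<in> qt_lattice} \<union>
     {alpha})"

text \<open>Every element of \<open>K_sub i\<close> denotes an element of the quotient.\<close>

definition representable :: "'i laurent_alpha \<Rightarrow> bool"
  where "representable P \<longleftrightarrow> (\<exists>Q\<in>Yqt. (alpha\<^sup>2 - alpha) dvd (P - Q))"

lemma representable_denotes: "representable P \<Longrightarrow> denotes P \<in> Yqt_tilde"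
  unfolding representable_def Yqt_tilde_def using denotes_eq_coset by (metis quotientI)

lemma representable_Yqt: "P \<in> Yqt \<Longrightarrow> representable P"
  unfolding representable_def by (intro bexI[of _ P]) simp_all

lemma representable_cong:
  assumes "representable P" "(alpha\<^sup>2 - alpha) dvd (P' - P)"
  shows "representable P'"
proof -
  obtain Q where Q: "Q \<in> Yqt" "(alpha\<^sup>2 - alpha) dvd (P - Q)"
    using assms(1) by (auto simp: representable_def)
  have "(alpha\<^sup>2 - alpha) dvd (P' - Q)"
    using dvd_add[OF assms(2) Q(2)] by simp
  then show ?thesis
    using Q(1) by (auto simp: representable_def)
qed

lemma representable_diff:
  assumes "representable P" "representable P'"
  shows "representable (P - P')"
proof -
  obtain Q Q' where Q: "Q \<in> Yqt" "(alpha\<^sup>2 - alpha) dvd (P - Q)"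
      "Q' \<in> Yqt" "(alpha\<^sup>2 - alpha) dvd (P' - Q')"
    using assms unfolding representable_def by blast
  have "(alpha\<^sup>2 - alpha) dvd ((P - P') - (Q - Q'))"
    using dvd_diff[OF Q(2) Q(4)] by (simp add: algebra_simps)
  then show ?thesis
    using Q Yqt_diff unfolding representable_def by blast
qed

lemma representable_mult:
  assumes "representable P" "representable P'"
  shows "representable (P * P')"
proof -
  obtain Q Q' where Q: "Q \<in> Yqt" "(alpha\<^sup>2 - alpha) dvd (P - Q)"
      "Q' \<in> Yqt" "(alpha\<^sup>2 - alpha) dvd (P' - Q')"
    using assms unfolding representable_def by blast
  have "(alpha\<^sup>2 - alpha) dvd ((P - Q) * P' + Q * (P' - Q'))"
    using Q by (intro dvd_add dvd_mult dvd_mult2)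
  moreover have "(P - Q) * P' + Q * (P' - Q') = P * P' - Q * Q'"
    by (simp add: algebra_simps)
  ultimately show ?thesis
    using Q Yqt_mult unfolding representable_def by metis
qed

lemma representable_add: "representable P \<Longrightarrow> representable P' \<Longrightarrow> representable (P + P')"
  using representable_diff[of P "0 - P'"] representable_diff[of 0 P']
    representable_diff[of 1 1] representable_Yqt[OF Yqt_one] by simp

lemma mono_add: "mono (u + v) = mono u * mono v"
  by (simp add: mono_def mult_single)

lemma Yqt_gens:
  assumes "i \<in> I" "a \<in> qt_lattice"
  shows "mono (Wexp i a) \<in> Yqt" "mono (- Wexp i a) \<in> Yqt"
    "alpha * mono (Yexp i a) \<in> Yqt" "alpha * mono (- Yexp i a) \<in> Yqt"
  unfolding Yqt_def using assms by (blast intro: subring_gen.gen)+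

lemma alpha_Yqt: "alpha \<in> Yqt"
  unfolding Yqt_def by (blast intro: subring_gen.gen)

lemma mono_W_lattice_Yqt: "u \<in> W_lattice \<Longrightarrow> mono u \<in> Yqt"
proof -
  assume "u \<in> W_lattice"
  then obtain w where w: "Poly_Mapping.keys w \<subseteq> I \<times> qt_lattice" "u = Wmap w"
    by (auto simp: W_lattice_def)
  from w(1) have "mono (Wmap w) \<in> Yqt \<and> mono (- Wmap w) \<in> Yqt"
  proof (induction w rule: frag_induction)
    case zero
    then show ?case
      using Yqt_one by (simp add: Wmap_def mono_def)
  next
    case (one x)
    then show ?case
      using Yqt_gens by (cases x) (simp flip: Wexp_eq_Wmap)
  next
    case (diff x y)
    have "mono (Wmap (x - y)) = mono (Wmap x) * mono (- Wmap y)"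
      "mono (- Wmap (x - y)) = mono (Wmap y) * mono (- Wmap x)"
      unfolding Wmap_def frag_extend_diff by (simp_all flip: mono_add)
    then show ?case
      using diff Yqt_mult by simp
  qed
  then show ?thesis
    using w(2) by simp
qed

lemma alpha_mono_representable: "supported u \<Longrightarrow> representable (alpha * mono u)"
proof -
  assume "supported u"
  then have "representable (alpha * mono u) \<and> representable (alpha * mono (- u))"
    unfolding supported_def
  proof (induction u rule: frag_induction)
    case zero
    then show ?case
      using representable_Yqt[OF alpha_Yqt] by (simp add: mono_def)
  next
    case (one x)
    then show ?case
      using representable_Yqt Yqt_gens(3,4) by (cases x) simp
  next
    case (diff x y)
    have *: "representable (alpha * mono (x - y))"
      if "representable (alpha * mono x)" "representable (alpha * mono (- y))" for x y
    proof (rule representable_cong[OF representable_mult[OF that]])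
      have "alpha * mono (x - y) - alpha * mono x * (alpha * mono (- y))
          = (alpha\<^sup>2 - alpha) * (- mono (x - y))"
        using mono_add[of x "- y"] by (simp add: algebra_simps power2_eq_square)
      then show "(alpha\<^sup>2 - alpha) dvd (alpha * mono (x - y) - alpha * mono x * (alpha * mono (- y)))"
        by (metis dvd_triv_left)
    qed
    from *[of x y] *[of y x] diff show ?case
      by simp
  qed
  then show ?thesis
    by simp
qed

lemma K_generators_self_representable:
  assumes i: "i \<in> I" and P: "P \<in> K_generators_self i"
  shows "representable P"
proof (cases "r i = 1")
  case True
  then consider
    a where "a \<in> qt_lattice" "P = mono (Wexp i a) *
          (1 + alpha * Ainv i (a * q\<^sup>2 * t) + Ainv i (a * q\<^sup>2 * t) * Ainv i (a * t))"
    | a where "a \<in> qt_lattice" "P = alpha * mono (Yexp i a) * (1 + Ainv i (a * q * t))"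
    using P unfolding K_generators_self_def by auto
  then show ?thesis
  proof cases
    case (1 a)
    let ?b = "a * q\<^sup>2 * t" and ?c = "a * t" and ?d = "a * q * t"
    have lat: "?b \<in> qt_lattice" "?d \<in> qt_lattice"
      using 1(1) qt_lattice_t(1) qt_lattice_qpow(1) qt_lattice_q(1) by blast+
    have bc: "?d * q = ?b" "?d / q = ?c"
      using q_nonzero by (simp_all add: power2_eq_square)
    have "P = mono (Wexp i a) + alpha * mono (Wexp i a - Aexp i ?b)
        + mono (Wexp i a - (Aexp i ?b + Aexp i ?c))"
      unfolding 1(2) by (simp add: algebra_simps flip: mono_add)
    moreover have "representable (mono (Wexp i a))"
      using 1(1) i by (intro representable_Yqt Yqt_gens)
    moreover have "representable (alpha * mono (Wexp i a - Aexp i ?b))"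
      using 1(1) i lat by (intro alpha_mono_representable supported_diff supported_Wexp supported_Aexp)
    moreover have "representable (mono (Wexp i a - (Aexp i ?b + Aexp i ?c)))"
      using 1(1) i lat True Aexp_pair_in_W_lattice[of i ?d] unfolding bc
      by (intro representable_Yqt mono_W_lattice_Yqt W_lattice_diff Wexp_in_W_lattice)
    ultimately show ?thesis
      by (simp add: representable_add)
  next
    case (2 a)
    have "a * q * t \<in> qt_lattice"
      using 2(1) qt_lattice_t(1) qt_lattice_q(1) by blast
    moreover have "P = alpha * mono (Yexp i a) + alpha * mono (Yexp i a - Aexp i (a * q * t))"
      unfolding 2(2) by (simp add: algebra_simps flip: mono_add)
    ultimately show ?thesis
      using 2(1) i
      by (simp add: representable_add alpha_mono_representable supported_diff supported_Y supported_Aexp)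
  qed
next
  case False
  then have r: "r i = 2"
    using r_values[OF i] by simp
  obtain a where a: "a \<in> qt_lattice" "P = mono (Yexp i a) * (1 + Ainv i (a * q\<^sup>2 * t))"
    using False P unfolding K_generators_self_def by auto
  have lat: "a * q\<^sup>2 * t \<in> qt_lattice"
    using a(1) qt_lattice_t(1) qt_lattice_qpow(1) by blast
  have "P = mono (Wexp i a) + mono (Wexp i a - Aexp i (a * q\<^sup>2 * t))"
    unfolding a(2) using r by (simp add: Wexp_def algebra_simps flip: mono_add)
  moreover have "Wexp i a - Aexp i (a * q\<^sup>2 * t) \<in> W_lattice"
    using i r a(1) lat by (intro W_lattice_diff Wexp_in_W_lattice Aexp_in_W_lattice)
  ultimately show ?thesis
    using i a(1) by (simp add: representable_add representable_Yqt Yqt_gens mono_W_lattice_Yqt)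
qed

lemma K_sub_denotes:
  assumes i: "i \<in> I" and P: "P \<in> K_sub i"
  shows "denotes P \<in> Yqt_tilde"
proof (rule representable_denotes)
  from P show "representable P"
    unfolding K_sub_def
  proof (induction rule: subring_gen.induct)
    case one
    then show ?case
      using representable_Yqt Yqt_one by blast
  next
    case (gen x)
    then show ?case
      using K_generators_self_representable[OF i] representable_Yqt Yqt_gens alpha_Yqt by blast
  qed (auto intro: representable_diff representable_mult)
qed

definition frakK :: "'i laurent_alpha set set"
  where "frakK = (\<Inter>i\<in>I. denotes ` K_sub i)"


section \<open>Monomials\<close>

definition monomial_expr :: "int \<Rightarrow> int \<Rightarrow> 'i expo \<Rightarrow> 'i laurent_alpha"
  where "monomial_expr lam mu u = scalar [:lam, mu:] * mono u"

text \<open>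
  \<open>\<mu>\<alpha> \<Prod> Y\<^bsub>i,a\<^esub>\<^bsup>u(i,a)\<^esup>\<close> is an element of the quotient for every \<open>u\<close>, whereas \<open>\<lambda> + \<mu>\<alpha>\<close> with \<open>\<lambda> \<noteq> 0\<close>
  requires \<open>u\<close> to be in \<open>W_lattice\<close>; this is enforced by \<open>m \<in> Yqt_tilde\<close>.
\<close>

definition is_monomial :: "int \<Rightarrow> int \<Rightarrow> 'i expo \<Rightarrow> 'i laurent_alpha set \<Rightarrow> bool"
  where "is_monomial lam mu u m \<longleftrightarrow>
    m \<in> Yqt_tilde \<and> Poly_Mapping.keys u \<subseteq> I \<times> qt_lattice \<and> m = denotes (monomial_expr lam mu u)"

definition is_dominant_monomial :: "int \<Rightarrow> int \<Rightarrow> 'i expo \<Rightarrow> 'i laurent_alpha set \<Rightarrow> bool"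
  where "is_dominant_monomial lam mu u m \<longleftrightarrow> is_monomial lam mu u m \<and> dominant_expo u"

definition unique_dominant_monomial :: "'i laurent_alpha set \<Rightarrow> 'i laurent_alpha set \<Rightarrow> bool"
  where "unique_dominant_monomial m F \<longleftrightarrow>
    no_dominant (Pi_q_tilde F - Pi_q_tilde m) \<and> no_dominant (Pi_t_tilde F - Pi_t_tilde m)"

definition C_support :: "'i expo \<Rightarrow> complex set"
  where "C_support u = {a \<in> qt_lattice. \<exists>i\<in>I. Poly_Mapping.lookup u (i, a) \<noteq> 0}"

definition D_set :: "int \<Rightarrow> int \<Rightarrow> 'i expo \<Rightarrow> 'i laurent_alpha set"
  where "D_set lam mu u =
    {monomial_expr lam mu u * prod_list (map (\<lambda>(i, a). Ainv i a) ias) | ias.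
      set ias \<subseteq> I \<times> {c * q ^ k * t ^ l | c k l. c \<in> C_support u \<and> 1 \<le> k \<and> 1 \<le> l}}"

text \<open>
  As \<open>D_set\<close>, this is attached to an expression of the monomial \<open>m\<close>: the same element of the quotient
  may be represented with different \<open>u\<close>, since for instance \<open>\<alpha> Y\<^bsub>i,q\<^esub> = \<alpha> Y\<^bsub>i,qt\<^esub>\<close> there.
\<close>

definition D_tilde :: "int \<Rightarrow> int \<Rightarrow> 'i expo \<Rightarrow> 'i laurent_alpha set set"
  where "D_tilde lam mu u =
    {coset_rel `` {P} | P. P \<in> Yqt \<and>
      (\<exists>S c. finite S \<and> S \<subseteq> D_set lam mu u \<and> P = (\<Sum>d\<in>S. scalar (c d) * d))}"

end

end

theory Submission
  imports Defs "HOL-Analysis.Function_Topology"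
begin

text \<open>
  Sending \<open>\<alpha>\<close> to \<open>(1, 0)\<close> identifies the quotient ring with \<open>\<Y>\<^sub>q \<times> \<Y>\<^sub>t\<^sup>L\<close>, and the subalgebras and the
  sets of monomials split accordingly, so that it suffices to solve the problem in both factors. These
  are instances of one combinatorial situation. There, an element of the intersection of the
  subrings \<open>K\<^sub>i\<close> without dominant monomials vanishes, since its maximal monomials are dominant. For
  existence, the coefficients are determined one depth below the leading monomial \<open>M\<close> at a time: a
  coefficient at a non-dominant monomial is forced by every colour \<open>i\<close> for which it is not
  \<open>i\<close>-dominant, and two such colours agree because the fundamental solutions in rank two are known
  explicitly. The process stops because all weights that occur are at most as long as the weight
  of \<open>M\<close> for the positive definite form of the Cartan matrix: from any monomial that is not dominant one
  can pass to a higher one of at least the same length.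
\<close>

text \<open>The obstacle to existence is finiteness: fixing coefficients depth by depth a priori
  yields an infinite series. Expansions in one colour move a weight only along a root string, from a
  point to one between it and its reflection, where lengths cannot grow. The same estimate, applied
  to the truncated one-colour expansions, turns agreement up to a large depth into equality. The
  restriction on the parameters of \<open>D_tilde\<close> is handled by degrees. At
  \<open>t = 1\<close> the exponent of \<open>t\<close> is invisible, and at
  \<open>q = epsilon\<close> the exponent of \<open>q\<close> only matters modulo a small number.
  This freedom allows every \<open>A v\<close> at a vertex of degree at least that of some variable
  of the leading monomial to be lifted with both exponents strictly larger than those of a variable
  of \<open>m\<close>. The second factor has the transposed Cartan matrix. It belongs to twisted
  type, which is why a fundamental solution with six terms appears beside the familiar ones of type
  B2.\<close>

abbreviation keys :: "('a \<Rightarrow>\<^sub>0 'b::zero) \<Rightarrow> 'a set"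
  where "keys \<equiv> Poly_Mapping.keys"

abbreviation lookup :: "('a \<Rightarrow>\<^sub>0 'b::zero) \<Rightarrow> 'a \<Rightarrow> 'b"
  where "lookup \<equiv> Poly_Mapping.lookup"

section \<open>Free abelian groups\<close>

definition nonneg :: "('a \<Rightarrow>\<^sub>0 int) \<Rightarrow> bool"
  where "nonneg u \<longleftrightarrow> (\<forall>k. 0 \<le> lookup u k)"

lemma nonneg_zero [simp]: "nonneg 0"
  by (simp add: nonneg_def)

lemma nonneg_add: "nonneg u \<Longrightarrow> nonneg v \<Longrightarrow> nonneg (u + v)"
  by (simp add: nonneg_def lookup_add)

lemma nonneg_frag_of [simp]: "nonneg (frag_of a)"
  by (simp add: nonneg_def)

lemma lookup_frag_extend:
  "lookup (frag_extend f u) x = (\<Sum>k\<in>keys u. lookup u k * lookup (f k) x)"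
  by (simp add: frag_extend_def lookup_sum)

lemma nonneg_frag_extend: "nonneg u \<Longrightarrow> (\<And>k. nonneg (f k)) \<Longrightarrow> nonneg (frag_extend f u)"
  by (simp add: nonneg_def lookup_frag_extend sum_nonneg)

lemma nonneg_add_eq_0: "nonneg u \<Longrightarrow> nonneg v \<Longrightarrow> u + v = 0 \<Longrightarrow> u = 0"
  by (simp add: nonneg_def poly_mapping_eq_iff fun_eq_iff lookup_add add_nonneg_eq_0_iff)

lemma keys_add_subset: "keys u \<subseteq> X \<Longrightarrow> keys v \<subseteq> X \<Longrightarrow> keys (u + v) \<subseteq> X"
  using Poly_Mapping.keys_add[of u v] by blast

lemma keys_diff_subset: "keys u \<subseteq> X \<Longrightarrow> keys v \<subseteq> X \<Longrightarrow> keys (u - v) \<subseteq> X"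
  using keys_diff[of u v] by blast

lemma keys_frag_extend_subset:
  "(\<And>k. k \<in> keys u \<Longrightarrow> keys (f k) \<subseteq> X) \<Longrightarrow> keys (frag_extend f u) \<subseteq> X"
  using keys_frag_extend[of f u] by blast

text \<open>The sum of all coefficients, written as the homomorphism induced by the map to a
  one-point set, so that additivity is inherited from \<open>frag_extend\<close>.\<close>

definition tot :: "('a \<Rightarrow>\<^sub>0 int) \<Rightarrow> int"
  where "tot u = lookup (frag_extend (\<lambda>_. frag_of ()) u) ()"

lemma tot_add: "tot (u + v) = tot u + tot v"
  and tot_diff: "tot (u - v) = tot u - tot v"
  and tot_zero [simp]: "tot 0 = 0"
  and tot_frag_of [simp]: "tot (frag_of a) = 1"
  by (simp_all add: tot_def frag_extend_add frag_extend_diff lookup_add lookup_minus)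

lemma tot_nonneg: "nonneg u \<Longrightarrow> 0 \<le> tot u"
  by (simp add: nonneg_def tot_def lookup_frag_extend sum_nonneg)

lemma tot_eq_0: "nonneg u \<Longrightarrow> tot u = 0 \<longleftrightarrow> u = 0"
  unfolding tot_def lookup_frag_extend nonneg_def
  by (subst sum_nonneg_eq_0_iff) (auto simp: in_keys_iff poly_mapping_eq_iff fun_eq_iff)

lemma tot_pos: "nonneg u \<Longrightarrow> u \<noteq> 0 \<Longrightarrow> 0 < tot u"
  using tot_nonneg[of u] tot_eq_0[of u] by linarith

definition part :: "'a set \<Rightarrow> ('a \<Rightarrow>\<^sub>0 int) \<Rightarrow> ('a \<Rightarrow>\<^sub>0 int)"
  where "part S u = frag_extend (\<lambda>k. if k \<in> S then frag_of k else 0) u"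

lemma lookup_part: "lookup (part S u) k = (if k \<in> S then lookup u k else 0)"
proof -
  have "lookup (part S u) k = (\<Sum>j\<in>keys u. if j = k then (if k \<in> S then lookup u k else 0) else 0)"
    unfolding part_def lookup_frag_extend by (intro sum.cong) auto
  then show ?thesis
    by (auto simp: sum.delta in_keys_iff)
qed

lemma keys_part: "keys (part S u) = keys u \<inter> S"
  by (auto simp: in_keys_iff lookup_part split: if_splits)

lemma frag_of_mult: "frag_of u * frag_of v = frag_of (u + v)"
  by (simp add: mult_single)

lemma lookup_shift:
  fixes P :: "('a \<Rightarrow>\<^sub>0 int) \<Rightarrow>\<^sub>0 int"
  shows "lookup (frag_of u * P) x = lookup P (x - u)"
  using subset_UNIV[of "keys P"]
  by (induction P rule: frag_induction)
    (auto simp: frag_of_mult right_diff_distrib lookup_minus algebra_simps)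

lemma keys_shift:
  fixes P :: "('a \<Rightarrow>\<^sub>0 int) \<Rightarrow>\<^sub>0 int"
  shows "keys (frag_of u * P) = (\<lambda>x. u + x) ` keys P"
proof -
  have "x \<in> (+) u ` keys P" if "x - u \<in> keys P" for x
    using that by (intro image_eqI[of _ _ "x - u"]) auto
  then show ?thesis
    by (auto simp: in_keys_iff lookup_shift)
qed

text \<open>Splits a monomial into powers of single variables from \<open>S\<close> and a remainder.
  Multiplying each variable by its own factor then produces products of generators or of fundamental
  solutions.\<close>

lemma frag_of_split:
  assumes "finite S" "\<And>v. v \<in> S \<Longrightarrow> 0 \<le> lookup u v"
  shows "frag_of u = frag_of (part (- S) u) * (\<Prod>v\<in>S. frag_of (frag_of v) ^ nat (lookup u v))"
  using assms
proof (induction S rule: finite_induct)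
  case empty
  have "part UNIV u = u"
    by (rule poly_mapping_eqI) (simp add: lookup_part)
  then show ?case
    by simp
next
  case (insert v S)
  have pow: "frag_of (frag_cmul (int k) w) = frag_of w ^ k" for k and w :: "'a \<Rightarrow>\<^sub>0 int"
    by (induction k) (simp_all add: frag_cmul_distrib flip: frag_of_mult)
  have "part (- S) u = part (- insert v S) u + frag_cmul (lookup u v) (frag_of v)"
    using insert.hyps by (intro poly_mapping_eqI) (simp add: lookup_part lookup_add)
  moreover have "frag_of (frag_cmul (lookup u v) (frag_of v)) = frag_of (frag_of v) ^ nat (lookup u v)"
    using pow[of "nat (lookup u v)" "frag_of v"] insert.prems[of v] by simp
  ultimately have "frag_of (part (- S) u) = frag_of (part (- insert v S) u) * frag_of (frag_of v) ^ nat (lookup u v)"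
    by (simp flip: frag_of_mult)
  then show ?case
    using insert by (simp add: mult.assoc)
qed

lemma finite_argmax:
  fixes f :: "'a \<Rightarrow> int"
  assumes "finite S" "x \<in> S"
  shows "\<exists>w\<in>S. \<forall>w'\<in>S. f w' \<le> f w"
proof -
  have "Max (f ` S) \<in> f ` S"
    using assms by (intro Max_in) auto
  then obtain w where "w \<in> S" "f w = Max (f ` S)"
    by force
  then show ?thesis
    using assms(1) by (intro bexI[of _ w]) auto
qed

section \<open>Systems of vertices\<close>

text \<open>
  A vertex \<open>v\<close> stands for a variable \<open>Y\<^bsub>i,a\<^esub>\<close> of colour \<open>i\<close>, \<open>up v\<close> for \<open>Y\<^bsub>i,aq\<^sub>i\<^sup>2\<^esub>\<close>, and \<open>A v\<close> for the
  exponent of \<open>A\<^bsub>i,aq\<^sub>i\<^esub> = Y\<^bsub>i,a\<^esub> Y\<^bsub>i,aq\<^sub>i\<^sup>2\<^esub> \<Prod>\<^bsub>w \<in> nb v\<^esub> Y\<^sub>w\<^sup>-\<^sup>1\<close>: with this indexing \<open>Y\<^sub>v (1 + A\<^sub>v\<^sup>-\<^sup>1)\<close> is the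
  generator attached to \<open>v\<close>.
\<close>

locale vertex_system =
  fixes V :: "'v set" and col :: "'v \<Rightarrow> 'i" and deg :: "'v \<Rightarrow> int"
    and up :: "'v \<Rightarrow> 'v" and nb :: "'v \<Rightarrow> 'v set"
  assumes up_V: "v \<in> V \<Longrightarrow> up v \<in> V"
    and col_up: "v \<in> V \<Longrightarrow> col (up v) = col v"
    and deg_up: "v \<in> V \<Longrightarrow> deg v < deg (up v)"
    and up_inj: "inj_on up V"
    and nb_finite: "v \<in> V \<Longrightarrow> finite (nb v)"
    and nb_V: "v \<in> V \<Longrightarrow> nb v \<subseteq> V"
    and col_nb: "v \<in> V \<Longrightarrow> w \<in> nb v \<Longrightarrow> col w \<noteq> col v"
    and deg_nb: "v \<in> V \<Longrightarrow> w \<in> nb v \<Longrightarrow> deg v < deg w \<and> deg w < deg (up v)"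
begin

definition A :: "'v \<Rightarrow> 'v \<Rightarrow>\<^sub>0 int"
  where "A v = frag_of v + frag_of (up v) - (\<Sum>w\<in>nb v. frag_of w)"

abbreviation AA :: "('v \<Rightarrow>\<^sub>0 int) \<Rightarrow> 'v \<Rightarrow>\<^sub>0 int"
  where "AA \<equiv> frag_extend A"

lemma lookup_A:
  assumes "v \<in> V"
  shows "lookup (A v) x = (if x = v then 1 else 0) + (if x = up v then 1 else 0)
    - (if x \<in> nb v then 1 else 0)"
proof -
  have "(\<Sum>w\<in>nb v. lookup (frag_of w) x) = (\<Sum>w\<in>nb v. if w = x then 1 else 0)"
    by (intro sum.cong) auto
  also have "\<dots> = (if x \<in> nb v then 1 else 0)"
    using nb_finite[OF assms] by (subst sum.delta) auto
  finally show ?thesis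
    by (simp add: A_def lookup_add lookup_minus lookup_sum)
qed

lemma keys_A: "v \<in> V \<Longrightarrow> keys (A v) \<subseteq> V"
  using up_V nb_V[of v] by (auto simp: in_keys_iff lookup_A split: if_splits)

lemma keys_AA: "keys n \<subseteq> V \<Longrightarrow> keys (AA n) \<subseteq> V"
  using keys_A by (intro keys_frag_extend_subset) blast

text \<open>The vertex of largest degree in a combination of the \<open>A v\<close> is not cancelled.\<close>

lemma AA_eq_0:
  assumes n: "keys n \<subseteq> V" and "AA n = 0"
  shows "n = 0"
proof (rule ccontr)
  assume "n \<noteq> 0"
  define m where "m = Max ((\<lambda>v. deg (up v)) ` keys n)"
  have "m \<in> (\<lambda>v. deg (up v)) ` keys n"
    unfolding m_def using \<open>n \<noteq> 0\<close> by (intro Max_in) auto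
  then obtain v where v: "v \<in> keys n" "deg (up v) = m"
    by auto
  have max: "deg (up w) \<le> deg (up v)" if "w \<in> keys n" for w
    using that v(2) unfolding m_def by (metis Max_ge finite_imageI finite_keys imageI)
  have "lookup (A w) (up v) = (if w = v then 1 else 0)" if w: "w \<in> keys n" for w
  proof -
    have wv: "w \<in> V" "v \<in> V"
      using n w v(1) by auto
    have "up v \<noteq> w"
      using max[OF w] deg_up[of w] wv by force
    moreover have "up v = up w \<longleftrightarrow> v = w"
      using up_inj wv by (auto dest: inj_onD)
    moreover have "up v \<notin> nb w"
      using deg_nb[of w "up v"] max[OF w] wv by force
    ultimately show ?thesis
      by (auto simp: lookup_A[OF wv(1)])
  qed
  then have "lookup (AA n) (up v) = (\<Sum>w\<in>keys n. if w = v then lookup n w else 0)"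
    unfolding lookup_frag_extend by (intro sum.cong) auto
  also have "\<dots> = lookup n v"
    using v(1) by (simp add: sum.delta)
  finally show False
    using assms(2) v(1) by (simp add: in_keys_iff)
qed

lemma AA_inj: "keys n \<subseteq> V \<Longrightarrow> keys m \<subseteq> V \<Longrightarrow> AA n = AA m \<Longrightarrow> n = m"
  using AA_eq_0[of "n - m"] keys_diff[of n m] by (auto simp: frag_extend_diff)

definition coords :: "('v \<Rightarrow>\<^sub>0 int) \<Rightarrow> 'v \<Rightarrow>\<^sub>0 int"
  where "coords x = (THE n. keys n \<subseteq> V \<and> AA n = x)"

lemma coords_AA: "keys n \<subseteq> V \<Longrightarrow> coords (AA n) = n"
  unfolding coords_def using AA_inj by (intro the_equality) auto

text \<open>The weight of a monomial: \<open>cnt i u\<close> is the pairing of that weight with the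
  simple coroot of colour \<open>i\<close>.\<close>

definition cnt :: "'i \<Rightarrow> ('v \<Rightarrow>\<^sub>0 int) \<Rightarrow> int"
  where "cnt i u = lookup (frag_extend (\<lambda>v. frag_of (col v)) u) i"

lemma cnt_add: "cnt i (u + v) = cnt i u + cnt i v"
  and cnt_diff: "cnt i (u - v) = cnt i u - cnt i v"
  and cnt_zero [simp]: "cnt i 0 = 0"
  and cnt_frag_of [simp]: "cnt i (frag_of w) = (if col w = i then 1 else 0)"
  by (simp_all add: cnt_def frag_extend_add frag_extend_diff lookup_add lookup_minus)

lemma cnt_sum: "cnt i (sum f X) = (\<Sum>x\<in>X. cnt i (f x))"
  by (induction X rule: infinite_finite_induct) (simp_all add: cnt_add)

lemma cnt_nonneg: "(\<And>v. v \<in> keys u \<Longrightarrow> col v = i \<Longrightarrow> 0 \<le> lookup u v) \<Longrightarrow> 0 \<le> cnt i u"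
  unfolding cnt_def lookup_frag_extend by (intro sum_nonneg) simp

lemma cnt_A: "v \<in> V \<Longrightarrow> cnt i (A v) = (if i = col v then 2 else - int (card {w \<in> nb v. col w = i}))"
  using col_nb[of v] nb_finite[of v]
  by (auto simp: A_def cnt_add cnt_diff cnt_sum col_up sum.If_cases Int_def conj_commute
      intro: sum.neutral)

lemma cnt_AA_self:
  assumes "keys n \<subseteq> {v \<in> V. col v = i}"
  shows "cnt i (AA n) = 2 * tot n"
  using assms by (induction n rule: frag_induction)
    (auto simp: frag_extend_diff cnt_diff tot_diff cnt_A)

lemma cnt_eq_tot:
  assumes "keys n \<subseteq> {v. col v = i}"
  shows "cnt i n = tot n"
  using assms by (induction n rule: frag_induction) (auto simp: cnt_diff tot_diff)

lemma cnt_other: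
  assumes "keys n \<subseteq> {v. col v \<noteq> i}"
  shows "cnt i n = 0"
  using assms by (induction n rule: frag_induction) (auto simp: cnt_diff)

subsection \<open>Unitriangular Laurent polynomials\<close>

text \<open>The bound \<open>b\<close> on the number of factors is recorded because for
  \<open>E i u\<close> it becomes the weight \<open>cnt i u\<close>, and exactly this inequality
  feeds the length estimate \<open>nrm_up\<close>.\<close>

definition lower :: "'v set \<Rightarrow> int \<Rightarrow> ('v \<Rightarrow>\<^sub>0 int) set"
  where "lower X b = {- AA n | n. nonneg n \<and> n \<noteq> 0 \<and> keys n \<subseteq> X \<and> tot n \<le> b}"

definition unitri :: "'v set \<Rightarrow> int \<Rightarrow> (('v \<Rightarrow>\<^sub>0 int) \<Rightarrow>\<^sub>0 int) \<Rightarrow> bool"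
  where "unitri X b P \<longleftrightarrow> keys (P - 1) \<subseteq> lower X b"

lemma lower_mono: "X \<subseteq> Y \<Longrightarrow> b \<le> b' \<Longrightarrow> lower X b \<subseteq> lower Y b'"
  unfolding lower_def by force

lemma lower_add:
  assumes "x \<in> lower X b" "y \<in> lower X b'"
  shows "x + y \<in> lower X (b + b')"
proof -
  obtain n m where nm: "x = - AA n" "nonneg n" "n \<noteq> 0" "keys n \<subseteq> X" "tot n \<le> b"
    "y = - AA m" "nonneg m" "m \<noteq> 0" "keys m \<subseteq> X" "tot m \<le> b'"
    using assms unfolding lower_def by blast
  have "x + y = - AA (n + m)" "nonneg (n + m)" "n + m \<noteq> 0" "keys (n + m) \<subseteq> X" "tot (n + m) \<le> b + b'"
    using nm nonneg_add_eq_0[of n m] keys_add_subset[of n X m]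
    by (auto simp: frag_extend_add nonneg_add tot_add)
  then show ?thesis
    unfolding lower_def by blast
qed

lemma unitri_mono: "unitri X b P \<Longrightarrow> X \<subseteq> Y \<Longrightarrow> b \<le> b' \<Longrightarrow> unitri Y b' P"
  unfolding unitri_def using lower_mono by blast

lemma unitri_one: "unitri X b 1"
  by (simp add: unitri_def)

lemma unitri_mult:
  assumes P: "unitri X b P" and Q: "unitri X b' Q" and b: "0 \<le> b" "0 \<le> b'"
  shows "unitri X (b + b') (P * Q)"
proof -
  have eq: "P * Q - 1 = (P - 1) + (Q - 1) + (P - 1) * (Q - 1)"
    by (simp add: algebra_simps)
  have PQ: "keys (P - 1) \<subseteq> lower X (b + b')" "keys (Q - 1) \<subseteq> lower X (b + b')"
    using P Q b lower_mono[of X X b "b + b'"] lower_mono[of X X b' "b + b'"] unfolding unitri_def by auto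
  have "keys ((P - 1) * (Q - 1)) \<subseteq> lower X (b + b')"
    using keys_mult[of "P - 1" "Q - 1"] P Q lower_add unfolding unitri_def by blast
  then show ?thesis
    unfolding unitri_def eq using PQ by (intro keys_add_subset)
qed

lemma unitri_power: "unitri X b P \<Longrightarrow> 0 \<le> b \<Longrightarrow> unitri X (int k * b) (P ^ k)"
proof (induction k)
  case (Suc k)
  then have "unitri X (b + int k * b) (P * P ^ k)"
    by (intro unitri_mult) auto
  then show ?case
    by (simp add: algebra_simps)
qed (simp add: unitri_one)

lemma unitri_prod:
  assumes "\<And>x. x \<in> S \<Longrightarrow> unitri X (b x) (P x)" "\<And>x. x \<in> S \<Longrightarrow> 0 \<le> b x"
  shows "unitri X (sum b S) (prod P S)"
  using assms
proof (induction S rule: infinite_finite_induct)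
  case (insert x S)
  then show ?case
    by (simp add: unitri_mult sum_nonneg)
qed (simp_all add: unitri_one)

lemma unitri_single:
  assumes "v \<in> X" "1 \<le> b"
  shows "unitri X b (1 + frag_of (- A v))"
  using assms unfolding unitri_def lower_def by (auto intro!: exI[of _ "frag_of v"])

lemma lookup_unitri:
  assumes "unitri X b P" "X \<subseteq> V"
  shows "lookup P 0 = 1"
proof -
  have "0 \<notin> lower X b"
    using AA_eq_0 assms(2) unfolding lower_def by fastforce
  then have "lookup (P - 1) 0 = 0"
    using assms(1) unfolding unitri_def by (metis in_keys_iff subsetD)
  then show ?thesis
    by (simp add: lookup_minus)
qed

lemma unitri_keys:
  assumes "unitri X b P" "x \<in> keys P" "0 \<le> b"
  obtains n where "nonneg n" "keys n \<subseteq> X" "tot n \<le> b" "x = - AA n"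
proof (cases "x = 0")
  case True
  then show ?thesis
    using that[of 0] assms(3) by simp
next
  case False
  then have "x \<in> keys (P - 1)"
    using assms(2) by (simp add: in_keys_iff lookup_minus lookup_one)
  then show ?thesis
    using assms(1) that unfolding unitri_def lower_def by blast
qed

subsection \<open>The subrings attached to the colours\<close>

text \<open>For \<open>u\<close> in \<open>Dom i\<close>, the product of the generators of colour
  \<open>i\<close> and of invertible variables of the other colours with leading monomial
  \<open>u\<close>. Outside \<open>Dom i\<close> the truncation by \<open>nat\<close> only makes the
  definition total.\<close>

definition E :: "'i \<Rightarrow> ('v \<Rightarrow>\<^sub>0 int) \<Rightarrow> ('v \<Rightarrow>\<^sub>0 int) \<Rightarrow>\<^sub>0 int"
  where "E i u = frag_of u * (\<Prod>v\<in>{v \<in> keys u. col v = i}. (1 + frag_of (- A v)) ^ nat (lookup u v))"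

definition Dom :: "'i \<Rightarrow> ('v \<Rightarrow>\<^sub>0 int) set"
  where "Dom i = {u. keys u \<subseteq> V \<and> (\<forall>v. col v = i \<longrightarrow> 0 \<le> lookup u v)}"

text \<open>An additive span rather than a generated ring: the triangular arguments need the
  coefficients \<open>c\<close> on the \<open>i\<close>-dominant monomials. \<open>K_eq\<close>
  identifies it with the subring generated by \<open>gens i\<close>.\<close>

definition K :: "'i \<Rightarrow> (('v \<Rightarrow>\<^sub>0 int) \<Rightarrow>\<^sub>0 int) set"
  where "K i = frag_extend (E i) ` {c. keys c \<subseteq> Dom i}"

lemma Dom_add: "u \<in> Dom i \<Longrightarrow> w \<in> Dom i \<Longrightarrow> u + w \<in> Dom i"
  using keys_add_subset[of u V w] by (auto simp: Dom_def lookup_add)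

lemma Dom_frag_of: "v \<in> V \<Longrightarrow> frag_of v \<in> Dom i"
  by (auto simp: Dom_def)

lemma Dom_free: "keys u \<subseteq> {v \<in> V. col v \<noteq> i} \<Longrightarrow> u \<in> Dom i"
  unfolding Dom_def subset_iff mem_Collect_eq in_keys_iff by (metis order_refl)

lemma E_superset:
  assumes "finite S" "{v \<in> keys u. col v = i} \<subseteq> S"
  shows "E i u = frag_of u * (\<Prod>v\<in>S. (1 + frag_of (- A v)) ^ (if col v = i then nat (lookup u v) else 0))"
  unfolding E_def using assms
  by (intro arg_cong2[where f = "(*)"] refl prod.mono_neutral_cong_left) (auto simp: in_keys_iff)

lemma E_add:
  assumes "u \<in> Dom i" "w \<in> Dom i"
  shows "E i (u + w) = E i u * E i w"
proof -
  let ?S = "keys u \<union> keys w"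
  have "keys (u + w) \<subseteq> ?S"
    by (rule Poly_Mapping.keys_add)
  then have "E i (u + w) = frag_of (u + w) *
      (\<Prod>v\<in>?S. (1 + frag_of (- A v)) ^ (if col v = i then nat (lookup (u + w) v) else 0))"
    by (intro E_superset) auto
  also have "(\<Prod>v\<in>?S. (1 + frag_of (- A v)) ^ (if col v = i then nat (lookup (u + w) v) else 0)) =
    (\<Prod>v\<in>?S. (1 + frag_of (- A v)) ^ (if col v = i then nat (lookup u v) else 0) *
      (1 + frag_of (- A v)) ^ (if col v = i then nat (lookup w v) else 0))"
    using assms by (intro prod.cong) (auto simp: Dom_def lookup_add nat_add_distrib power_add)
  also have "frag_of (u + w) * \<dots> = E i u * E i w"
    using E_superset[of ?S u i, OF _ order_trans[OF _ Un_upper1]]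
      E_superset[of ?S w i, OF _ order_trans[OF _ Un_upper2]]
    by (simp add: prod.distrib mult_ac Int_def flip: frag_of_mult)
  finally show ?thesis .
qed

lemma E_free: "keys u \<subseteq> {v. col v \<noteq> i} \<Longrightarrow> E i u = frag_of u"
  unfolding E_def by (subst prod.neutral) auto

lemma E_frag_of: "col v = i \<Longrightarrow> E i (frag_of v) = frag_of (frag_of v) * (1 + frag_of (- A v))"
  by (simp add: E_def Collect_conv_if)

lemma E_unitri:
  assumes "u \<in> Dom i"
  obtains G where "E i u = frag_of u * G" "unitri {v \<in> keys u. col v = i} (cnt i u) G"
proof
  let ?S = "{v \<in> keys u. col v = i}"
  let ?G = "\<Prod>v\<in>?S. (1 + frag_of (- A v)) ^ nat (lookup u v)"
  show "E i u = frag_of u * ?G"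
    by (simp add: E_def)
  have "unitri ?S (\<Sum>v\<in>?S. int (nat (lookup u v)) * 1) ?G"
    by (intro unitri_prod unitri_power unitri_single) auto
  moreover have "(\<Sum>v\<in>?S. int (nat (lookup u v)) * 1) = cnt i u"
  proof -
    have "cnt i u = (\<Sum>v\<in>keys u. if col v = i then lookup u v else 0)"
      unfolding cnt_def lookup_frag_extend by (intro sum.cong) auto
    also have "\<dots> = (\<Sum>v\<in>?S. lookup u v)"
      by (simp add: sum.inter_filter)
    finally show ?thesis
      using assms by (auto simp: Dom_def intro!: sum.cong)
  qed
  ultimately show "unitri ?S (cnt i u) ?G"
    by simp
qed

lemma E_self:
  assumes "u \<in> Dom i"
  shows "lookup (E i u) u = 1"
proof -
  obtain G where "E i u = frag_of u * G" "unitri {v \<in> keys u. col v = i} (cnt i u) G"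
    using E_unitri[OF assms] .
  moreover have "{v \<in> keys u. col v = i} \<subseteq> V"
    using assms by (auto simp: Dom_def)
  ultimately show ?thesis
    using lookup_unitri by (simp add: lookup_shift)
qed

lemma E_keys:
  assumes u: "u \<in> Dom i" and x: "x \<in> keys (E i u)"
  obtains n where "nonneg n" "keys n \<subseteq> {v \<in> keys u. col v = i}" "tot n \<le> cnt i u" "x = u - AA n"
proof -
  obtain G where G: "E i u = frag_of u * G" "unitri {v \<in> keys u. col v = i} (cnt i u) G"
    using E_unitri[OF u] .
  obtain y where y: "y \<in> keys G" "x = u + y"
    using x unfolding G(1) keys_shift by auto
  have "0 \<le> cnt i u"
    using u by (intro cnt_nonneg) (auto simp: Dom_def)
  then obtain n where "nonneg n" "keys n \<subseteq> {v \<in> keys u. col v = i}" "tot n \<le> cnt i u" "y = - AA n"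
    using unitri_keys[OF G(2) y(1)] by blast
  then show thesis
    using that[of n] y(2) by simp
qed

lemma E_keys_V: "u \<in> Dom i \<Longrightarrow> keys (E i u) \<subseteq> {x. keys x \<subseteq> V}"
proof
  fix x assume u: "u \<in> Dom i" and x: "x \<in> keys (E i u)"
  obtain n where "keys n \<subseteq> {v \<in> keys u. col v = i}" "x = u - AA n"
    using E_keys[OF u x] by blast
  then show "x \<in> {x. keys x \<subseteq> V}"
    using u keys_AA[of n] keys_diff_subset[of u V "AA n"] unfolding Dom_def by auto
qed

lemma K_keys_V: "P \<in> K i \<Longrightarrow> x \<in> keys P \<Longrightarrow> keys x \<subseteq> V"
  unfolding K_def using keys_frag_extend[of "E i"] E_keys_V by fastforce

text \<open>
  The expansion of \<open>frag_extend (E i) c\<close> is triangular, so a key of \<open>c\<close> of maximal weight above a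
  given monomial survives in it.
\<close>

lemma K_top:
  assumes c: "keys c \<subseteq> Dom i" and u: "u \<in> keys (frag_extend (E i) c)"
  obtains w n where "w \<in> keys c" "w \<in> keys (frag_extend (E i) c)" "nonneg n"
    "keys n \<subseteq> {v \<in> V. col v = i}" "tot n \<le> cnt i w" "u = w - AA n"
proof -
  let ?X = "{v \<in> V. col v = i}"
  obtain w0 where w0: "w0 \<in> keys c" "u \<in> keys (E i w0)"
    using u keys_frag_extend[of "E i" c] by blast
  have EX: "\<exists>n. nonneg n \<and> keys n \<subseteq> ?X \<and> tot n \<le> cnt i w \<and> x = w - AA n"
    if w: "w \<in> keys c" "x \<in> keys (E i w)" for w x
  proof -
    have wD: "w \<in> Dom i"
      using w(1) c by auto
    obtain n where "nonneg n" "keys n \<subseteq> {v \<in> keys w. col v = i}" "tot n \<le> cnt i w" "x = w - AA n"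
      using E_keys[OF wD w(2)] .
    moreover have "{v \<in> keys w. col v = i} \<subseteq> ?X"
      using wD by (auto simp: Dom_def)
    ultimately show ?thesis
      by (intro exI[of _ n]) auto
  qed
  obtain n0 where n0: "nonneg n0" "keys n0 \<subseteq> ?X" "tot n0 \<le> cnt i w0" "u = w0 - AA n0"
    using EX[OF w0] by blast
  \<comment> \<open>A member of \<open>S\<close> with maximal \<open>cnt i\<close> has no other key
    of \<open>c\<close> strictly above it in colour \<open>i\<close>, since descending by
    \<open>AA k\<close> lowers \<open>cnt i\<close> by \<open>2 * tot k\<close>. Hence its
    coefficient cannot be cancelled.\<close>
  define S where "S = {w \<in> keys c. \<exists>n. nonneg n \<and> keys n \<subseteq> ?X \<and> w0 = w - AA n}"
  have "finite S"
    by (simp add: S_def)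
  moreover have "w0 \<in> S"
    using w0(1) unfolding S_def by (intro CollectI conjI exI[of _ 0]) simp_all
  ultimately obtain w where w: "w \<in> S" "\<And>w'. w' \<in> S \<Longrightarrow> cnt i w' \<le> cnt i w"
    using finite_argmax[of S w0 "cnt i"] by blast
  obtain n where n: "nonneg n" "keys n \<subseteq> ?X" "w0 = w - AA n"
    using w(1) unfolding S_def by blast
  have wc: "w \<in> keys c"
    using w(1) by (simp add: S_def)
  have other: "lookup (E i w') w = 0" if w': "w' \<in> keys c" "w' \<noteq> w" for w'
  proof (rule ccontr)
    assume "lookup (E i w') w \<noteq> 0"
    then obtain k where k: "nonneg k" "keys k \<subseteq> ?X" "w = w' - AA k"
      using EX[OF w'(1), of w] by (auto simp: in_keys_iff)
    then have "k \<noteq> 0"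
      using w'(2) by auto
    have "w0 = w' - AA (n + k)" "nonneg (n + k)" "keys (n + k) \<subseteq> ?X"
      using n k keys_add_subset[of n ?X k] by (auto simp: nonneg_add frag_extend_add)
    then have "w' \<in> S"
      using w'(1) unfolding S_def by blast
    then have "cnt i w' \<le> cnt i w"
      by (rule w(2))
    moreover have "cnt i w = cnt i w' - 2 * tot k"
      using cnt_AA_self[OF k(2)] by (simp add: k(3) cnt_diff)
    ultimately show False
      using tot_pos[OF k(1) \<open>k \<noteq> 0\<close>] by simp
  qed
  have "lookup (frag_extend (E i) c) w = (\<Sum>w'\<in>keys c. if w' = w then lookup c w else 0)"
    unfolding lookup_frag_extend using other E_self c wc by (intro sum.cong) auto
  then have "w \<in> keys (frag_extend (E i) c)"
    using wc by (simp add: in_keys_iff)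
  moreover have "u = w - AA (n + n0)" "nonneg (n + n0)" "keys (n + n0) \<subseteq> ?X"
    using n n0 keys_add_subset[of n ?X n0] by (auto simp: nonneg_add frag_extend_add)
  \<comment> \<open>Descending by \<open>n\<close> costs \<open>2 * tot n\<close> in
    \<open>cnt i\<close> but adds only \<open>tot n\<close> factors, so the bound for
    \<open>w0\<close> implies the bound for \<open>w\<close>.\<close>
  moreover have "tot (n + n0) \<le> cnt i w"
  proof -
    have "cnt i w0 = cnt i w - 2 * tot n"
      using cnt_AA_self[OF n(2)] by (simp add: n(3) cnt_diff)
    then show ?thesis
      using n0(3) tot_nonneg[OF n(1)] by (simp add: tot_add)
  qed
  ultimately show thesis
    using that[of w "n + n0"] wc by blast
qed

text \<open>A key \<open>u\<close> that is maximal for the order given by the \<open>A v\<close>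
  would have a negative exponent at some \<open>v\<close>. It is then not a leading monomial in the
  expansion of colour \<open>col v\<close>, and \<open>K_top\<close> finds a key strictly above it.
  Independence of the \<open>A v\<close> makes the order irreflexive.\<close>

lemma K_unique:
  assumes P: "\<And>v. v \<in> V \<Longrightarrow> P \<in> K (col v)" and nd: "\<And>u. u \<in> keys P \<Longrightarrow> \<not> nonneg u"
    and PV: "\<And>u. u \<in> keys P \<Longrightarrow> keys u \<subseteq> V"
  shows "P = 0"
proof (rule ccontr)
  assume "P \<noteq> 0"
  define less where "less x y \<longleftrightarrow> (\<exists>n. nonneg n \<and> n \<noteq> 0 \<and> keys n \<subseteq> V \<and> x = y - AA n)" for x y
  have "less x z" if xy: "less x y" and yz: "less y z" for x y z
  proof -
    obtain n m where "nonneg n" "n \<noteq> 0" "keys n \<subseteq> V" "x = y - AA n"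
        "nonneg m" "m \<noteq> 0" "keys m \<subseteq> V" "y = z - AA m"
      using xy yz unfolding less_def by blast
    then have "nonneg (n + m)" "n + m \<noteq> 0" "keys (n + m) \<subseteq> V" "x = z - AA (n + m)"
      using keys_add_subset[of n V m] nonneg_add_eq_0[of n m] by (auto simp: nonneg_add frag_extend_add)
    then show ?thesis
      unfolding less_def by blast
  qed
  moreover have "\<not> less x x" for x
    unfolding less_def using AA_eq_0 by auto
  ultimately have tr: "transp_on (keys P) less" and as: "asymp_on (keys P) less"
    by (auto intro!: transp_onI asymp_onI)
  have fin: "finite (keys P)" "keys P \<noteq> {}"
    using \<open>P \<noteq> 0\<close> by simp_all
  obtain u where u: "u \<in> keys P" "\<forall>w\<in>keys P. w \<noteq> u \<longrightarrow> \<not> less u w"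
    using Finite_Set.bex_max_element[OF fin(1) as tr fin(2)] by blast
  obtain v where v: "lookup u v < 0"
    using nd[OF u(1)] by (auto simp: nonneg_def not_le)
  then have "v \<in> V"
    using PV[OF u(1)] by (auto simp: in_keys_iff subset_iff)
  then obtain c where c: "keys c \<subseteq> Dom (col v)" "P = frag_extend (E (col v)) c"
    using P[OF \<open>v \<in> V\<close>] unfolding K_def by blast
  obtain w n where w: "w \<in> keys c" "w \<in> keys P" "nonneg n" "keys n \<subseteq> {x \<in> V. col x = col v}" "u = w - AA n"
    using K_top[OF c(1) u(1)[unfolded c(2)]] unfolding c(2) .
  then have nV: "keys n \<subseteq> V"
    by auto
  have "n \<noteq> 0"
    using w(1,5) c(1) v by (force simp: Dom_def)
  then have "less u w"
    using w nV unfolding less_def by blast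
  moreover have "w \<noteq> u"
    using w(5) AA_eq_0[OF nV] \<open>n \<noteq> 0\<close> by auto
  ultimately show False
    using u(2) w(2) by blast
qed

subsection \<open>Closure properties and generators\<close>

lemma K_E: "u \<in> Dom i \<Longrightarrow> E i u \<in> K i"
  unfolding K_def by (intro image_eqI[of _ _ "frag_of u"]) auto

lemma K_extend: "keys c \<subseteq> Dom i \<Longrightarrow> frag_extend (E i) c \<in> K i"
  unfolding K_def by blast

lemma K_diff: "P \<in> K i \<Longrightarrow> Q \<in> K i \<Longrightarrow> P - Q \<in> K i"
  unfolding K_def using keys_diff_subset by (fastforce simp flip: frag_extend_diff)

lemma K_zero: "0 \<in> K i"
  unfolding K_def by (intro image_eqI[of _ _ 0]) auto

lemma K_add: "P \<in> K i \<Longrightarrow> Q \<in> K i \<Longrightarrow> P + Q \<in> K i"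
  using K_diff[OF _ K_diff[OF K_zero, of Q], of P] by simp

lemma K_mult:
  assumes "P \<in> K i" "Q \<in> K i"
  shows "P * Q \<in> K i"
proof -
  obtain c c' where c: "keys c \<subseteq> Dom i" "P = frag_extend (E i) c" "keys c' \<subseteq> Dom i" "Q = frag_extend (E i) c'"
    using assms by (auto simp: K_def)
  have 1: "E i u * frag_extend (E i) c' \<in> K i" if "u \<in> Dom i" for u
    using c(3)
    by (induction c' rule: frag_induction)
      (auto simp: frag_extend_diff right_diff_distrib K_zero K_diff K_E Dom_add that simp flip: E_add)
  show ?thesis
    using c(1) unfolding c(2,4)
    by (induction c rule: frag_induction) (auto simp: frag_extend_diff left_diff_distrib K_zero K_diff 1)
qed

lemma K_free: "keys u \<subseteq> {v \<in> V. col v \<noteq> i} \<Longrightarrow> frag_of u \<in> K i"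
  using K_E[OF Dom_free, of u i] E_free[of u i] by (metis (no_types, lifting) mem_Collect_eq subset_iff)

lemma K_one: "1 \<in> K i"
  using K_free[of 0 i] by simp

lemma K_generator: "v \<in> V \<Longrightarrow> frag_of (frag_of v) * (1 + frag_of (- A v)) \<in> K (col v)"
  using K_E[OF Dom_frag_of, of v "col v"] by (simp add: E_frag_of)

lemma K_power: "P \<in> K i \<Longrightarrow> P ^ k \<in> K i"
  by (induction k) (simp_all add: K_one K_mult)

lemma K_prod: "(\<And>x. x \<in> S \<Longrightarrow> P x \<in> K i) \<Longrightarrow> prod P S \<in> K i"
  by (induction S rule: infinite_finite_induct) (simp_all add: K_one K_mult)

definition gens :: "'i \<Rightarrow> (('v \<Rightarrow>\<^sub>0 int) \<Rightarrow>\<^sub>0 int) set"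
  where "gens i = {frag_of (frag_of v) * (1 + frag_of (- A v)) | v. v \<in> V \<and> col v = i} \<union>
    {frag_of (frag_of v) | v. v \<in> V \<and> col v \<noteq> i} \<union> {frag_of (- frag_of v) | v. v \<in> V \<and> col v \<noteq> i}"

lemma subring_gen_subset_K: "subring_gen (gens i) \<subseteq> K i"
proof
  fix P assume "P \<in> subring_gen (gens i)"
  then show "P \<in> K i"
    by (induction rule: subring_gen.induct)
      (auto simp: gens_def K_one K_diff K_mult K_generator intro!: K_free)
qed

lemma subring_gen_power: "x \<in> subring_gen S \<Longrightarrow> x ^ k \<in> subring_gen S"
  by (induction k) (auto intro: subring_gen.intros)

lemma subring_gen_prod: "(\<And>x. x \<in> X \<Longrightarrow> f x \<in> subring_gen S) \<Longrightarrow> prod f X \<in> subring_gen S"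
  by (induction X rule: infinite_finite_induct) (auto intro: subring_gen.intros)

lemma K_subset_subring_gen: "K i \<subseteq> subring_gen (gens i)"
proof -
  have free: "frag_of u \<in> subring_gen (gens i)" if "keys u \<subseteq> {v \<in> V. col v \<noteq> i}" for u
  proof -
    have "frag_of u \<in> subring_gen (gens i) \<and> frag_of (- u) \<in> subring_gen (gens i)"
      using that
    proof (induction u rule: frag_induction)
      case (diff a b)
      then have "frag_of a * frag_of (- b) \<in> subring_gen (gens i)" "frag_of (- a) * frag_of b \<in> subring_gen (gens i)"
        by (auto intro: subring_gen.mult)
      then show ?case
        by (simp add: frag_of_mult)
    qed (auto simp: gens_def intro: subring_gen.intros)
    then show ?thesis ..
  qed
  have E: "E i u \<in> subring_gen (gens i)" if u: "u \<in> Dom i" for u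
  proof -
    let ?S = "{v \<in> keys u. col v = i}"
    have rest: "keys (part (- ?S) u) \<subseteq> {v \<in> V. col v \<noteq> i}"
      using u by (auto simp: keys_part Dom_def)
    have "E i u = frag_of (part (- ?S) u) * (\<Prod>v\<in>?S. (frag_of (frag_of v) * (1 + frag_of (- A v))) ^ nat (lookup u v))"
      using u unfolding E_def
      by (subst frag_of_split[of ?S]) (auto simp: Dom_def power_mult_distrib prod.distrib)
    also have "\<dots> \<in> subring_gen (gens i)"
    proof (rule subring_gen.mult[OF free[OF rest]], intro subring_gen_prod subring_gen_power)
      fix v assume "v \<in> ?S"
      then have "frag_of (frag_of v) * (1 + frag_of (- A v)) \<in> gens i"
        using u by (auto simp: Dom_def gens_def)
      then show "frag_of (frag_of v) * (1 + frag_of (- A v)) \<in> subring_gen (gens i)"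
        by (rule subring_gen.gen)
    qed
    finally show ?thesis .
  qed
  have "frag_extend (E i) c \<in> subring_gen (gens i)" if "keys c \<subseteq> Dom i" for c
    using that
  proof (induction c rule: frag_induction)
    case zero
    show ?case
      using subring_gen.diff[OF subring_gen.one subring_gen.one] by simp
  qed (auto simp: frag_extend_diff E intro: subring_gen.diff)
  then show ?thesis
    by (auto simp: K_def)
qed

lemma K_eq: "K i = subring_gen (gens i)"
  using subring_gen_subset_K K_subset_subring_gen by blast

subsection \<open>Two colours\<close>

definition free :: "'i \<Rightarrow> ('v \<Rightarrow>\<^sub>0 int) set"
  where "free i = {u. keys u \<subseteq> {w \<in> V. col w \<noteq> i}}"

lemma free_add: "u \<in> free i \<Longrightarrow> w \<in> free i \<Longrightarrow> u + w \<in> free i"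
  and free_diff: "u \<in> free i \<Longrightarrow> w \<in> free i \<Longrightarrow> u - w \<in> free i"
  and free_uminus: "u \<in> free i \<Longrightarrow> - u \<in> free i"
  and free_zero: "0 \<in> free i"
  and free_frag_of: "v \<in> V \<Longrightarrow> col v \<noteq> i \<Longrightarrow> frag_of v \<in> free i"
  unfolding free_def using keys_add_subset[of u _ w] keys_diff_subset[of u _ w] by auto

lemmas free_intros = free_add free_diff free_uminus free_zero free_frag_of

lemma K_free': "u \<in> free i \<Longrightarrow> frag_of u \<in> K i"
  using K_free by (simp add: free_def)

text \<open>One of the blocks into which the rank-two solutions are cut: \<open>s\<close> contains
  colour \<open>i\<close> only through a single \<open>v\<close>.\<close>

lemma K_pair:
  assumes "v \<in> V" "col v = i" "s - frag_of v \<in> free i"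
  shows "frag_of s + frag_of (s - A v) \<in> K i"
proof -
  have "frag_of s + frag_of (s - A v)
      = frag_of (s - frag_of v) * (frag_of (frag_of v) * (1 + frag_of (- A v)))"
    by (simp add: algebra_simps frag_of_mult)
  then show ?thesis
    using assms K_mult[OF K_free' K_generator] by metis
qed

text \<open>The block for a product of two generators. If \<open>y = up x\<close>, then
  \<open>s - A x\<close> is free of colour \<open>i\<close>, lies in \<open>K i\<close> by itself
  and may be subtracted; three terms remain.\<close>

lemma K_quad:
  assumes "x \<in> V" "col x = i" "y \<in> V" "col y = i" "s - frag_of x - frag_of y \<in> free i"
  shows "frag_of s + frag_of (s - A x) + frag_of (s - A y) + frag_of (s - A x - A y) \<in> K i"
proof -
  have "frag_of s + frag_of (s - A x) + frag_of (s - A y) + frag_of (s - A x - A y)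
      = frag_of (s - frag_of x - frag_of y) * ((frag_of (frag_of x) * (1 + frag_of (- A x))) *
        (frag_of (frag_of y) * (1 + frag_of (- A y))))"
    by (simp add: algebra_simps frag_of_mult)
  then show ?thesis
    using assms K_generator[of x] K_generator[of y] K_free' K_mult by metis
qed

lemma lower_A: "v \<in> X \<Longrightarrow> - A v \<in> lower X 1"
  unfolding lower_def by (auto intro!: exI[of _ "frag_of v"])

lemma lower_diff_A: "x \<in> lower X b \<Longrightarrow> v \<in> X \<Longrightarrow> x - A v \<in> lower X (b + 1)"
  using lower_add[OF _ lower_A, of x X b v] by simp

lemma unitri_plus:
  assumes "unitri X b P" "x \<in> lower X b'"
  shows "unitri X (max b b') (P + frag_of x)"
proof -
  have "keys (P - 1) \<subseteq> lower X (max b b')" "keys (frag_of x) \<subseteq> lower X (max b b')"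
    using assms lower_mono[of X X b "max b b'"] lower_mono[of X X b' "max b b'"]
    unfolding unitri_def by auto
  then have "keys ((P - 1) + frag_of x) \<subseteq> lower X (max b b')"
    by (rule keys_add_subset)
  then show ?thesis
    by (simp add: unitri_def algebra_simps)
qed

text \<open>Existential versions, so that unitriangularity of an explicit sum follows by
  \<open>intro\<close> without computing the bound.\<close>

lemma ex_unitri_plus:
  "\<exists>b. unitri X b P \<Longrightarrow> \<exists>b. x \<in> lower X b \<Longrightarrow> \<exists>b. unitri X b (P + frag_of x)"
  using unitri_plus by blast

lemma ex_lower_diff_A: "\<exists>b. x \<in> lower X b \<Longrightarrow> v \<in> X \<Longrightarrow> \<exists>b. x - A v \<in> lower X b"
  using lower_diff_A by blast

lemma ex_lower_A: "v \<in> X \<Longrightarrow> \<exists>b. - A v \<in> lower X b"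
  using lower_A by blast

lemma ex_unitri_one: "\<exists>b. unitri X b 1"
  using unitri_one by blast

lemmas unitri_intros = ex_unitri_plus ex_unitri_one ex_lower_diff_A ex_lower_A

text \<open>Isolates the neighbours of colour \<open>j\<close>. The remaining ones form
  \<open>R\<close>, invertible in both subrings, so that a computation with colours \<open>i\<close>
  and \<open>j\<close> never sees the rest of the diagram.\<close>

lemma A_split:
  assumes v: "v \<in> V" "col v = i"
  obtains R where "R \<in> free i" "R \<in> free j"
    "A v = frag_of v + frag_of (up v) - (\<Sum>w\<in>{w \<in> nb v. col w = j}. frag_of w) - R"
proof
  let ?R = "\<Sum>w\<in>{w \<in> nb v. col w \<noteq> j}. frag_of w"
  have "keys ?R \<subseteq> {w \<in> nb v. col w \<noteq> j}"
    using keys_sum[of frag_of "{w \<in> nb v. col w \<noteq> j}"] by auto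
  then show "?R \<in> free i" "?R \<in> free j"
    using nb_V[OF v(1)] col_nb[OF v(1)] v(2) by (auto simp: free_def)
  have "(\<Sum>w\<in>nb v. frag_of w) = (\<Sum>w\<in>{w \<in> nb v. col w = j}. frag_of w) + ?R"
    using nb_finite[OF v(1)] by (subst sum.union_disjoint[symmetric]) (auto intro!: sum.cong)
  then show "A v = frag_of v + frag_of (up v) - (\<Sum>w\<in>{w \<in> nb v. col w = j}. frag_of w) - ?R"
    by (simp add: A_def)
qed

text \<open>A solution for the two colours only, with leading term the variable \<open>v\<close>.
  Bounding degrees from below keeps all its factors inside the region \<open>reg\<close>, which is
  closed upwards in degree.\<close>

definition rank2_fundamental :: "'i \<Rightarrow> 'i \<Rightarrow> 'v \<Rightarrow> bool"
  where "rank2_fundamental i j v \<longleftrightarrow> (\<exists>G b. unitri {w \<in> V. deg v \<le> deg w} b G \<and>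
    frag_of (frag_of v) * G \<in> K i \<and> frag_of (frag_of v) * G \<in> K j)"

lemma rank2_fundamental_sym: "rank2_fundamental i j v \<Longrightarrow> rank2_fundamental j i v"
  unfolding rank2_fundamental_def by blast

text \<open>Without neighbours of colour \<open>j\<close> both terms of the generator at
  \<open>v\<close> are free of colour \<open>j\<close>.\<close>

lemma rank2_A1A1:
  assumes v: "v \<in> V" "col v = i" and ij: "i \<noteq> j" and nb: "{w \<in> nb v. col w = j} = {}"
  shows "rank2_fundamental i j v"
proof -
  obtain R where R: "R \<in> free i" "R \<in> free j" "A v = frag_of v + frag_of (up v) - R"
    using A_split[OF v, of j] nb by auto
  let ?G = "1 + frag_of (- A v)"
  have P: "frag_of (frag_of v) * ?G = frag_of (frag_of v) + frag_of (frag_of v - A v)"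
    by (simp add: algebra_simps frag_of_mult)
  have up: "up v \<in> V" "col (up v) = i"
    using v up_V col_up by auto
  have "frag_of (frag_of v) * ?G \<in> K i" "frag_of (frag_of v) * ?G \<in> K j"
    unfolding P using v ij R up
    by (intro K_pair K_add K_free'; simp add: free_intros)+
  moreover have "\<exists>b. unitri {w \<in> V. deg v \<le> deg w} b ?G"
    using v by (intro unitri_intros) auto
  ultimately show ?thesis
    unfolding rank2_fundamental_def by blast
qed

text \<open>The three monomials of the vector representation of type A2, bracketed as
  \<open>(t0 + t1) + t2\<close> in colour \<open>i\<close> and as \<open>t0 + (t1 + t2)\<close> in
  colour \<open>j\<close>.\<close>

lemma rank2_A2:
  assumes v: "v \<in> V" "col v = i" and ij: "i \<noteq> j"
    and nb: "{x \<in> nb v. col x = j} = {w}" "{x \<in> nb w. col x = i} = {up v}"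
  shows "rank2_fundamental i j v"
proof -
  have "w \<in> nb v" "col w = j"
    using nb(1) by auto
  then have w: "w \<in> V" "col w = j" "deg v \<le> deg w"
    using nb_V[OF v(1)] deg_nb[OF v(1), of w] by auto
  have up: "up v \<in> V" "col (up v) = i" "up w \<in> V" "col (up w) = j"
    using v w up_V col_up by auto
  obtain R where R: "R \<in> free i" "R \<in> free j" "A v = frag_of v + frag_of (up v) - frag_of w - R"
    using A_split[OF v, of j] unfolding nb by auto
  obtain S where S: "S \<in> free i" "S \<in> free j" "A w = frag_of w + frag_of (up w) - frag_of (up v) - S"
    using A_split[OF w(1,2), of i] unfolding nb by auto
  let ?G = "1 + frag_of (- A v) + frag_of (- A v - A w)"
  let ?t0 = "frag_of v" and ?t1 = "frag_of v - A v" and ?t2 = "frag_of v - A v - A w"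
  have P: "frag_of (frag_of v) * ?G = frag_of ?t0 + frag_of ?t1 + frag_of ?t2"
    by (simp add: algebra_simps frag_of_mult)
  have t: "?t1 = frag_of w + R - frag_of (up v)" "?t2 = R + S - frag_of (up w)"
    by (simp_all add: R(3) S(3))
  have "frag_of ?t0 + frag_of ?t1 \<in> K i" "frag_of ?t2 \<in> K i"
    using v ij R S up by (intro K_pair K_free'; simp add: t free_intros)+
  then have "frag_of (frag_of v) * ?G \<in> K i"
    unfolding P by (rule K_add)
  moreover have "frag_of ?t1 + frag_of ?t2 \<in> K j" "frag_of ?t0 \<in> K j"
    using v w ij R S up by (intro K_pair K_free'; simp add: t free_intros)+
  then have "frag_of ?t0 + (frag_of ?t1 + frag_of ?t2) \<in> K j"
    by (blast intro: K_add)
  then have "frag_of (frag_of v) * ?G \<in> K j"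
    unfolding P by (simp only: add.assoc)
  moreover have "\<exists>b. unitri {w \<in> V. deg v \<le> deg w} b ?G"
    using v w by (intro unitri_intros) auto
  ultimately show ?thesis
    unfolding rank2_fundamental_def by blast
qed

text \<open>The four-dimensional fundamental representation of type B2: a chain lowered by the
  colours \<open>i\<close>, \<open>j\<close>, \<open>i\<close>, so that each colour sees only pairs
  and single free monomials.\<close>

lemma rank2_B2_short:
  assumes v: "v \<in> V" "col v = i" and ij: "i \<noteq> j"
    and nb: "{w \<in> nb v. col w = j} = {p}" "{w \<in> nb p. col w = i} = {up v, x}" "x \<noteq> up v"
      "{w \<in> nb x. col w = j} = {up p}"
  shows "rank2_fundamental i j v"
proof -
  have "p \<in> nb v" "col p = j"
    using nb(1) by auto
  then have p: "p \<in> V" "col p = j" "deg v \<le> deg p"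
    using nb_V[OF v(1)] deg_nb[OF v(1), of p] by auto
  have "x \<in> nb p" "col x = i"
    using nb(2) by auto
  then have x: "x \<in> V" "col x = i" "deg v \<le> deg x"
    using nb_V[OF p(1)] deg_nb[OF p(1), of x] p(3) by auto
  have up: "up v \<in> V" "col (up v) = i" "up p \<in> V" "col (up p) = j" "up x \<in> V" "col (up x) = i"
    using v p x up_V col_up by auto
  obtain R where R: "R \<in> free i" "R \<in> free j" "A v = frag_of v + frag_of (up v) - frag_of p - R"
    using A_split[OF v, of j] unfolding nb by auto
  obtain S where S: "S \<in> free i" "S \<in> free j"
      "A p = frag_of p + frag_of (up p) - (frag_of (up v) + frag_of x) - S"
    using A_split[OF p(1,2), of i] nb(3) unfolding nb(2) by auto
  obtain T where T: "T \<in> free i" "T \<in> free j" "A x = frag_of x + frag_of (up x) - frag_of (up p) - T"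
    using A_split[OF x(1,2), of j] unfolding nb by auto
  let ?G = "1 + frag_of (- A v) + frag_of (- A v - A p) + frag_of (- A v - A p - A x)"
  let ?t0 = "frag_of v" and ?t1 = "frag_of v - A v" and ?t2 = "frag_of v - A v - A p"
    and ?t3 = "frag_of v - A v - A p - A x"
  have P: "frag_of (frag_of v) * ?G = frag_of ?t0 + frag_of ?t1 + frag_of ?t2 + frag_of ?t3"
    by (simp add: algebra_simps frag_of_mult)
  have t: "?t1 = frag_of p + R - frag_of (up v)" "?t2 = frag_of x + (R + S - frag_of (up p))"
      "?t3 = R + S + T - frag_of (up x)"
    by (simp_all add: R(3) S(3) T(3))
  have "frag_of ?t0 + frag_of ?t1 \<in> K i" "frag_of ?t2 + frag_of ?t3 \<in> K i"
    using v x ij R S up p by (intro K_pair; simp add: t free_intros)+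
  then have "(frag_of ?t0 + frag_of ?t1) + (frag_of ?t2 + frag_of ?t3) \<in> K i"
    by (blast intro: K_add)
  then have "frag_of (frag_of v) * ?G \<in> K i"
    unfolding P by (simp only: add.assoc)
  moreover have "frag_of ?t0 \<in> K j" "frag_of ?t1 + frag_of ?t2 \<in> K j" "frag_of ?t3 \<in> K j"
    using v x p ij R S T up by (intro K_pair K_free'; simp add: t free_intros)+
  then have "frag_of ?t0 + (frag_of ?t1 + frag_of ?t2) + frag_of ?t3 \<in> K j"
    by (blast intro: K_add)
  then have "frag_of (frag_of v) * ?G \<in> K j"
    unfolding P by (simp only: add.assoc)
  moreover have "\<exists>b. unitri {w \<in> V. deg v \<le> deg w} b ?G"
    using v p x by (intro unitri_intros) auto
  ultimately show ?thesis
    unfolding rank2_fundamental_def by blast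
qed

text \<open>The five-dimensional fundamental representation of type B2. In colour \<open>j\<close>
  the middle three terms are a product of generators at \<open>x\<close> and \<open>up x\<close>
  minus the free monomial \<open>?s\<close>.\<close>

lemma rank2_B2_long:
  assumes v: "v \<in> V" "col v = i" and ij: "i \<noteq> j"
    and nb: "{w \<in> nb v. col w = j} = {x, up x}" "{w \<in> nb x. col w = i} = {z}"
      "{w \<in> nb (up x). col w = i} = {up v}" "{w \<in> nb z. col w = j} = {up x, up (up x)}"
  shows "rank2_fundamental i j v"
proof -
  have "x \<in> nb v" "up x \<in> nb v" "col x = j"
    using nb(1) by auto
  then have x: "x \<in> V" "col x = j" "deg v \<le> deg x" "deg v \<le> deg (up x)"
    using nb_V[OF v(1)] deg_nb[OF v(1), of x] deg_nb[OF v(1), of "up x"] by auto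
  have "z \<in> nb x" "col z = i"
    using nb(2) by auto
  then have z: "z \<in> V" "col z = i" "deg v \<le> deg z"
    using nb_V[OF x(1)] deg_nb[OF x(1), of z] x(3) by auto
  have up: "up v \<in> V" "col (up v) = i" "up x \<in> V" "col (up x) = j" "up z \<in> V" "col (up z) = i"
      "up (up x) \<in> V" "col (up (up x)) = j" "up x \<noteq> x" "up (up x) \<noteq> up x"
    using v x z up_V col_up deg_up[of x] deg_up[of "up x"] by auto
  obtain R where R: "R \<in> free i" "R \<in> free j"
      "A v = frag_of v + frag_of (up v) - (frag_of x + frag_of (up x)) - R"
    using A_split[OF v, of j] up(9) unfolding nb by auto
  obtain S where S: "S \<in> free i" "S \<in> free j" "A x = frag_of x + frag_of (up x) - frag_of z - S"
    using A_split[OF x(1,2), of i] unfolding nb by auto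
  obtain T where T: "T \<in> free i" "T \<in> free j"
      "A (up x) = frag_of (up x) + frag_of (up (up x)) - frag_of (up v) - T"
    using A_split[OF up(3,4), of i] unfolding nb by auto
  obtain U where U: "U \<in> free i" "U \<in> free j"
      "A z = frag_of z + frag_of (up z) - (frag_of (up x) + frag_of (up (up x))) - U"
    using A_split[OF z(1,2), of j] up(10) unfolding nb by auto
  let ?G = "1 + frag_of (- A v) + frag_of (- A v - A (up x)) + frag_of (- A v - A x - A (up x))
    + frag_of (- A v - A x - A (up x) - A z)"
  let ?t0 = "frag_of v" and ?t1 = "frag_of v - A v" and ?t2 = "frag_of v - A v - A (up x)"
    and ?t3 = "frag_of v - A v - A x - A (up x)" and ?t4 = "frag_of v - A v - A x - A (up x) - A z"
    and ?s = "frag_of v - A v - A x"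
  have P: "frag_of (frag_of v) * ?G = frag_of ?t0 + frag_of ?t1 + frag_of ?t2 + frag_of ?t3 + frag_of ?t4"
    by (simp add: algebra_simps frag_of_mult)
  have t: "?t1 = frag_of x + (frag_of (up x) + (R - frag_of (up v)))" "?t2 = frag_of x + R + T - frag_of (up (up x))"
      "?t3 = frag_of z + (R + S + T - frag_of (up x) - frag_of (up (up x)))"
      "?t4 = R + S + T + U - frag_of (up z)" "?s = R + S + frag_of z - frag_of (up v)"
    by (simp_all add: R(3) S(3) T(3) U(3))
  have "frag_of ?t0 + frag_of ?t1 \<in> K i" "frag_of ?t2 \<in> K i" "frag_of ?t3 + frag_of ?t4 \<in> K i"
    using v x z ij R S T up by (intro K_pair K_free'; simp add: t free_intros)+
  then have "(frag_of ?t0 + frag_of ?t1) + frag_of ?t2 + (frag_of ?t3 + frag_of ?t4) \<in> K i"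
    by (blast intro: K_add)
  then have Ki: "frag_of (frag_of v) * ?G \<in> K i"
    unfolding P by (simp only: add.assoc)
  have "frag_of ?t0 \<in> K j" "frag_of ?s \<in> K j" "frag_of ?t4 \<in> K j"
    using v x z ij R S T U up by (intro K_free'; simp add: t free_intros)+
  moreover have "frag_of ?t1 + frag_of (?t1 - A x) + frag_of (?t1 - A (up x)) + frag_of (?t1 - A x - A (up x)) \<in> K j"
    using v x z ij R up by (intro K_quad; simp add: t(1) free_intros)
  ultimately have "frag_of ?t0 + (frag_of ?t1 + frag_of (?t1 - A x) + frag_of (?t1 - A (up x))
      + frag_of (?t1 - A x - A (up x)) - frag_of ?s) + frag_of ?t4 \<in> K j"
    by (blast intro: K_add K_diff)
  then have "frag_of (frag_of v) * ?G \<in> K j"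
    unfolding P by (simp add: algebra_simps)
  with Ki have "frag_of (frag_of v) * ?G \<in> K i \<inter> K j"
    by blast
  moreover have "\<exists>b. unitri {w \<in> V. deg v \<le> deg w} b ?G"
    using v x z up by (intro unitri_intros) auto
  ultimately show ?thesis
    unfolding rank2_fundamental_def by blast
qed

text \<open>The twisted analogue of \<open>rank2_B2_long\<close>. In its application the two
  neighbours \<open>x\<close> and \<open>y\<close> are not related by \<open>up\<close>, so all four
  terms of \<open>K_quad\<close> stay: there are six terms, and \<open>?t2\<close>,
  \<open>?t3\<close> both have weight zero in the two colours.\<close>

lemma rank2_B2_long_twisted:
  assumes v: "v \<in> V" "col v = i" and ij: "i \<noteq> j" and xy: "x \<noteq> y"
    and nb: "{w \<in> nb v. col w = j} = {x, y}" "{w \<in> nb x. col w = i} = {up v}"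
      "{w \<in> nb y. col w = i} = {up v}" "{w \<in> nb (up v). col w = j} = {up x, up y}"
  shows "rank2_fundamental i j v"
proof -
  have "x \<in> nb v" "y \<in> nb v" "col x = j" "col y = j"
    using nb(1) by auto
  then have x: "x \<in> V" "col x = j" "deg v \<le> deg x" "y \<in> V" "col y = j" "deg v \<le> deg y" "deg v \<le> deg (up v)"
    using nb_V[OF v(1)] deg_nb[OF v(1), of x] deg_nb[OF v(1), of y] deg_up[OF v(1)] by auto
  have up: "up v \<in> V" "col (up v) = i" "up x \<in> V" "col (up x) = j" "up y \<in> V" "col (up y) = j"
      "up (up v) \<in> V" "col (up (up v)) = i" "up x \<noteq> up y"
    using v x up_V col_up inj_onD[OF up_inj, of x y] xy by auto
  obtain R where R: "R \<in> free i" "R \<in> free j"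
      "A v = frag_of v + frag_of (up v) - (frag_of x + frag_of y) - R"
    using A_split[OF v, of j] xy unfolding nb by auto
  obtain S where S: "S \<in> free i" "S \<in> free j" "A x = frag_of x + frag_of (up x) - frag_of (up v) - S"
    using A_split[OF x(1,2), of i] unfolding nb by auto
  obtain T where T: "T \<in> free i" "T \<in> free j" "A y = frag_of y + frag_of (up y) - frag_of (up v) - T"
    using A_split[OF x(4,5), of i] unfolding nb by auto
  obtain U where U: "U \<in> free i" "U \<in> free j"
      "A (up v) = frag_of (up v) + frag_of (up (up v)) - (frag_of (up x) + frag_of (up y)) - U"
    using A_split[OF up(1,2), of j] up(9) unfolding nb by auto
  let ?G = "1 + frag_of (- A v) + frag_of (- A v - A x) + frag_of (- A v - A y) + frag_of (- A v - A x - A y)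
    + frag_of (- A v - A x - A y - A (up v))"
  let ?t0 = "frag_of v" and ?t1 = "frag_of v - A v" and ?t2 = "frag_of v - A v - A x"
    and ?t3 = "frag_of v - A v - A y" and ?t4 = "frag_of v - A v - A x - A y"
    and ?t5 = "frag_of v - A v - A x - A y - A (up v)"
  have P: "frag_of (frag_of v) * ?G
      = frag_of ?t0 + frag_of ?t1 + frag_of ?t2 + frag_of ?t3 + frag_of ?t4 + frag_of ?t5"
    by (simp add: algebra_simps frag_of_mult)
  have t: "?t1 = frag_of x + (frag_of y + (R - frag_of (up v)))" "?t2 = frag_of y + R + S - frag_of (up x)"
      "?t3 = frag_of x + R + T - frag_of (up y)"
      "?t4 = frag_of (up v) + (R + S + T - frag_of (up x) - frag_of (up y))"
      "?t5 = R + S + T + U - frag_of (up (up v))"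
    by (simp_all add: R(3) S(3) T(3) U(3))
  have "frag_of ?t0 + frag_of ?t1 \<in> K i" "frag_of ?t2 \<in> K i" "frag_of ?t3 \<in> K i" "frag_of ?t4 + frag_of ?t5 \<in> K i"
    using v x ij R S T up by (intro K_pair K_free'; simp add: t free_intros)+
  then have "(frag_of ?t0 + frag_of ?t1) + frag_of ?t2 + frag_of ?t3 + (frag_of ?t4 + frag_of ?t5) \<in> K i"
    by (blast intro: K_add)
  then have Ki: "frag_of (frag_of v) * ?G \<in> K i"
    unfolding P by (simp only: add.assoc)
  have "frag_of ?t0 \<in> K j" "frag_of ?t5 \<in> K j"
    using v x ij R S T U up by (intro K_free'; simp add: t free_intros)+
  moreover have "frag_of ?t1 + frag_of (?t1 - A x) + frag_of (?t1 - A y) + frag_of (?t1 - A x - A y) \<in> K j"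
    using v x ij R up by (intro K_quad; simp add: t(1) free_intros)
  ultimately have "frag_of ?t0 + (frag_of ?t1 + frag_of (?t1 - A x) + frag_of (?t1 - A y)
      + frag_of (?t1 - A x - A y)) + frag_of ?t5 \<in> K j"
    by (blast intro: K_add)
  then have "frag_of (frag_of v) * ?G \<in> K j"
    unfolding P by (simp add: algebra_simps)
  with Ki have "frag_of (frag_of v) * ?G \<in> K i \<inter> K j"
    by blast
  moreover have "\<exists>b. unitri {w \<in> V. deg v \<le> deg w} b ?G"
    using v x up by (intro unitri_intros) auto
  ultimately show ?thesis
    unfolding rank2_fundamental_def by blast
qed

end

section \<open>Approximate solutions below a dominant monomial, by depth\<close>

locale coloured_system = vertex_system V col deg up nb
  for V :: "'v set" and col :: "'v \<Rightarrow> 'i" and deg :: "'v \<Rightarrow> int"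
    and up :: "'v \<Rightarrow> 'v" and nb :: "'v \<Rightarrow> 'v set" +
  fixes I :: "'i set" and C :: "'i \<Rightarrow> 'i \<Rightarrow> int"
  assumes col_I: "v \<in> V \<Longrightarrow> col v \<in> I"
    and cartan: "finite_cartan_matrix I C"
    and card_nb: "v \<in> V \<Longrightarrow> i \<in> I \<Longrightarrow> i \<noteq> col v \<Longrightarrow> int (card {w \<in> nb v. col w = i}) = - C i (col v)"
    and rank2: "i \<in> I \<Longrightarrow> j \<in> I \<Longrightarrow> i \<noteq> j \<Longrightarrow> v \<in> V \<Longrightarrow> col v = i \<Longrightarrow> rank2_fundamental i j v"

locale dominant_monomial = coloured_system V col deg up nb I C
  for V :: "'v set" and col :: "'v \<Rightarrow> 'i" and deg :: "'v \<Rightarrow> int"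
    and up :: "'v \<Rightarrow> 'v" and nb :: "'v \<Rightarrow> 'v set" and I C +
  fixes M :: "'v \<Rightarrow>\<^sub>0 int"
  assumes M_V: "keys M \<subseteq> V" and M_nonneg: "nonneg M"
begin

text \<open>The only vertices \<open>v\<close> whose \<open>A v\<close> can occur below
  \<open>M\<close>. The comparison with a variable of \<open>M\<close> later becomes the condition
  on the parameters in \<open>D_tilde\<close>.\<close>

definition reg :: "'v set"
  where "reg = {v \<in> V. \<exists>w\<in>keys M. deg w \<le> deg v}"

definition cone :: "('v \<Rightarrow>\<^sub>0 int) set"
  where "cone = {M - AA n | n. nonneg n \<and> keys n \<subseteq> reg}"

text \<open>The number of factors \<open>A v\<close> separating \<open>u\<close> from
  \<open>M\<close>, well defined because the \<open>A v\<close> are independent.\<close>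

definition dep :: "('v \<Rightarrow>\<^sub>0 int) \<Rightarrow> int"
  where "dep u = tot (coords (M - u))"

text \<open>Error terms: \<open>f - k \<in> H h\<close> for \<open>f\<close>, \<open>k\<close>
  supported on \<open>cone\<close> means agreement up to depth \<open>h\<close>. As depths are
  nonnegative, \<open>H (- 1)\<close> is everything supported on \<open>cone\<close>.\<close>

definition H :: "int \<Rightarrow> (('v \<Rightarrow>\<^sub>0 int) \<Rightarrow>\<^sub>0 int) set"
  where "H h = {P. keys P \<subseteq> {u \<in> cone. h < dep u}}"

lemma reg_V: "reg \<subseteq> V"
  by (auto simp: reg_def)

lemma M_cone: "M \<in> cone"
  unfolding cone_def by (intro CollectI exI[of _ 0]) simp

lemma cone_E:
  assumes "u \<in> cone"
  obtains n where "nonneg n" "keys n \<subseteq> reg" "keys n \<subseteq> V" "u = M - AA n" "coords (M - u) = n" "dep u = tot n"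
  using assms reg_V unfolding cone_def dep_def by (auto simp: coords_AA subset_trans)

lemma dep_nonneg: "u \<in> cone \<Longrightarrow> 0 \<le> dep u"
  using tot_nonneg by (metis cone_E)

lemma cone_V: "u \<in> cone \<Longrightarrow> keys u \<subseteq> V"
  using keys_diff_subset[OF M_V keys_AA] by (metis cone_E)

lemma cone_diff:
  assumes "u \<in> cone" "nonneg m" "keys m \<subseteq> reg"
  shows "u - AA m \<in> cone" "dep (u - AA m) = dep u + tot m" "coords (M - (u - AA m)) = coords (M - u) + m"
proof -
  obtain n where n: "nonneg n" "keys n \<subseteq> reg" "keys n \<subseteq> V" "u = M - AA n" "coords (M - u) = n" "dep u = tot n"
    using cone_E[OF assms(1)] .
  have m: "keys m \<subseteq> V"
    using assms(3) reg_V by blast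
  have eq: "u - AA m = M - AA (n + m)"
    by (simp add: n(4) frag_extend_add)
  then show "u - AA m \<in> cone"
    using n assms keys_add_subset[of n reg m] nonneg_add[of n m] unfolding cone_def by blast
  have "M - (u - AA m) = AA (n + m)"
    by (simp add: eq)
  then show c: "coords (M - (u - AA m)) = coords (M - u) + m"
    using coords_AA[OF keys_add_subset[OF n(3) m]] n(5) by simp
  then show "dep (u - AA m) = dep u + tot m"
    by (simp add: dep_def tot_add)
qed

text \<open>A positive exponent comes from \<open>M\<close> or from a neighbour of some vertex in
  \<open>reg\<close>, and neighbours have larger degree.\<close>

lemma cone_pos:
  assumes "u \<in> cone" "0 < lookup u v"
  shows "v \<in> reg"
proof -
  obtain n where n: "nonneg n" "keys n \<subseteq> reg" "keys n \<subseteq> V" "u = M - AA n"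
    using cone_E[OF assms(1)] by metis
  show ?thesis
  proof (cases "v \<in> keys M")
    case True
    then show ?thesis
      using M_V by (auto simp: reg_def)
  next
    case False
    then have "lookup (AA n) v < 0"
      using assms(2) by (simp add: n(4) lookup_minus in_keys_iff)
    then obtain w where w: "w \<in> keys n" "lookup n w * lookup (A w) v < 0"
      unfolding lookup_frag_extend by (meson not_le sum_nonneg)
    have "lookup (A w) v < 0"
      using w n(1) by (metis mult_nonneg_nonneg nonneg_def not_le)
    then have "v \<in> nb w"
      using lookup_A[of w v] w(1) n(3) by (auto split: if_splits)
    then have "deg w < deg v" "v \<in> V"
      using deg_nb nb_V w(1) n(3) by blast+
    moreover obtain x where "x \<in> keys M" "deg x \<le> deg w"
      using w(1) n(2) by (auto simp: reg_def)
    ultimately show ?thesis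
      by (auto simp: reg_def intro!: bexI[of _ x])
  qed
qed

lemma H_add: "P \<in> H h \<Longrightarrow> Q \<in> H h \<Longrightarrow> P + Q \<in> H h"
  and H_diff: "P \<in> H h \<Longrightarrow> Q \<in> H h \<Longrightarrow> P - Q \<in> H h"
  unfolding H_def using keys_add_subset[of P _ Q] keys_diff_subset[of P _ Q] by auto

lemma H_mono: "h \<le> h' \<Longrightarrow> H h' \<subseteq> H h"
  unfolding H_def by force

lemma H_lookup: "P \<in> H h \<Longrightarrow> u \<notin> cone \<or> dep u \<le> h \<Longrightarrow> lookup P u = 0"
  unfolding H_def by (force simp: in_keys_iff subset_iff)

text \<open>Common to the elements \<open>E i u\<close> of one colour and to the products of
  fundamental solutions for two colours; \<open>D\<close> is the set of admissible leading
  monomials.\<close>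

definition triangular :: "(('v \<Rightarrow>\<^sub>0 int) \<Rightarrow> ('v \<Rightarrow>\<^sub>0 int) \<Rightarrow>\<^sub>0 int) \<Rightarrow> ('v \<Rightarrow>\<^sub>0 int) set \<Rightarrow> bool"
  where "triangular F D \<longleftrightarrow> (\<forall>u\<in>cone \<inter> D. \<exists>G b. F u = frag_of u * G \<and> unitri reg b G)"

lemma triangular_H:
  assumes F: "triangular F D" and u: "u \<in> cone \<inter> D"
  shows "F u - frag_of u \<in> H (dep u)"
proof -
  obtain G b where G: "F u = frag_of u * G" "unitri reg b G"
    using assms unfolding triangular_def by blast
  have "F u - frag_of u = frag_of u * (G - 1)"
    by (simp add: G(1) right_diff_distrib)
  then have "keys (F u - frag_of u) = (+) u ` keys (G - 1)"
    by (simp add: keys_shift)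
  moreover have "u + x \<in> cone \<and> dep u < dep (u + x)" if x: "x \<in> keys (G - 1)" for x
  proof -
    obtain n where "nonneg n" "n \<noteq> 0" "keys n \<subseteq> reg" "x = - AA n"
      using x G(2) unfolding unitri_def lower_def by blast
    then show ?thesis
      using cone_diff[of u n] u tot_pos[of n] by simp
  qed
  ultimately show ?thesis
    unfolding H_def by auto
qed

text \<open>Each monomial of depth \<open>h + 1\<close> is replaced by the element it leads; what
  this changes lies deeper.\<close>

lemma triangular_refine:
  assumes F: "triangular F D" and g: "g \<in> H h" "\<And>u. u \<in> keys g \<Longrightarrow> dep u = h + 1 \<Longrightarrow> u \<in> D"
  obtains c where "keys c \<subseteq> cone \<inter> D" "g - frag_extend F c \<in> H (h + 1)"
proof
  let ?c = "part {u. dep u = h + 1} g"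
  show c: "keys ?c \<subseteq> cone \<inter> D"
    using g unfolding keys_part H_def by auto
  have d: "keys ?c \<subseteq> {u \<in> cone \<inter> D. dep u = h + 1}"
    using c unfolding keys_part by auto
  have "g - ?c \<in> H (h + 1)"
    unfolding H_def
  proof safe
    fix u assume "u \<in> keys (g - ?c)"
    then have "u \<in> keys g" "dep u \<noteq> h + 1"
      by (auto simp: in_keys_iff lookup_minus lookup_part split: if_splits)
    then show "u \<in> cone" "h + 1 < dep u"
      using g(1) unfolding H_def by auto
  qed
  moreover have "frag_extend F c - c \<in> H (h + 1)"
    if "keys c \<subseteq> {u \<in> cone \<inter> D. dep u = h + 1}" for c
    using that
  proof (induction c rule: frag_induction)
    case zero
    show ?case
      by (simp add: H_def)
  next
    case (one x)
    then show ?case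
      using triangular_H[OF F, of x] by auto
  next
    case (diff a b)
    from H_diff[OF diff] show ?case
      by (simp add: frag_extend_diff algebra_simps)
  qed
  from this[OF d] have "frag_extend F ?c - ?c \<in> H (h + 1)" .
  ultimately have "(g - ?c) - (frag_extend F ?c - ?c) \<in> H (h + 1)"
    by (rule H_diff)
  then show "g - frag_extend F ?c \<in> H (h + 1)"
    by simp
qed

lemma E_triangular: "triangular (E i) (Dom i)"
  unfolding triangular_def
proof
  fix u assume u: "u \<in> cone \<inter> Dom i"
  obtain G where G: "E i u = frag_of u * G" "unitri {v \<in> keys u. col v = i} (cnt i u) G"
    using E_unitri[of u i] u by blast
  have "{v \<in> keys u. col v = i} \<subseteq> reg"
  proof safe
    fix v assume "v \<in> keys u" "i = col v"
    then have "0 < lookup u v"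
      using u by (auto simp: Dom_def in_keys_iff order_less_le)
    then show "v \<in> reg"
      using cone_pos u by blast
  qed
  then show "\<exists>G b. E i u = frag_of u * G \<and> unitri reg b G"
    using G unitri_mono[of "{v \<in> keys u. col v = i}" _ G reg] by blast
qed

text \<open>Compared with \<open>K i\<close>, the leading monomials themselves are also confined to
  \<open>cone\<close>. The final truncation by depth of the coefficients \<open>c\<close> relies on
  this.\<close>

definition Kc :: "'i \<Rightarrow> (('v \<Rightarrow>\<^sub>0 int) \<Rightarrow>\<^sub>0 int) set"
  where "Kc i = frag_extend (E i) ` {c. keys c \<subseteq> cone \<inter> Dom i}"

lemma Kc_K: "k \<in> Kc i \<Longrightarrow> k \<in> K i"
  unfolding Kc_def K_def by blast

lemma Kc_refine:
  assumes k: "k \<in> Kc i" "f - k \<in> H h" "\<And>u. u \<in> keys (f - k) \<Longrightarrow> dep u = h + 1 \<Longrightarrow> u \<in> Dom i"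
  shows "\<exists>k\<in>Kc i. f - k \<in> H (h + 1)"
proof -
  obtain c where c: "keys c \<subseteq> cone \<inter> Dom i" "(f - k) - frag_extend (E i) c \<in> H (h + 1)"
    using triangular_refine[OF E_triangular k(2)] k(3) by blast
  obtain c' where c': "keys c' \<subseteq> cone \<inter> Dom i" "k = frag_extend (E i) c'"
    using k(1) unfolding Kc_def by blast
  have "k + frag_extend (E i) c \<in> Kc i"
    unfolding Kc_def c'(2) frag_extend_add[symmetric] using keys_add_subset[OF c'(1) c(1)] by blast
  then show ?thesis
    using c(2) by (intro bexI[of _ "k + frag_extend (E i) c"]) (auto simp: algebra_simps)
qed

text \<open>\<open>K_top\<close> puts a key \<open>w\<close> above \<open>u\<close> by some
  \<open>n\<close>. As \<open>w\<close> also has depth greater than \<open>h\<close>, there is no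
  room for \<open>n\<close>, and \<open>u\<close> is itself a leading monomial.\<close>

lemma K_lowest:
  assumes P: "P \<in> K i" "P \<in> H h" and u: "u \<in> keys P" "dep u = h + 1"
  shows "u \<in> Dom i"
proof -
  obtain c where c: "keys c \<subseteq> Dom i" "P = frag_extend (E i) c"
    using P(1) unfolding K_def by blast
  obtain w n where w: "w \<in> keys c" "w \<in> keys P" "nonneg n" "keys n \<subseteq> {v \<in> V. col v = i}" "u = w - AA n"
    using K_top[OF c(1) u(1)[unfolded c(2)]] unfolding c(2) .
  have "w \<in> cone" "h < dep w"
    using w(2) P(2) unfolding H_def by auto
  obtain m where m: "nonneg m" "keys m \<subseteq> V" "w = M - AA m" "dep w = tot m"
    using cone_E[OF \<open>w \<in> cone\<close>] .
  have nV: "keys n \<subseteq> V"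
    using w(4) by auto
  have "M - u = AA (m + n)"
    by (simp add: w(5) m(3) frag_extend_add)
  then have "dep u = tot (m + n)"
    unfolding dep_def using coords_AA[OF keys_add_subset[OF m(2) nV]] by simp
  then have "tot n \<le> 0"
    using u(2) \<open>h < dep w\<close> m(4) by (simp add: tot_add)
  then have "n = 0"
    using tot_pos[OF w(3)] by force
  then show ?thesis
    using w(1,5) c(1) by auto
qed

text \<open>The product of the fundamental solutions over the variables of colours \<open>i\<close>
  and \<open>j\<close> in \<open>u\<close>, which have positive exponents; the other variables are
  invertible in both subrings.\<close>

lemma rank2_triangular:
  assumes ij: "i \<in> I" "j \<in> I" "i \<noteq> j" and u: "u \<in> cone \<inter> (Dom i \<inter> Dom j)"
  shows "\<exists>P. P \<in> K i \<inter> K j \<and> (\<exists>G b. P = frag_of u * G \<and> unitri reg b G)"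
proof -
  let ?S = "{v \<in> keys u. col v = i \<or> col v = j}"
  have pos: "0 < lookup u v" if "v \<in> ?S" for v
    using that u by (auto simp: Dom_def in_keys_iff order_less_le)
  have S: "v \<in> reg" if "v \<in> ?S" for v
    using cone_pos[OF _ pos[OF that]] u by blast
  have "rank2_fundamental i j v" if "v \<in> ?S" for v
    using rank2[of i j v] rank2[of j i v] rank2_fundamental_sym[of j i v] ij that S[OF that] reg_V by auto
  then have "\<forall>v\<in>?S. \<exists>p. unitri {w \<in> V. deg v \<le> deg w} (snd p) (fst p) \<and>
      frag_of (frag_of v) * fst p \<in> K i \<inter> K j"
    unfolding rank2_fundamental_def by auto
  from bchoice[OF this] obtain p where p: "\<forall>v\<in>?S. unitri {w \<in> V. deg v \<le> deg w} (snd (p v)) (fst (p v)) \<and>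
      frag_of (frag_of v) * fst (p v) \<in> K i \<inter> K j"
    by blast
  define G b where "G = fst \<circ> p" and "b = snd \<circ> p"
  have G: "unitri {w \<in> V. deg v \<le> deg w} (b v) (G v)" "frag_of (frag_of v) * G v \<in> K i \<inter> K j"
    if "v \<in> ?S" for v
    using p that by (simp_all add: G_def b_def)
  let ?G = "\<Prod>v\<in>?S. G v ^ nat (lookup u v)"
  have reg: "unitri reg (\<bar>b v\<bar>) (G v)" if v: "v \<in> ?S" for v
  proof (rule unitri_mono[OF G(1)[OF v]])
    obtain x where "x \<in> keys M" "deg x \<le> deg v"
      using S[OF v] unfolding reg_def by blast
    then show "{w \<in> V. deg v \<le> deg w} \<subseteq> reg"
      by (auto simp: reg_def intro!: bexI[of _ x])
  qed simp
  have unitri: "unitri reg (\<Sum>v\<in>?S. int (nat (lookup u v)) * \<bar>b v\<bar>) ?G"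
    by (intro unitri_prod unitri_power reg) auto
  have eq: "frag_of u * ?G = frag_of (part (- ?S) u) * (\<Prod>v\<in>?S. (frag_of (frag_of v) * G v) ^ nat (lookup u v))"
    using pos by (subst frag_of_split[of ?S]) (auto simp: power_mult_distrib prod.distrib order_less_le)
  have "frag_of (part (- ?S) u) \<in> K k"
      "(\<Prod>v\<in>?S. (frag_of (frag_of v) * G v) ^ nat (lookup u v)) \<in> K k" if k: "k = i \<or> k = j" for k
  proof -
    show "frag_of (part (- ?S) u) \<in> K k"
      using u k by (intro K_free) (auto simp: keys_part Dom_def)
    have "frag_of (frag_of v) * G v \<in> K k" if "v \<in> ?S" for v
      using G(2)[OF that] k by auto
    then show "(\<Prod>v\<in>?S. (frag_of (frag_of v) * G v) ^ nat (lookup u v)) \<in> K k"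
      by (intro K_prod K_power)
  qed
  then have "frag_of (part (- ?S) u) * (\<Prod>v\<in>?S. (frag_of (frag_of v) * G v) ^ nat (lookup u v)) \<in> K i \<inter> K j"
    by (simp add: K_mult)
  then have "frag_of u * ?G \<in> K i \<inter> K j"
    by (simp only: eq)
  with unitri show ?thesis
    by blast
qed

text \<open>The gluing step. If \<open>G\<close> approximates \<open>f\<close> up to depth
  \<open>m\<close>, then at depth \<open>m + 1\<close> the error \<open>f - G\<close> equals
  \<open>ki - G\<close> and \<open>kj - G\<close>, so \<open>K_lowest\<close> makes its monomials
  dominant for both colours. A combination of rank-two products removes them.\<close>

lemma K_inter_approx:
  assumes ij: "i \<in> I" "j \<in> I" "i \<noteq> j" and f: "f \<in> H (- 1)"
    and k: "ki \<in> K i" "f - ki \<in> H h" "kj \<in> K j" "f - kj \<in> H h" and h: "- 1 \<le> h"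
  shows "\<exists>G\<in>K i \<inter> K j. f - G \<in> H h"
proof -
  obtain F where F: "\<And>u. u \<in> cone \<inter> (Dom i \<inter> Dom j) \<Longrightarrow> F u \<in> K i \<inter> K j"
      "triangular F (Dom i \<inter> Dom j)"
    using rank2_triangular[OF ij] unfolding triangular_def by metis
  have ext: "frag_extend F c \<in> K i \<inter> K j" if "keys c \<subseteq> cone \<inter> (Dom i \<inter> Dom j)" for c
    using that by (induction c rule: frag_induction) (use F(1) in \<open>auto simp: frag_extend_diff K_zero K_diff\<close>)
  have "m \<le> h \<longrightarrow> (\<exists>G\<in>K i \<inter> K j. f - G \<in> H m)" if "- 1 \<le> m" for m
    using that
  proof (induction m rule: int_ge_induct)
    case base
    show ?case
      using f K_zero by (auto intro!: bexI[of _ 0])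
  next
    case (step m)
    show ?case
    proof
      assume m: "m + 1 \<le> h"
      then obtain G where G: "G \<in> K i" "G \<in> K j" "f - G \<in> H m"
        using step.IH by auto
      have low: "u \<in> Dom l" if l: "k \<in> K l" "f - k \<in> H h" "G \<in> K l" and u: "u \<in> keys (f - G)" "dep u = m + 1"
        for u l k
      proof -
        have kG: "k - G = (f - G) - (f - k)"
          by simp
        have "f - k \<in> H m"
          using l(2) H_mono[of m h] m by auto
        then have "k - G \<in> H m"
          unfolding kG using G(3) by (rule H_diff[rotated])
        moreover have "lookup (f - k) u = 0"
          using H_lookup[OF l(2)] u(2) m by auto
        then have "u \<in> keys (k - G)"
          using u(1) unfolding kG in_keys_iff lookup_minus[of "f - G"] by simp
        ultimately show ?thesis
          using K_lowest[OF K_diff[OF l(1,3)] _ _ u(2)] by blast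
      qed
      obtain c where c: "keys c \<subseteq> cone \<inter> (Dom i \<inter> Dom j)" "(f - G) - frag_extend F c \<in> H (m + 1)"
        using triangular_refine[OF F(2) G(3)] low[OF k(1,2) G(1)] low[OF k(3,4) G(2)] by blast
      then show "\<exists>G\<in>K i \<inter> K j. f - G \<in> H (m + 1)"
        using ext[OF c(1)] G K_add by (intro bexI[of _ "G + frag_extend F c"]) (auto simp: algebra_simps)
    qed
  qed
  then show ?thesis
    using h by blast
qed

text \<open>Both \<open>ki\<close> and \<open>kj\<close> are compared with a common approximation
  \<open>G\<close> in \<open>K i \<inter> K j\<close>. A difference inside one subring has only
  dominant monomials for that colour at its lowest depth, hence coefficient 0 at
  \<open>u\<close>.\<close>

lemma K_coefficient_unique:
  assumes ij: "i \<in> I" "j \<in> I" and f: "f \<in> H (- 1)" and h: "- 1 \<le> h"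
    and k: "ki \<in> K i" "f - ki \<in> H h" "kj \<in> K j" "f - kj \<in> H h"
    and u: "dep u = h + 1" "u \<notin> Dom i" "u \<notin> Dom j"
  shows "lookup ki u = lookup kj u"
proof -
  have *: "lookup k u = lookup G u" if "k \<in> K l" "G \<in> K l" "f - k \<in> H h" "f - G \<in> H h" "u \<notin> Dom l" for k G l
  proof -
    have "k - G = (f - G) - (f - k)"
      by simp
    then have "k - G \<in> H h"
      using H_diff[OF that(4,3)] by simp
    then have "u \<notin> keys (k - G)"
      using K_lowest[OF K_diff[OF that(1,2)] _ _ u(1)] that(5) by blast
    then show ?thesis
      by (simp add: in_keys_iff lookup_minus)
  qed
  show ?thesis
  proof (cases "i = j")
    case True
    then show ?thesis
      using * k u by blast
  next
    case False
    then obtain G where "G \<in> K i" "G \<in> K j" "f - G \<in> H h"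
      using K_inter_approx[OF ij False f k h] by blast
    then show ?thesis
      using *[of ki i G] *[of kj j G] k u by simp
  qed
qed

lemma truncated_solution:
  "\<exists>f. f \<in> H (- 1) \<and> (\<forall>u\<in>keys f. dep u \<le> int h) \<and> lookup f M = 1 \<and>
    (\<forall>u\<in>keys f. nonneg u \<longrightarrow> u = M) \<and> (\<forall>i\<in>I. \<exists>k\<in>Kc i. f - k \<in> H (int h))"
proof (induction h)
  case 0
  have f: "frag_of M \<in> H (- 1)"
    using M_cone dep_nonneg[OF M_cone] by (simp add: H_def)
  have "coords 0 = 0"
    using coords_AA[of 0] by simp
  then have dM: "dep M = 0"
    by (simp add: dep_def)
  have "0 \<in> Kc i" for i
    unfolding Kc_def by (intro image_eqI[of _ _ 0]) auto
  \<comment> \<open>The zero element approximates \<open>M\<close> up to depth -1, and one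
    refinement reaches depth 0, because \<open>M\<close> is dominant for every colour.\<close>
  then have "\<exists>k\<in>Kc i. frag_of M - k \<in> H (- 1 + 1)" for i
    by (rule Kc_refine) (use f M_V M_nonneg in \<open>auto simp: Dom_def nonneg_def\<close>)
  then show ?case
    using f dM by (intro exI[of _ "frag_of M"]) auto
next
  case (Suc h)
  then obtain f k where f: "f \<in> H (- 1)" "\<And>u. u \<in> keys f \<Longrightarrow> dep u \<le> int h" "lookup f M = 1"
      "\<And>u. u \<in> keys f \<Longrightarrow> nonneg u \<Longrightarrow> u = M"
    and k: "\<And>i. i \<in> I \<Longrightarrow> k i \<in> Kc i" "\<And>i. i \<in> I \<Longrightarrow> f - k i \<in> H (int h)"
    by metis
  \<comment> \<open>Only non-dominant monomials receive a new coefficient. At dominant ones of depth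
    \<open>h + 1\<close> it stays 0, and each colour can correct its own expansion there because
    they are \<open>i\<close>-dominant for every \<open>i\<close>.\<close>
  define T where "T = {u \<in> (\<Union>i\<in>I. keys (k i)). u \<in> cone \<and> dep u = int h + 1 \<and> \<not> nonneg u}"
  have "finite T"
    using cartan by (auto simp: T_def finite_cartan_matrix_def)
  have "\<exists>i\<in>I. u \<notin> Dom i" if "u \<in> T" for u
  proof -
    have "keys u \<subseteq> V" "\<not> nonneg u"
      using that cone_V by (auto simp: T_def)
    then obtain v where "lookup u v < 0" "keys u \<subseteq> V"
      by (auto simp: nonneg_def not_le)
    then show ?thesis
      using col_I[of v] by (intro bexI[of _ "col v"]) (auto simp: Dom_def in_keys_iff subset_iff)
  qed
  \<comment> \<open>Any colour that forces the coefficient at \<open>u\<close> may be chosen, since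
    two of them give the same value by \<open>K_coefficient_unique\<close>.\<close>
  then obtain \<iota> where \<iota>: "\<And>u. u \<in> T \<Longrightarrow> \<iota> u \<in> I" "\<And>u. u \<in> T \<Longrightarrow> u \<notin> Dom (\<iota> u)"
    by metis
  define g where "g = (\<Sum>u\<in>T. frag_cmul (lookup (k (\<iota> u)) u) (frag_of u))"
  have g: "lookup g u = (if u \<in> T then lookup (k (\<iota> u)) u else 0)" for u
  proof -
    have "lookup g u = (\<Sum>w\<in>T. if w = u then lookup (k (\<iota> u)) u else 0)"
      unfolding g_def lookup_sum by (intro sum.cong) auto
    then show ?thesis
      using \<open>finite T\<close> by (simp add: sum.delta)
  qed
  have gT: "keys g \<subseteq> T"
    by (auto simp: in_keys_iff g split: if_splits)
  have gH: "g \<in> H (int h)"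
    using gT unfolding H_def T_def by auto
  have fg: "f + g \<in> H (- 1)"
    using H_add[OF f(1), of g] gH H_mono[of "- 1" "int h"] by auto
  have keys: "u \<in> keys f \<or> u \<in> T" if "u \<in> keys (f + g)" for u
    using that gT Poly_Mapping.keys_add[of f g] by blast
  have "\<exists>k\<in>Kc i. (f + g) - k \<in> H (int h + 1)" if i: "i \<in> I" for i
  proof (rule Kc_refine[OF k(1)[OF i]])
    show "f + g - k i \<in> H (int h)"
      using H_add[OF k(2)[OF i] gH] by (simp add: algebra_simps)
    then have cone: "u \<in> cone" if "u \<in> keys (f + g - k i)" for u
      using that unfolding H_def by auto
    fix u assume u: "u \<in> keys (f + g - k i)" "dep u = int h + 1"
    show "u \<in> Dom i"
    proof (rule ccontr)
      assume nd: "u \<notin> Dom i"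
      then have "\<not> nonneg u"
        using cone_V[OF cone[OF u(1)]] by (auto simp: Dom_def nonneg_def)
      have "lookup f u = 0"
        using f(2)[of u] u(2) by (auto simp: in_keys_iff)
      moreover have "lookup g u = lookup (k i) u"
      proof (cases "u \<in> T")
        case True
        then have "lookup (k (\<iota> u)) u = lookup (k i) u"
          using Kc_K k \<iota> i nd f(1) u(2)
          by (intro K_coefficient_unique[of "\<iota> u" i f "int h"]) auto
        then show ?thesis
          using True by (simp add: g)
      next
        case False
        then show ?thesis
          using i u(2) cone[OF u(1)] \<open>\<not> nonneg u\<close> by (auto simp: g T_def in_keys_iff)
      qed
      ultimately show False
        using u(1) by (simp add: in_keys_iff lookup_add lookup_minus)
    qed
  qed
  moreover have "M \<notin> T"
    using M_nonneg by (simp add: T_def)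
  moreover have "\<And>u. u \<in> T \<Longrightarrow> dep u = int h + 1 \<and> \<not> nonneg u"
    by (simp add: T_def)
  ultimately show ?case
    using fg f keys by (intro exI[of _ "f + g"]) (force simp: lookup_add g add.commute)
qed

end

text \<open>By compactness the form is at least some positive \<open>\<epsilon>\<close> on every
  face of the unit cube where one coordinate is 1. Scaling a nonnegative \<open>x\<close> by its
  largest coordinate \<open>s\<close> gives \<open>\<epsilon> * s\<^sup>2\<close> as a lower bound
  of the form, while the linear side is at most \<open>L * s\<close>; thus \<open>s\<close> is
  bounded.\<close>

lemma positive_definite_bound:
  fixes a :: "'i \<Rightarrow> 'i \<Rightarrow> real" and b :: "'i \<Rightarrow> real"
  assumes I: "finite I"
    and pos: "\<And>x. \<exists>i\<in>I. x i \<noteq> 0 \<Longrightarrow> 0 < (\<Sum>i\<in>I. \<Sum>j\<in>I. a i j * x i * x j)"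
  shows "\<exists>B. \<forall>x. (\<forall>i\<in>I. 0 \<le> x i) \<and> (\<Sum>i\<in>I. \<Sum>j\<in>I. a i j * x i * x j) \<le> (\<Sum>i\<in>I. b i * x i)
    \<longrightarrow> (\<Sum>i\<in>I. x i) \<le> B"
proof (cases "I = {}")
  case False
  define Q where "Q x = (\<Sum>i\<in>I. \<Sum>j\<in>I. a i j * x i * x j)" for x :: "'i \<Rightarrow> real"
  define S where "S k = PiE I (\<lambda>j. if j = k then {1} else {0..1::real})" for k
  let ?X = "product_topology (\<lambda>_. euclideanreal) I"
  have "\<exists>e>0. \<forall>x\<in>S k. e \<le> Q x" if k: "k \<in> I" for k
  proof -
    have "compactin ?X (S k)"
      unfolding S_def compactin_PiE by auto
    moreover have "continuous_map ?X euclideanreal Q"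
      unfolding Q_def by (intro continuous_intros continuous_map_product_projection) (use I in auto)
    ultimately have "compact (Q ` S k)"
      using image_compactin by fastforce
    moreover have "(\<lambda>j\<in>I. if j = k then 1 else 0) \<in> S k"
      unfolding S_def by auto
    then have "Q ` S k \<noteq> {}"
      by blast
    ultimately obtain x where x: "x \<in> S k" "\<And>y. y \<in> S k \<Longrightarrow> Q x \<le> Q y"
      using compact_attains_inf[of "Q ` S k"] by blast
    have "x k = 1"
      using PiE_mem[OF x(1)[unfolded S_def] k] by simp
    then have "0 < Q x"
      unfolding Q_def using k by (intro pos bexI[of _ k]) auto
    then show ?thesis
      using x by blast
  qed
  then obtain e where e: "\<And>k. k \<in> I \<Longrightarrow> 0 < e k" "\<And>k x. k \<in> I \<Longrightarrow> x \<in> S k \<Longrightarrow> e k \<le> Q x"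
    by metis
  define \<epsilon> where "\<epsilon> = Min (e ` I)"
  have \<epsilon>: "0 < \<epsilon>" "\<And>k. k \<in> I \<Longrightarrow> \<epsilon> \<le> e k"
    using I False e(1) by (auto simp: \<epsilon>_def)
  define L where "L = (\<Sum>i\<in>I. \<bar>b i\<bar>)"
  have "(\<Sum>i\<in>I. x i) \<le> real (card I) * (L / \<epsilon>)"
    if x: "\<forall>i\<in>I. 0 \<le> x i" and le: "Q x \<le> (\<Sum>i\<in>I. b i * x i)" for x
  proof -
    define s where "s = Max (x ` I)"
    have s: "x i \<le> s" if "i \<in> I" for i
      using that I by (simp add: s_def)
    have "s \<in> x ` I"
      unfolding s_def using I False by (intro Max_in) auto
    then obtain k where k: "k \<in> I" "x k = s"
      by blast
    have "s \<le> L / \<epsilon>"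
    proof (cases "s = 0")
      case True
      then show ?thesis
        using \<epsilon>(1) by (simp add: L_def sum_nonneg)
    next
      case False
      then have "0 < s"
        using x k by force
      define y where "y = (\<lambda>i\<in>I. x i / s)"
      have "y \<in> S k"
        unfolding y_def S_def using x s k \<open>0 < s\<close> by auto
      then have "\<epsilon> \<le> Q y"
        using e(2) \<epsilon>(2) k(1) by force
      also have "Q y = Q x / s\<^sup>2"
        unfolding Q_def sum_divide_distrib
        by (intro sum.cong) (auto simp: y_def power2_eq_square)
      finally have "\<epsilon> * s\<^sup>2 \<le> Q x"
        using \<open>0 < s\<close> by (simp add: field_simps)
      also note le
      also have "(\<Sum>i\<in>I. b i * x i) \<le> (\<Sum>i\<in>I. \<bar>b i\<bar> * s)"
      proof (rule sum_mono)
        fix i assume i: "i \<in> I"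
        have "b i * x i \<le> \<bar>b i\<bar> * x i"
          using x i by (intro mult_right_mono) auto
        also have "\<dots> \<le> \<bar>b i\<bar> * s"
          using s[OF i] by (intro mult_left_mono) auto
        finally show "b i * x i \<le> \<bar>b i\<bar> * s" .
      qed
      also have "\<dots> = L * s"
        by (simp add: L_def sum_distrib_right)
      finally have "\<epsilon> * s \<le> L"
        using \<open>0 < s\<close> by (simp add: power2_eq_square)
      then show ?thesis
        using \<epsilon>(1) by (simp add: field_simps)
    qed
    moreover have "(\<Sum>i\<in>I. x i) \<le> (\<Sum>i\<in>I. s)"
      by (rule sum_mono) (rule s)
    ultimately show ?thesis
      using mult_left_mono[of s "L / \<epsilon>" "real (card I)"] by simp
  qed
  then show ?thesis
    unfolding Q_def by blast
qed auto

context coloured_system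
begin

lemma finite_I: "finite I"
  using cartan by (simp add: finite_cartan_matrix_def)

lemma cnt_A_C:
  assumes "v \<in> V" "i \<in> I"
  shows "cnt i (A v) = C i (col v)"
  using cnt_A[OF assms(1)] card_nb[OF assms] cartan assms(2) by (auto simp: finite_cartan_matrix_def)

lemma cnt_AA:
  assumes "keys n \<subseteq> V" "i \<in> I"
  shows "cnt i (AA n) = (\<Sum>j\<in>I. C i j * cnt j n)"
  using assms(1)
proof (induction n rule: frag_induction)
  case (one v)
  then show ?case
    using cnt_A_C[OF one assms(2)] col_I[OF one] finite_I
    by (simp add: if_distrib[of "(*) _"] cong: if_cong)
next
  case (diff a b)
  then show ?case
    by (simp add: frag_extend_diff cnt_diff right_diff_distrib sum_subtractf)
qed simp

lemma tot_eq_sum_cnt: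
  assumes "keys n \<subseteq> V"
  shows "tot n = (\<Sum>j\<in>I. cnt j n)"
  using assms
proof (induction n rule: frag_induction)
  case (one v)
  then show ?case
    using col_I[OF one] finite_I by simp
qed (simp_all add: tot_diff cnt_diff sum_subtractf)

end

section \<open>Lengths of weights and termination\<close>

context dominant_monomial
begin

text \<open>
  \<open>nrm d n\<close> is the difference of the squared lengths of the weights of the monomials
  with exponents \<open>M - AA n\<close> and \<open>M\<close>.
\<close>

definition nrm :: "('i \<Rightarrow> real) \<Rightarrow> ('v \<Rightarrow>\<^sub>0 int) \<Rightarrow> real"
  where "nrm d n = (\<Sum>i\<in>I. d i * cnt i n * (cnt i (AA n) - 2 * cnt i M))"

definition symmetriser :: "('i \<Rightarrow> real) \<Rightarrow> bool"
  where "symmetriser d \<longleftrightarrow> (\<forall>i\<in>I. 0 < d i) \<and>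
    (\<forall>i\<in>I. \<forall>j\<in>I. d i * of_int (C i j) = d j * of_int (C j i))"

text \<open>With \<open>c = cnt l (M - AA n)\<close> and \<open>k = tot s\<close>, the weight moves
  from \<open>w\<close> to \<open>w\<close> minus \<open>k\<close> times a simple root, where
  \<open>k\<close> lies between 0 and \<open>c\<close>. This is on the segment from \<open>w\<close>
  to its reflection; the squared length changes by \<open>- 2 * d l * k * (c - k)\<close>.\<close>

lemma nrm_up:
  assumes d: "symmetriser d" and n: "keys n \<subseteq> V" and l: "l \<in> I"
    and s: "nonneg s" "keys s \<subseteq> {v \<in> V. col v = l}" "tot s \<le> cnt l (M - AA n)"
  shows "nrm d (n + s) \<le> nrm d n"
proof -
  let ?k = "real_of_int (tot s)" and ?p = "\<lambda>i. real_of_int (cnt i (AA n))" and ?n = "\<lambda>i. real_of_int (cnt i n)"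
    and ?m = "\<lambda>i. real_of_int (cnt i M)"
  have cs: "cnt i s = (if i = l then tot s else 0)" for i
  proof (cases "i = l")
    case True
    then show ?thesis
      using s(2) by (auto intro!: cnt_eq_tot)
  next
    case False
    then show ?thesis
      using s(2) by (auto intro!: cnt_other)
  qed
  have sV: "keys s \<subseteq> V"
    using s(2) by auto
  have As: "cnt i (AA s) = C i l * tot s" if "i \<in> I" for i
    unfolding cnt_AA[OF sV that] cs using l finite_I by (simp add: if_distrib[of "(*) _"] cong: if_cong)
  have dpos: "0 < d l" "C l l = 2"
    using d l cartan by (auto simp: symmetriser_def finite_cartan_matrix_def)
  have "nrm d (n + s) = (\<Sum>i\<in>I. d i * (?n i + (if i = l then ?k else 0)) * (?p i + C i l * ?k - 2 * ?m i))"
    unfolding nrm_def using As cs by (intro sum.cong) (auto simp: cnt_add frag_extend_add)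
  also have "\<dots> = (\<Sum>i\<in>I. d i * ?n i * (?p i - 2 * ?m i) + (d i * C i l) * ?n i * ?k
      + (if i = l then d i * ?k * (?p i + C i l * ?k - 2 * ?m i) else 0))"
    by (intro sum.cong) (auto simp: algebra_simps)
  also have "\<dots> = nrm d n + (\<Sum>i\<in>I. (d i * C i l) * ?n i * ?k) + d l * ?k * (?p l + 2 * ?k - 2 * ?m l)"
    unfolding sum.distrib using finite_I l dpos(2) by (simp add: nrm_def)
  also have "(\<Sum>i\<in>I. (d i * C i l) * ?n i * ?k) = (\<Sum>i\<in>I. (d l * C l i) * ?n i * ?k)"
    using d l by (intro sum.cong) (auto simp: symmetriser_def)
  also have "\<dots> = d l * ?k * ?p l"
    unfolding cnt_AA[OF n l] by (simp add: sum_distrib_left mult_ac)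
  finally have "nrm d (n + s) = nrm d n + 2 * d l * ?k * (?p l + ?k - ?m l)"
    by (simp add: algebra_simps)
  moreover have "0 \<le> ?k" "?p l + ?k - ?m l \<le> 0"
    using tot_nonneg[OF s(1)] s(3) by (simp_all add: cnt_diff)
  then have "2 * d l * ?k * (?p l + ?k - ?m l) \<le> 0"
    using dpos(1) by (intro mult_nonneg_nonpos) auto
  ultimately show ?thesis
    by simp
qed

text \<open>In terms of the numbers \<open>cnt i n\<close>, the inequality
  \<open>nrm d n \<le> 0\<close> says that the positive definite form is at most a fixed linear
  form.\<close>

lemma nrm_bound: "\<exists>d B. symmetriser d \<and> (\<forall>n. nonneg n \<and> keys n \<subseteq> V \<and> nrm d n \<le> 0 \<longrightarrow> tot n \<le> int B)"
proof -
  obtain d where d: "symmetriser d"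
    and pos: "\<forall>x. (\<exists>i\<in>I. x i \<noteq> 0) \<longrightarrow> 0 < (\<Sum>i\<in>I. \<Sum>j\<in>I. d i * of_int (C i j) * x i * x j)"
    using cartan unfolding finite_cartan_matrix_def symmetriser_def by (elim conjE exE) simp
  have "\<exists>B. \<forall>x. (\<forall>i\<in>I. 0 \<le> x i) \<and>
      (\<Sum>i\<in>I. \<Sum>j\<in>I. d i * of_int (C i j) * x i * x j) \<le> (\<Sum>i\<in>I. (2 * d i * cnt i M) * x i)
      \<longrightarrow> (\<Sum>i\<in>I. x i) \<le> B"
    by (rule positive_definite_bound[OF finite_I]) (use pos in simp)
  then obtain B where B: "\<forall>x. (\<forall>i\<in>I. 0 \<le> x i) \<and>
      (\<Sum>i\<in>I. \<Sum>j\<in>I. d i * of_int (C i j) * x i * x j) \<le> (\<Sum>i\<in>I. (2 * d i * cnt i M) * x i)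
      \<longrightarrow> (\<Sum>i\<in>I. x i) \<le> B"
    by (elim exE)
  have "tot n \<le> int (nat \<lceil>B\<rceil>)" if n: "nonneg n" "keys n \<subseteq> V" "nrm d n \<le> 0" for n
  proof -
    have "nrm d n = (\<Sum>i\<in>I. \<Sum>j\<in>I. d i * of_int (C i j) * cnt i n * cnt j n)
        - (\<Sum>i\<in>I. (2 * d i * cnt i M) * cnt i n)"
      unfolding nrm_def sum_subtractf[symmetric]
      by (intro sum.cong) (auto simp: cnt_AA[OF n(2)] algebra_simps sum_distrib_left)
    then have "(\<Sum>i\<in>I. real_of_int (cnt i n)) \<le> B"
      using n cnt_nonneg[of n] by (intro B[rule_format]) (auto simp: nonneg_def)
    then have "real_of_int (tot n) \<le> B"
      by (simp add: tot_eq_sum_cnt[OF n(2)])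
    then show ?thesis
      by linarith
  qed
  then show ?thesis
    using d by blast
qed

text \<open>If the weight of \<open>u\<close> is dominant, the squared length of the weight of
  \<open>M\<close> exceeds that of \<open>u\<close> by the pairing of a nonnegative root combination
  with the sum of the two dominant weights. Otherwise some \<open>cnt i u\<close> is negative and
  \<open>K_top\<close> gives a higher key to which the induction and \<open>nrm_up\<close> apply.
  Only dominance of the weight matters here, not of the monomial.\<close>

lemma nrm_keys:
  assumes d: "symmetriser d" and f: "f \<in> H (- 1)" "\<And>u. u \<in> keys f \<Longrightarrow> dep u \<le> h"
    and K: "\<And>i. i \<in> I \<Longrightarrow> \<exists>k\<in>K i. f - k \<in> H h"
    and u: "u \<in> keys f"
  shows "nrm d (coords (M - u)) \<le> 0"
  using u
proof (induction "nat (dep u)" arbitrary: u rule: less_induct)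
  case less
  have fc: "x \<in> cone" if "x \<in> keys f" for x
    using f(1) that unfolding H_def by auto
  have uc: "u \<in> cone"
    by (rule fc[OF less.prems])
  obtain n where n: "nonneg n" "keys n \<subseteq> reg" "keys n \<subseteq> V" "u = M - AA n" "coords (M - u) = n" "dep u = tot n"
    using cone_E[OF uc] .
  show ?case
  proof (cases "\<forall>i\<in>I. 0 \<le> cnt i u")
    case True
    have "d i * cnt i n * (cnt i (AA n) - 2 * cnt i M) \<le> 0" if i: "i \<in> I" for i
    proof (rule mult_nonneg_nonpos)
      show "0 \<le> d i * cnt i n"
        using d i cnt_nonneg[of n i] n(1) by (auto simp: symmetriser_def nonneg_def)
      have "cnt i (AA n) - 2 * cnt i M = - (cnt i u + cnt i M)"
        by (simp add: n(4) cnt_diff)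
      then show "real_of_int (cnt i (AA n) - 2 * cnt i M) \<le> 0"
        using True i cnt_nonneg[of M i] M_nonneg by (auto simp: nonneg_def)
    qed
    then show ?thesis
      unfolding n(5) nrm_def by (simp add: sum_nonpos)
  next
    case False
    then obtain i where i: "i \<in> I" "cnt i u < 0"
      by force
    obtain k where k: "k \<in> K i" "f - k \<in> H h"
      using K[OF i(1)] by blast
    have eq: "lookup f x = lookup k x" if "x \<notin> cone \<or> dep x \<le> h" for x
      using H_lookup[OF k(2) that] by (simp add: lookup_minus)
    have uk: "u \<in> keys k"
      using less.prems f(2)[OF less.prems] eq[of u] by (simp add: in_keys_iff)
    obtain c where c: "keys c \<subseteq> Dom i" "k = frag_extend (E i) c"
      using k(1) unfolding K_def by blast
    obtain w s where "w \<in> keys c" and w: "w \<in> keys k" "nonneg s" "keys s \<subseteq> {v \<in> V. col v = i}"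
        "tot s \<le> cnt i w" "u = w - AA s"
      using K_top[OF c(1) uk[unfolded c(2)]] unfolding c(2) .
    have "w \<in> cone"
      using w(1) eq[of w] fc[of w] by (cases "w \<in> cone") (auto simp: in_keys_iff)
    then obtain n' where n': "keys n' \<subseteq> V" "w = M - AA n'" "coords (M - w) = n'" "dep w = tot n'"
      by (rule cone_E)
    have sV: "keys s \<subseteq> V"
      using w(3) by auto
    have "AA n = AA (n' + s)"
      using n(4) w(5) n'(2) by (simp add: frag_extend_add algebra_simps)
    then have nn: "n = n' + s"
      using AA_inj[OF n(3) keys_add_subset[OF n'(1) sV]] by simp
    \<comment> \<open>If \<open>s\<close> were 0, then \<open>w = u\<close> and
      \<open>tot s \<le> cnt i w\<close> would contradict \<open>cnt i u < 0\<close>.\<close>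
    have "0 < tot s"
    proof (rule tot_pos[OF w(2)])
      show "s \<noteq> 0"
        using w(4,5) i(2) by auto
    qed
    then have "dep w < dep u"
      by (simp add: n(6) n'(4) nn tot_add)
    then have wf: "w \<in> keys f"
      using w(1) eq[of w] f(2)[OF less.prems] by (auto simp: in_keys_iff)
    have "nrm d (coords (M - w)) \<le> 0"
      using less.hyps[of w] wf \<open>dep w < dep u\<close> dep_nonneg[OF \<open>w \<in> cone\<close>] by auto
    then have "nrm d n' \<le> 0"
      by (simp add: n'(3))
    then show ?thesis
      using nrm_up[OF d n'(1) i(1) w(2,3)] w(4) unfolding n(5) nn n'(2) by auto
  qed
qed

text \<open>A truncated solution at the depth \<open>B\<close> of \<open>nrm_bound\<close> is exact:
  dropping the leading monomials below depth \<open>B\<close> from its one-colour expansions changes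
  nothing up to depth \<open>B\<close>, and what is left reaches no further.\<close>

lemma solution:
  "\<exists>f. (\<forall>u\<in>keys f. u \<in> cone) \<and> lookup f M = 1 \<and> (\<forall>u\<in>keys f. nonneg u \<longrightarrow> u = M) \<and> (\<forall>i\<in>I. f \<in> K i)"
proof -
  obtain d B where d: "symmetriser d"
    and B: "\<And>n. nonneg n \<Longrightarrow> keys n \<subseteq> V \<Longrightarrow> nrm d n \<le> 0 \<Longrightarrow> tot n \<le> int B"
    using nrm_bound by blast
  obtain f where f: "f \<in> H (- 1)" "\<And>u. u \<in> keys f \<Longrightarrow> dep u \<le> int B" "lookup f M = 1"
      "\<And>u. u \<in> keys f \<Longrightarrow> nonneg u \<Longrightarrow> u = M" and K: "\<And>i. i \<in> I \<Longrightarrow> \<exists>k\<in>Kc i. f - k \<in> H (int B)"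
    using truncated_solution[of B] by blast
  have nf: "nrm d (coords (M - u)) \<le> 0" if "u \<in> keys f" for u
    using nrm_keys[OF d f(1,2) _ that] K Kc_K by blast
  have fc: "u \<in> cone" if "u \<in> keys f" for u
    using f(1) that unfolding H_def by auto
  have "f \<in> K i" if i: "i \<in> I" for i
  proof -
    obtain c where c: "keys c \<subseteq> cone \<inter> Dom i" "f - frag_extend (E i) c \<in> H (int B)"
      using K[OF i] unfolding Kc_def by blast
    define c' where "c' = part {w. dep w \<le> int B} c"
    define k where "k = frag_extend (E i) c'"
    have "frag_extend (E i) c'' \<in> H (int B)" if "keys c'' \<subseteq> {w \<in> cone \<inter> Dom i. int B < dep w}" for c''
      using that
    proof (induction c'' rule: frag_induction)
      case zero
      show ?case
        by (simp add: H_def)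
    next
      case (one w)
      then have "E i w - frag_of w \<in> H (int B)" "frag_of w \<in> H (int B)"
        using triangular_H[OF E_triangular, of w i] H_mono[of "int B" "dep w"] by (auto simp: H_def)
      from H_add[OF this] show ?case
        by simp
    next
      case (diff a b)
      then show ?case
        by (simp add: frag_extend_diff H_diff)
    qed
    moreover have "keys (c - c') \<subseteq> {w \<in> cone \<inter> Dom i. int B < dep w}"
      using c(1) by (auto simp: c'_def in_keys_iff lookup_minus lookup_part split: if_splits)
    ultimately have "frag_extend (E i) (c - c') \<in> H (int B)"
      by blast
    from H_add[OF c(2) this] have fk: "f - k \<in> H (int B)"
      by (simp add: k_def frag_extend_diff)
    have c'D: "keys c' \<subseteq> cone \<inter> Dom i" "\<And>w. w \<in> keys c' \<Longrightarrow> dep w \<le> int B"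
      using c(1) by (auto simp: c'_def keys_part)
    then have c'_Dom: "keys c' \<subseteq> Dom i"
      by blast
    have kc: "u \<in> cone" if "u \<in> keys k" for u
      using that H_lookup[OF fk, of u] fc[of u]
      by (cases "u \<in> cone") (auto simp: in_keys_iff lookup_minus)
    \<comment> \<open>A key of \<open>k\<close> lies below some leading key \<open>w\<close> of
      depth at most \<open>B\<close>. There \<open>f\<close> and \<open>k\<close> agree, so
      \<open>w\<close> is a key of \<open>f\<close> and satisfies the length bound;
      \<open>nrm_up\<close> transfers the bound to \<open>u\<close>.\<close>
    have dep_k: "dep u \<le> int B" if u: "u \<in> keys k" for u
    proof -
      obtain w s where w: "w \<in> keys c'" "w \<in> keys k" "nonneg s" "keys s \<subseteq> {v \<in> V. col v = i}"
        "tot s \<le> cnt i w" "u = w - AA s"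
        using K_top[OF c'_Dom u[unfolded k_def]] unfolding k_def .
      have "w \<in> keys f"
        using H_lookup[OF fk, of w] c'D(2)[OF w(1)] w(2) by (auto simp: in_keys_iff lookup_minus)
      obtain n where n: "nonneg n" "keys n \<subseteq> V" "w = M - AA n" "coords (M - w) = n"
        using fc[OF \<open>w \<in> keys f\<close>] by (rule cone_E)
      have sV: "keys s \<subseteq> V"
        using w(4) by auto
      have "nrm d (n + s) \<le> nrm d n"
        using nrm_up[OF d n(2) i w(3,4)] w(5) n(3) by simp
      then have "nrm d (n + s) \<le> 0"
        using nf[OF \<open>w \<in> keys f\<close>] n(4) by simp
      then have "tot (n + s) \<le> int B"
        using B n w(3) sV by (simp add: nonneg_add keys_add_subset)
      moreover have "M - u = AA (n + s)"
        by (simp add: w(6) n(3) frag_extend_add)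
      then have "dep u = tot (n + s)"
        unfolding dep_def using coords_AA[OF keys_add_subset[OF n(2) sV]] by simp
      ultimately show ?thesis
        by simp
    qed
    have k_dep: "lookup k u = 0" "lookup f u = 0" if "int B < dep u" for u
      using that f(2)[of u] dep_k[of u] by (auto simp: in_keys_iff not_le[symmetric])
    have "lookup f u = lookup k u" for u
      using H_lookup[OF fk, of u] k_dep[of u] by (cases "int B < dep u") (auto simp: lookup_minus)
    then have "f = k"
      by (rule poly_mapping_eqI)
    then show ?thesis
      using K_extend[of c' i] c'D(1) by (simp add: k_def)
  qed
  then show ?thesis
    using f fc by blast
qed

end

section \<open>Cartan matrices\<close>

lemma finite_cartan_matrix_product:
  assumes C: "finite_cartan_matrix I C" and ij: "i \<in> I" "j \<in> I" "i \<noteq> j"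
  shows "C i j * C j i < 4"
proof -
  obtain d where d: "\<forall>i\<in>I. 0 < d i" "\<forall>i\<in>I. \<forall>j\<in>I. d i * of_int (C i j) = d j * of_int (C j i)"
    and pos: "\<forall>x :: _ \<Rightarrow> real. (\<exists>i\<in>I. x i \<noteq> 0) \<longrightarrow> 0 < (\<Sum>i\<in>I. \<Sum>j\<in>I. d i * of_int (C i j) * x i * x j)"
    using C unfolding finite_cartan_matrix_def by (elim conjE exE) simp
  have fin: "finite I" and diag: "C i i = 2" "C j j = 2"
    using C ij by (auto simp: finite_cartan_matrix_def)
  let ?a = "real_of_int (C i j)"
  \<comment> \<open>Up to scaling, the value at \<open>i\<close> minimises the form for a fixed
    value at \<open>j\<close>; the resulting minimum is a multiple of the determinant of the
    rank-two form.\<close>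
  define x where "x k = (if k = i then - ?a * d i else if k = j then 2 * d i else 0)" for k
  have sub: "(\<Sum>k\<in>I. f k) = f i + f j" if "\<And>k. k \<noteq> i \<Longrightarrow> k \<noteq> j \<Longrightarrow> f k = 0" for f :: "_ \<Rightarrow> real"
  proof -
    have "(\<Sum>k\<in>I. f k) = (\<Sum>k\<in>{i, j}. f k)"
      using fin ij that by (intro sum.mono_neutral_right) auto
    then show ?thesis
      using ij by simp
  qed
  have "0 < (\<Sum>k\<in>I. \<Sum>l\<in>I. d k * of_int (C k l) * x k * x l)"
  proof -
    have "\<exists>k\<in>I. x k \<noteq> 0"
      using ij d(1) by (intro bexI[of _ j]) (auto simp: x_def)
    then show ?thesis
      using pos by simp
  qed
  also have "\<dots> = (\<Sum>k\<in>I. d k * of_int (C k i) * x k * x i + d k * of_int (C k j) * x k * x j)"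
    by (intro sum.cong refl sub) (auto simp: x_def)
  also have "\<dots> = (d i * of_int (C i i) * x i * x i + d i * of_int (C i j) * x i * x j) +
      (d j * of_int (C j i) * x j * x i + d j * of_int (C j j) * x j * x j)"
    by (intro sub) (auto simp: x_def)
  also have "\<dots> = 2 * (d i)\<^sup>2 * (4 * d j - ?a * (d i * ?a))"
  proof -
    have "d j * real_of_int (C j i) = d i * ?a"
      using d(2) ij by auto
    then show ?thesis
      using ij by (simp add: x_def diag power2_eq_square algebra_simps)
  qed
  also have "d i * ?a = d j * real_of_int (C j i)"
    using d(2) ij by auto
  finally have "?a * (d j * real_of_int (C j i)) < 4 * d j"
    using d(1) ij by (simp add: zero_less_mult_iff)
  then have "d j * (?a * real_of_int (C j i)) < d j * 4"
    by (simp add: mult_ac)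
  then have "real_of_int (C i j * C j i) < real_of_int 4"
    using d(1) ij by simp
  then show ?thesis
    by (simp only: of_int_less_iff)
qed

text \<open>Inverting \<open>d\<close> symmetrises the transpose, whose form at \<open>x\<close> is
  the original one at the vector \<open>x i / d i\<close>. It is needed for the specialisation at
  \<open>q = epsilon\<close>, which is of Langlands dual type.\<close>

lemma finite_cartan_matrix_transpose:
  assumes "finite_cartan_matrix I C"
  shows "finite_cartan_matrix I (\<lambda>i j. C j i)"
proof -
  obtain d where d: "\<forall>i\<in>I. 0 < d i" "\<forall>i\<in>I. \<forall>j\<in>I. d i * of_int (C i j) = d j * of_int (C j i)"
    and pos: "\<forall>x :: _ \<Rightarrow> real. (\<exists>i\<in>I. x i \<noteq> 0) \<longrightarrow> 0 < (\<Sum>i\<in>I. \<Sum>j\<in>I. d i * of_int (C i j) * x i * x j)"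
    using assms unfolding finite_cartan_matrix_def by (elim conjE exE) simp
  have eq: "inverse (d i) * of_int (C j i) = inverse (d j) * real_of_int (C i j)" if "i \<in> I" "j \<in> I" for i j
  proof -
    have "0 < d i" "0 < d j" "d i * of_int (C i j) = d j * real_of_int (C j i)"
      using d that by auto
    then show ?thesis
      by (simp add: field_simps)
  qed
  have "0 < (\<Sum>i\<in>I. \<Sum>j\<in>I. inverse (d i) * of_int (C j i) * x i * x j)"
    if x: "\<exists>i\<in>I. x i \<noteq> 0" for x :: "_ \<Rightarrow> real"
  proof -
    have "\<exists>i\<in>I. x i / d i \<noteq> 0"
      using x d(1) by fastforce
    then have "0 < (\<Sum>i\<in>I. \<Sum>j\<in>I. d i * of_int (C i j) * (x i / d i) * (x j / d j))"
      by (rule pos[rule_format])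
    also have "\<dots> = (\<Sum>i\<in>I. \<Sum>j\<in>I. inverse (d i) * of_int (C j i) * x i * x j)"
    proof (intro sum.cong refl)
      fix i j assume "i \<in> I" "j \<in> I"
      then have "d i \<noteq> 0" "d j \<noteq> 0"
        using d(1) by auto
      then have "d i * of_int (C i j) * (x i / d i) * (x j / d j) = inverse (d j) * real_of_int (C i j) * x i * x j"
        by (simp add: field_simps)
      then show "d i * of_int (C i j) * (x i / d i) * (x j / d j) = inverse (d i) * of_int (C j i) * x i * x j"
        using eq[OF \<open>i \<in> I\<close> \<open>j \<in> I\<close>] by simp
    qed
    finally show ?thesis .
  qed
  moreover have "\<forall>i\<in>I. 0 < inverse (d i)"
    using d(1) by simp
  ultimately show ?thesis
    using assms eq unfolding finite_cartan_matrix_def by (intro conjI exI[of _ "\<lambda>i. inverse (d i)"]) auto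
qed

context interpolation
begin

lemma r_cases: "i \<in> I \<Longrightarrow> r i = 1 \<or> r i = 2"
  using r_values by auto

lemma C_diag: "i \<in> I \<Longrightarrow> C i i = 2"
  using cartan by (simp add: finite_cartan_matrix_def)

text \<open>Labels in \<open>{1, 2}\<close> allow only ratios 1 and 2 between the two entries.
  Together with the product being less than 4 this leaves A1 x A1, A2 and the two orientations of
  B2.\<close>

lemma C_cases:
  assumes ij: "i \<in> I" "j \<in> I" "i \<noteq> j"
  obtains "C i j = 0" "C j i = 0"
  | "C i j = - 1" "C j i = - 1" "r i = r j"
  | "C i j = - 2" "C j i = - 1" "r i = 1" "r j = 2"
  | "C i j = - 1" "C j i = - 2" "r i = 2" "r j = 1"
proof -
  have le: "C i j \<le> 0" "C j i \<le> 0" and zero: "C i j = 0 \<Longrightarrow> C j i = 0" "C j i = 0 \<Longrightarrow> C i j = 0"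
    using cartan ij by (auto simp: finite_cartan_matrix_def)
  have prod: "C i j * C j i < 4"
    using finite_cartan_matrix_product[OF cartan ij] .
  have sq: "c = 0 \<or> c = - 1" if "c \<le> 0" "c * c < 4" for c :: int
  proof (rule ccontr)
    assume "\<not> ?thesis"
    then have "2 \<le> - c"
      using that(1) by linarith
    then have "2 * 2 \<le> (- c) * (- c)"
      by (intro mult_mono) auto
    then show False
      using that(2) by simp
  qed
  consider "r i = r j" | "r i = 1" "r j = 2" | "r i = 2" "r j = 1"
    using r_cases[OF ij(1)] r_cases[OF ij(2)] by auto
  then show thesis
  proof cases
    case 1
    then have "C i j = C j i"
      using symmetrised[OF ij(1,2)] r_cases[OF ij(1)] by auto
    then show thesis
      using that(1,2) 1 sq[of "C i j"] le prod by auto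
  next
    case 2
    then have e: "C i j = 2 * C j i"
      using symmetrised[OF ij(1,2)] by simp
    then have "C j i * C j i < 4"
      using prod zero_le_square[of "C j i"] by simp
    then have "C j i = 0 \<or> C j i = - 1"
      using sq le by blast
    then show thesis
      using that(1,3) 2 e by auto
  next
    case 3
    then have e: "C j i = 2 * C i j"
      using symmetrised[OF ij(1,2)] by simp
    then have "C i j * C i j < 4"
      using prod zero_le_square[of "C i j"] by simp
    then have "C i j = 0 \<or> C i j = - 1"
      using sq le by blast
    then show thesis
      using that(1,4) 3 e by auto
  qed
qed

section \<open>The specialisation at \<open>t = 1\<close>\<close>

definition qv :: "'i \<Rightarrow> int \<Rightarrow> 'i \<times> complex"
  where "qv i l = (i, q powi l)"

definition Vq :: "('i \<times> complex) set"
  where "Vq = {qv i l | i l. i \<in> I}"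

definition degq :: "'i \<times> complex \<Rightarrow> int"
  where "degq v = fst (qt_exponents (snd v))"

definition upq :: "'i \<times> complex \<Rightarrow> 'i \<times> complex"
  where "upq v = qv (fst v) (degq v + 2 * int (r (fst v)))"

text \<open>The inverse factors of the \<open>A\<close> centred at exponent \<open>l + r i\<close>,
  halfway between \<open>v\<close> and \<open>upq v\<close>.\<close>

definition nbq :: "'i \<times> complex \<Rightarrow> ('i \<times> complex) set"
  where "nbq v = (\<Union>j\<in>I. if C j (fst v) = - 1 then {qv j (degq v + int (r (fst v)))}
    else if C j (fst v) = - 2 then {qv j (degq v + int (r (fst v)) - 1), qv j (degq v + int (r (fst v)) + 1)}
    else {})"

lemma fst_qv [simp]: "fst (qv i l) = i"
  by (simp add: qv_def)

lemma degq_qv [simp]: "degq (qv i l) = l"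
  using qt_exponents_eq[of l 0] by (simp add: qv_def degq_def)

lemma qv_eq [simp]: "qv i l = qv j m \<longleftrightarrow> i = j \<and> l = m"
  by (metis degq_qv fst_qv)

lemma qv_Pair: "(j, b) = qv i l \<longleftrightarrow> j = i \<and> b = q powi l"
  by (auto simp: qv_def)

lemma upq_qv [simp]: "upq (qv i l) = qv i (l + 2 * int (r i))"
  by (simp add: upq_def)

lemma nbq_col:
  assumes "j \<in> I"
  shows "{w \<in> nbq (qv i l). fst w = j} = (if C j i = - 1 then {qv j (l + int (r i))}
    else if C j i = - 2 then {qv j (l + int (r i) - 1), qv j (l + int (r i) + 1)} else {})"
  using assms by (auto simp: nbq_def qv_Pair split: if_splits)

lemma vertex_system_q: "vertex_system Vq fst degq upq nbq"
proof
  fix v assume "v \<in> Vq"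
  then obtain i l where v: "v = qv i l" "i \<in> I"
    by (auto simp: Vq_def)
  show "upq v \<in> Vq" "fst (upq v) = fst v" "degq v < degq (upq v)"
    using v r_cases[OF v(2)] by (auto simp: Vq_def)
  show "finite (nbq v)"
    using cartan by (auto simp: nbq_def finite_cartan_matrix_def)
  show "nbq v \<subseteq> Vq"
    by (auto simp: nbq_def Vq_def split: if_splits)
  fix w assume w: "w \<in> nbq v"
  then obtain j where j: "j \<in> I" "fst w = j"
    by (auto simp: nbq_def split: if_splits)
  then have w': "w \<in> {w \<in> nbq (qv i l). fst w = j}"
    using w v by simp
  have "j \<noteq> i"
    using w' C_diag[OF v(2)] unfolding nbq_col[OF j(1)] by auto
  then show "fst w \<noteq> fst v"
    using v j by simp
  show "degq v < degq w \<and> degq w < degq (upq v)"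
    using w' r_cases[OF v(2)] unfolding nbq_col[OF j(1)] v(1)
    by (rule_tac C_cases[OF v(2) j(1) \<open>j \<noteq> i\<close>[symmetric]]) auto
next
  show "inj_on upq Vq"
  proof (rule inj_onI)
    fix v w assume "v \<in> Vq" "w \<in> Vq" and eq: "upq v = upq w"
    then obtain i l j m where "v = qv i l" "w = qv j m"
      unfolding Vq_def by blast
    with eq show "v = w"
      by auto
  qed
qed

sublocale Q: vertex_system Vq fst degq upq nbq
  by (rule vertex_system_q)

text \<open>In the B2 cases the witnesses follow the lowering chain: for \<open>r i = 1\<close> it
  visits the exponents \<open>l\<close>, \<open>l + 1\<close>, \<open>l + 4\<close>, and for
  \<open>r i = 2\<close> it uses \<open>l + 1\<close>, \<open>l + 3\<close> of colour
  \<open>j\<close> and then \<open>l + 2\<close> of colour \<open>i\<close>.\<close>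

lemma rank2_q:
  assumes ij: "i \<in> I" "j \<in> I" "i \<noteq> j"
  shows "Q.rank2_fundamental i j (qv i l)"
proof -
  have v: "qv i l \<in> Vq"
    using ij by (auto simp: Vq_def)
  show ?thesis
    using ij
  proof (cases rule: C_cases)
    case 1
    then show ?thesis
      using v ij by (intro Q.rank2_A1A1) (auto simp: nbq_col)
  next
    case 2
    then show ?thesis
      using v ij by (intro Q.rank2_A2[where w = "qv j (l + int (r i))"]) (auto simp: nbq_col)
  next
    case 3
    then show ?thesis
      using v ij
      by (intro Q.rank2_B2_short[where p = "qv j (l + 1)" and x = "qv i (l + 4)"]) (auto simp: nbq_col)
  next
    case 4
    then show ?thesis
      using v ij
      by (intro Q.rank2_B2_long[where x = "qv j (l + 1)" and z = "qv i (l + 2)"]) (auto simp: nbq_col)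
  qed
qed

sublocale Q: coloured_system Vq fst degq upq nbq I C
proof
  show "finite_cartan_matrix I C"
    by (rule cartan)
  fix v assume "v \<in> Vq"
  then obtain i l where v: "v = qv i l" "i \<in> I"
    by (auto simp: Vq_def)
  then show "fst v \<in> I"
    by simp
  {
    fix j assume j: "j \<in> I" "j \<noteq> fst v"
    then have ij: "i \<noteq> j"
      using v by auto
    show "int (card {w \<in> nbq v. fst w = j}) = - C j (fst v)"
      unfolding v(1) nbq_col[OF j(1)] using C_cases[OF v(2) j(1) ij] by fastforce
  }
  fix i' j assume "i' \<in> I" "j \<in> I" "i' \<noteq> j" "fst v = i'"
  then show "Q.rank2_fundamental i' j v"
    using rank2_q[of i' j l] v by simp
qed

section \<open>Comparison of the subalgebras with the vertex system at \<open>t = 1\<close>\<close>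

definition expq :: "'i expo \<Rightarrow> 'i expo"
  where "expq = frag_extend (\<lambda>(i, a). frag_of (i, proj_q a))"

lemma expq_add: "expq (u + v) = expq u + expq v"
  and expq_diff: "expq (u - v) = expq u - expq v"
  and expq_uminus: "expq (- u) = - expq u"
  and expq_zero: "expq 0 = 0"
  by (simp_all add: expq_def frag_extend_add frag_extend_diff frag_extend_minus)

lemma expq_sum: "expq (sum f X) = (\<Sum>x\<in>X. expq (f x))"
  by (induction X rule: infinite_finite_induct) (simp_all add: expq_add expq_zero)

lemma qt_lattice_E:
  assumes "a \<in> qt_lattice"
  obtains l m where "a = q powi l * t powi m"
  using assms by (auto simp: qt_lattice_def)

lemma qt_lattice_I: "q powi l * t powi m \<in> qt_lattice"
  by (auto simp: qt_lattice_def)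

lemma qt_mult: "q powi l * t powi m * q = q powi (l + 1) * t powi m"
    "q powi l * t powi m / q = q powi (l - 1) * t powi m"
    "q powi l * t powi m * t = q powi l * t powi (m + 1)"
    "q powi l * t powi m / t = q powi l * t powi (m - 1)"
    "q powi l * t powi m * q ^ k = q powi (l + int k) * t powi m"
    "q powi l * t powi m / q ^ k = q powi (l - int k) * t powi m"
  using q_nonzero t_nonzero by (simp_all add: power_int_add power_int_diff)

lemma expq_Y: "expq (Yexp i (q powi l * t powi m)) = frag_of (qv i l)"
  by (simp add: expq_def proj_q_eq qv_def)

text \<open>\<open>Aexp\<close> is indexed by its centre and \<open>Q.A\<close> by its lower vertex,
  whence the shift by \<open>r i\<close>.\<close>

lemma expq_A:
  assumes i: "i \<in> I"
  shows "expq (Aexp i (q powi l * t powi m)) = Q.A (qv i (l - int (r i)))"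
proof -
  let ?J1 = "{j \<in> I. C j i = - 1}" and ?J2 = "{j \<in> I. C j i = - 2}" and ?l = "l - int (r i)"
  have fin: "finite ?J1" "finite ?J2"
    using Q.finite_I by auto
  have nb: "nbq (qv i ?l) = (\<lambda>j. qv j l) ` ?J1 \<union> ((\<lambda>j. qv j (l - 1)) ` ?J2 \<union> (\<lambda>j. qv j (l + 1)) ` ?J2)"
    by (auto simp: nbq_def split: if_splits)
  have "(\<Sum>w\<in>nbq (qv i ?l). frag_of w)
      = (\<Sum>j\<in>?J1. frag_of (qv j l)) + ((\<Sum>j\<in>?J2. frag_of (qv j (l - 1))) + (\<Sum>j\<in>?J2. frag_of (qv j (l + 1))))"
    unfolding nb using fin
    by (subst sum.union_disjoint; (subst sum.union_disjoint)?) (auto simp: sum.reindex inj_on_def)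
  moreover have "q powi l * t powi m / (q ^ r i * t) = q powi (l - int (r i)) * t powi (m - 1)"
    "q powi l * t powi m * (q ^ r i * t) = q powi (l + int (r i)) * t powi (m + 1)"
    using qt_mult(4)[of "l - int (r i)" m] qt_mult(3)[of "l + int (r i)" m] qt_mult(5,6)[of l m "r i"]
    by (metis divide_divide_eq_left mult.assoc)+
  ultimately show ?thesis
    by (simp add: Aexp_def Q.A_def expq_add expq_diff expq_sum qt_mult expq_Y sum.distrib
        add.commute[of "int (r i)" l])
qed

lemma Pi_q_single: "Pi_q (Poly_Mapping.single u p) = Poly_Mapping.single (expq u) (poly p 1)"
  by (simp add: Pi_q_def expq_def)

lemma Pi_q_mono: "Pi_q (mono u) = frag_of (expq u)"
  by (simp add: mono_def Pi_q_single)

lemma Pi_q_scalar: "Pi_q (scalar p * P) = Poly_Mapping.single 0 (poly p 1) * Pi_q P"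
  by (simp add: Pi_q_def specialise_scalar)

lemma keys_expq:
  assumes "keys u \<subseteq> I \<times> qt_lattice"
  shows "keys (expq u) \<subseteq> Vq"
proof -
  have "keys (expq u) \<subseteq> (\<lambda>(i, a). (i, proj_q a)) ` keys u"
    unfolding expq_def using keys_frag_extend by fastforce
  also have "\<dots> \<subseteq> Vq"
  proof safe
    fix i a assume "(i, a) \<in> keys u"
    then have "i \<in> I" "a \<in> qt_lattice"
      using assms by auto
    then show "(i, proj_q a) \<in> Vq"
      by (elim qt_lattice_E) (auto simp: Vq_def qv_def proj_q_eq)
  qed
  finally show ?thesis .
qed

lemma Pi_q_K_sub:
  assumes i: "i \<in> I" and P: "P \<in> K_sub i"
  shows "Pi_q P \<in> Q.K i"
  using P unfolding K_sub_def
proof (induction rule: subring_gen.induct)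
  case one
  then show ?case
    by (simp add: Pi_q_one Q.K_one)
next
  case (diff x y)
  then show ?case
    by (simp add: Pi_q_diff Q.K_diff)
next
  case (mult x y)
  then show ?case
    by (simp add: Pi_q_mult Q.K_mult)
next
  case (gen x)
  have lat: "\<exists>l m. a = q powi l * t powi m" if "a \<in> qt_lattice" for a
    using that by (elim qt_lattice_E) blast
  have V: "qv j l \<in> Vq" if "j \<in> I" for j l
    using that by (auto simp: Vq_def)
  have free: "Pi_q (mono (Yexp j a)) \<in> Q.K i" "Pi_q (mono (- Yexp j a)) \<in> Q.K i"
      "Pi_q (mono (Wexp j a)) \<in> Q.K i" "Pi_q (mono (- Wexp j a)) \<in> Q.K i"
    if j: "j \<in> I - {i}" and "a \<in> qt_lattice" for j a
  proof -
    obtain l m where a: "a = q powi l * t powi m"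
      using lat[OF \<open>a \<in> qt_lattice\<close>] by blast
    have "frag_of (qv j l) \<in> Q.free i" for l
      using j V by (intro Q.free_frag_of) auto
    then show "Pi_q (mono (Yexp j a)) \<in> Q.K i" "Pi_q (mono (- Yexp j a)) \<in> Q.K i"
      "Pi_q (mono (Wexp j a)) \<in> Q.K i" "Pi_q (mono (- Wexp j a)) \<in> Q.K i"
      unfolding Pi_q_mono a
      by (auto intro!: Q.K_free' Q.free_add Q.free_uminus simp: expq_uminus expq_Y Wexp_def qt_mult expq_add
        simp del: minus_add_distrib)
  qed
  have self: "Pi_q x \<in> Q.K i" if x: "x \<in> K_generators_self i"
  proof (cases "r i = 1")
    case True
    then consider
      a where "a \<in> qt_lattice" "x = mono (Wexp i a) *
            (1 + alpha * Ainv i (a * q\<^sup>2 * t) + Ainv i (a * q\<^sup>2 * t) * Ainv i (a * t))"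
      | a where "a \<in> qt_lattice" "x = alpha * mono (Yexp i a) * (1 + Ainv i (a * q * t))"
      using x unfolding K_generators_self_def by auto
    then show ?thesis
    proof cases
      case (1 a)
      obtain l m where a: "a = q powi l * t powi m"
        using 1(1) lat by blast
      let ?v = "qv i (l - 1)" and ?w = "qv i (l + 1)"
      have "Pi_q x = frag_of (frag_of ?v + frag_of ?w) * (1 + frag_of (- Q.A ?w) + frag_of (- Q.A ?w - Q.A ?v))"
        unfolding 1(2) a using i True
        by (simp add: Pi_q_mult Pi_q_add Pi_q_one Pi_q_alpha Pi_q_mono qt_mult expq_uminus expq_A Wexp_def
            expq_add expq_Y frag_of_mult add.commute[of 1 l])
      \<comment> \<open>For \<open>r i = 1\<close> the vertex \<open>?w\<close> is
        \<open>upq ?v\<close>. The image of the three-term generator is the product of the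
        generators at both vertices minus the one term that is free of colour
        \<open>i\<close>.\<close>
      also have "\<dots> = (frag_of (frag_of ?v + frag_of ?w) + frag_of (frag_of ?v + frag_of ?w - Q.A ?v)
          + frag_of (frag_of ?v + frag_of ?w - Q.A ?w) + frag_of (frag_of ?v + frag_of ?w - Q.A ?v - Q.A ?w))
          - frag_of (frag_of ?v + frag_of ?w - Q.A ?v)"
        by (simp add: algebra_simps frag_of_mult)
      also have "\<dots> \<in> Q.K i"
      proof (intro Q.K_diff Q.K_quad Q.K_free')
        have nb: "{w \<in> nbq ?v. fst w = i} = {}"
          using Q.col_nb[OF V[OF i, of "l - 1"]] by auto
        obtain R where R: "R \<in> Q.free i" "Q.A ?v = frag_of ?v + frag_of (upq ?v) - R"
          using Q.A_split[OF V[OF i, of "l - 1"] fst_qv, of i] unfolding nb by auto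
        then show "frag_of ?v + frag_of ?w - Q.A ?v \<in> Q.free i"
          using True by (simp add: add.commute[of 1 l])
      qed (use V i in \<open>auto simp: Q.free_zero\<close>)
      finally show ?thesis .
    next
      case (2 a)
      obtain l m where a: "a = q powi l * t powi m"
        using 2(1) lat by blast
      have "Pi_q x = frag_of (frag_of (qv i l)) * (1 + frag_of (- Q.A (qv i l)))"
        unfolding 2(2) a using i True
        by (simp add: Pi_q_mult Pi_q_add Pi_q_one Pi_q_alpha Pi_q_mono qt_mult expq_uminus expq_A expq_Y)
      then show ?thesis
        using Q.K_generator[of "qv i l"] V[OF i] by simp
    qed
  next
    case False
    then have r: "r i = 2"
      using r_cases[OF i] by simp
    obtain a where x: "a \<in> qt_lattice" "x = mono (Yexp i a) * (1 + Ainv i (a * q\<^sup>2 * t))"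
      using x False unfolding K_generators_self_def by auto
    obtain l m where a: "a = q powi l * t powi m"
      using x(1) lat by blast
    have "Pi_q x = frag_of (frag_of (qv i l)) * (1 + frag_of (- Q.A (qv i l)))"
      unfolding x(2) a using i r
      by (simp add: Pi_q_mult Pi_q_add Pi_q_one Pi_q_mono qt_mult expq_uminus expq_A expq_Y)
    then show ?thesis
      using Q.K_generator[of "qv i l"] V[OF i] by simp
  qed
  from gen show ?case
    using self free by (auto simp: Pi_q_mult Pi_q_alpha Q.K_one)
qed

lemma K_sub_gen:
  assumes "j \<in> I - {i}" "a \<in> qt_lattice"
  shows "mono (Wexp j a) \<in> K_sub i" "mono (- Wexp j a) \<in> K_sub i"
    "alpha * mono (Yexp j a) \<in> K_sub i" "alpha * mono (- Yexp j a) \<in> K_sub i"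
  unfolding K_sub_def using assms by (blast intro: subring_gen.gen)+

lemma K_sub_self: "x \<in> K_generators_self i \<Longrightarrow> x \<in> K_sub i"
  and K_sub_one: "1 \<in> K_sub i"
  and K_sub_diff: "x \<in> K_sub i \<Longrightarrow> y \<in> K_sub i \<Longrightarrow> x - y \<in> K_sub i"
  and K_sub_mult: "x \<in> K_sub i \<Longrightarrow> y \<in> K_sub i \<Longrightarrow> x * y \<in> K_sub i"
  unfolding K_sub_def by (auto intro: subring_gen.intros)

text \<open>Since \<open>alpha\<close> maps to 1, the multiples of \<open>alpha\<close> provide
  preimages of single variables and of the two-term generators for \<open>r i = 1\<close>.\<close>

lemma K_subset_Pi_q:
  assumes i: "i \<in> I" and P: "P \<in> Q.K i"
  shows "\<exists>k\<in>K_sub i. Pi_q k = P"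
  using P unfolding Q.K_eq
proof (induction rule: subring_gen.induct)
  case one
  then show ?case
    using Pi_q_one K_sub_one by blast
next
  case (diff x y)
  then show ?case
    using Pi_q_diff K_sub_diff by metis
next
  case (mult x y)
  then show ?case
    using Pi_q_mult K_sub_mult by metis
next
  case (gen x)
  have lat: "q powi l \<in> qt_lattice" for l
    using qt_lattice_I[of l 0] by simp
  have Y: "expq (Yexp j (q powi l)) = frag_of (qv j l)" for j l
    using expq_Y[of j l 0] by simp
  from gen consider v where "v \<in> Vq" "fst v = i" "x = frag_of (frag_of v) * (1 + frag_of (- Q.A v))"
    | v where "v \<in> Vq" "fst v \<noteq> i" "x = frag_of (frag_of v)"
    | v where "v \<in> Vq" "fst v \<noteq> i" "x = frag_of (- frag_of v)"
    unfolding Q.gens_def by blast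
  then show ?case
  proof cases
    case (1 v)
    then obtain l where v: "v = qv i l"
      by (auto simp: Vq_def)
    show ?thesis
    proof (cases "r i = 1")
      case True
      have "Pi_q (alpha * mono (Yexp i (q powi l)) * (1 + Ainv i (q powi l * q * t))) = x"
        using True i expq_A[of i "l + 1" 1] q_nonzero
        by (simp add: 1(3) v Pi_q_mult Pi_q_add Pi_q_one Pi_q_alpha Pi_q_mono Y expq_uminus power_int_add)
      moreover have "alpha * mono (Yexp i (q powi l)) * (1 + Ainv i (q powi l * q * t)) \<in> K_generators_self i"
        using True lat unfolding K_generators_self_def by auto
      ultimately show ?thesis
        using K_sub_self by blast
    next
      case False
      then have r: "r i = 2"
        using r_cases[OF i] by simp
      have "Pi_q (mono (Yexp i (q powi l)) * (1 + Ainv i (q powi l * q\<^sup>2 * t))) = x"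
        using r i expq_A[of i "l + 2" 1] q_nonzero
        by (simp add: 1(3) v Pi_q_mult Pi_q_add Pi_q_one Pi_q_mono Y expq_uminus power_int_add)
      moreover have "mono (Yexp i (q powi l)) * (1 + Ainv i (q powi l * q\<^sup>2 * t)) \<in> K_generators_self i"
        using r lat unfolding K_generators_self_def by auto
      ultimately show ?thesis
        using K_sub_self by blast
    qed
  next
    case (2 v)
    then obtain j l where v: "v = qv j l" "j \<in> I - {i}"
      by (auto simp: Vq_def)
    have "Pi_q (alpha * mono (Yexp j (q powi l))) = x"
      by (simp add: 2(3) v(1) Pi_q_mult Pi_q_alpha Pi_q_mono Y)
    then show ?thesis
      using K_sub_gen(3)[OF v(2) lat] by blast
  next
    case (3 v)
    then obtain j l where v: "v = qv j l" "j \<in> I - {i}"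
      by (auto simp: Vq_def)
    have "Pi_q (alpha * mono (- Yexp j (q powi l))) = x"
      by (simp add: 3(3) v(1) Pi_q_mult Pi_q_alpha Pi_q_mono Y expq_uminus)
    then show ?thesis
      using K_sub_gen(4)[OF v(2) lat] by blast
  qed
qed

section \<open>The specialisation at \<open>q = \<epsilon>\<close>\<close>

lemma epsilon_eq: "epsilon = \<i>"
  using cis_conv_exp[of "pi / 2"] cis_pi_half by (simp add: epsilon_def)

lemma epsilon_powi_eq_1: "epsilon powi l = 1 \<longleftrightarrow> 4 dvd l"
proof -
  have "epsilon powi l = epsilon powi (4 * (l div 4) + l mod 4)"
    by simp
  also have "\<dots> = (epsilon powi 4) powi (l div 4) * epsilon powi (l mod 4)"
    by (subst power_int_add) (simp_all add: epsilon_eq power_int_mult)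
  also have "epsilon powi 4 = 1"
    by (simp add: epsilon_eq power4_eq_xxxx)
  finally have "epsilon powi l = epsilon powi (l mod 4)"
    by simp
  moreover have "l mod 4 \<in> {0, 1, 2, 3}"
    by auto
  ultimately show ?thesis
    by (auto simp: epsilon_eq dvd_eq_mod_eq_0 power3_eq_cube complex_eq_iff)
qed

lemma t_powi_eq_1: "t powi k = 1 \<longleftrightarrow> k = 0"
proof (cases k rule: int_cases3)
  case (pos n)
  then show ?thesis
    using t_not_root[of n] by simp
next
  case (neg n)
  then show ?thesis
    using t_not_root[of n] by (simp add: power_int_minus)
qed simp

text \<open>Raising to the fourth power removes \<open>epsilon\<close>, which forces the exponent of
  \<open>t\<close> to vanish; only the order of \<open>epsilon\<close> is then left to
  decide.\<close>

lemma epsilon_t_power_eq_1: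
  assumes "0 < k"
  shows "(epsilon powi a * t powi b) ^ k = 1 \<longleftrightarrow> b = 0 \<and> 4 dvd int k * a"
proof -
  have pow: "(x powi a) ^ n = x powi (int n * a)" for x :: complex and a n
    by (simp add: power_int_mult mult.commute)
  have "b = 0" if "(epsilon powi a * t powi b) ^ k = 1"
  proof -
    have "((epsilon powi a * t powi b) ^ k) ^ 4 = 1"
      using that by simp
    then have "epsilon powi (4 * (int k * a)) * t powi (4 * (int k * b)) = 1"
      by (simp add: power_mult_distrib pow)
    moreover have "epsilon powi (4 * (int k * a)) = 1"
      by (subst epsilon_powi_eq_1) simp
    ultimately show ?thesis
      using assms by (simp add: t_powi_eq_1)
  qed
  then show ?thesis
    by (auto simp: pow epsilon_powi_eq_1)
qed

definition zv :: "'i \<Rightarrow> int \<Rightarrow> int \<Rightarrow> 'i \<times> complex"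
  where "zv i l m = (i, Zindex i (q powi l * t powi m))"

lemma fst_zv [simp]: "fst (zv i l m) = i"
  by (simp add: zv_def)

text \<open>The signs given by \<open>phi\<close> depend on the colour alone and drop out. What
  remains is \<open>epsilon powi l * t powi m\<close> for \<open>r i = 2\<close> and its square for
  \<open>r i = 1\<close>, so that \<open>l\<close> counts modulo 4 and modulo 2
  respectively.\<close>

lemma zv_eq:
  assumes i: "i \<in> I"
  shows "zv i l m = zv j l' m' \<longleftrightarrow> i = j \<and> m = m' \<and> 2 * int (r i) dvd l - l'"
proof -
  let ?x = "epsilon powi l * t powi m" and ?y = "epsilon powi l' * t powi m'"
  have eps: "epsilon \<noteq> 0"
    by (simp add: epsilon_eq)
  then have y: "?y \<noteq> 0"
    using t_nonzero by simp
  have xy: "?x / ?y = epsilon powi (l - l') * t powi (m - m')"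
    using eps t_nonzero by (simp add: power_int_diff)
  have pow: "?x ^ k = ?y ^ k \<longleftrightarrow> m = m' \<and> 4 dvd int k * (l - l')" if "0 < k" for k
  proof -
    have "?x ^ k = ?y ^ k \<longleftrightarrow> (?x / ?y) ^ k = 1"
      using y unfolding power_divide by simp
    also have "\<dots> \<longleftrightarrow> m - m' = 0 \<and> 4 dvd int k * (l - l')"
      unfolding xy using epsilon_t_power_eq_1[OF that] .
    finally show ?thesis
      by simp
  qed
  have "zv i l m = zv i l' m' \<longleftrightarrow> m = m' \<and> 2 * int (r i) dvd l - l'"
    using r_cases[OF i]
  proof
    assume r: "r i = 1"
    have "zv i l m = zv i l' m' \<longleftrightarrow> ?x ^ 2 = ?y ^ 2"
      using r by (simp add: zv_def Zindex_def proj_t_eq)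
    also have "\<dots> \<longleftrightarrow> m = m' \<and> 4 dvd int 2 * (l - l')"
      by (rule pow) simp
    also have "4 dvd int 2 * (l - l') \<longleftrightarrow> 2 dvd l - l'"
      by presburger
    finally show ?thesis
      using r by simp
  next
    assume r: "r i = 2"
    then show ?thesis
      using pow[of 1] by (simp add: zv_def Zindex_def proj_t_eq)
  qed
  moreover have "i = j" if "zv i l m = zv j l' m'"
    using that by (simp add: zv_def)
  ultimately show ?thesis
    by auto
qed

definition Vt :: "('i \<times> complex) set"
  where "Vt = {zv i l m | i l m. i \<in> I}"

definition degt :: "'i \<times> complex \<Rightarrow> int"
  where "degt v = (THE m. \<exists>l. v = zv (fst v) l m)"

text \<open>Raising \<open>m\<close> by 2 multiplies the index by \<open>t^2\<close>, or by
  \<open>t^4\<close> where the index is a square. The accompanying shift of \<open>l\<close> by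
  \<open>2 * r i\<close> is invisible.\<close>

definition upt :: "'i \<times> complex \<Rightarrow> 'i \<times> complex"
  where "upt v = (fst v, snd v * t ^ (if r (fst v) = 2 then 2 else 4))"

text \<open>
  The \<open>q\<close>-exponents \<open>l\<close> only matter modulo \<open>2 r\<^sub>i\<close>; for \<open>r\<^sub>i = 1\<close> and \<open>r\<^sub>j = 2\<close> the representatives
  \<open>l\<close> and \<open>l + 2\<close> of the same vertex produce the two neighbours \<open>Z\<^bsub>j,b\<^esub>\<close> and \<open>Z\<^bsub>j,-b\<^esub>\<close>.
\<close>

definition shift :: "'i \<Rightarrow> 'i \<Rightarrow> int"
  where "shift i j = (if r i = 2 then 2 else if r j = 1 then 1 else 0)"

definition nbt :: "'i \<times> complex \<Rightarrow> ('i \<times> complex) set"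
  where "nbt v = {zv j (l + shift i j) (m + 1) | i j l m. v = zv i l m \<and> i \<in> I \<and> j \<in> I \<and> C j i < 0}"

lemma zv_V: "i \<in> I \<Longrightarrow> zv i l m \<in> Vt"
  by (auto simp: Vt_def)

lemma degt_zv:
  assumes "i \<in> I"
  shows "degt (zv i l m) = m"
  unfolding degt_def
proof (rule the_equality)
  show "\<exists>l'. zv i l m = zv (fst (zv i l m)) l' m"
    by (intro exI[of _ l]) simp
qed (auto simp: zv_eq[OF assms])

lemma upt_zv [simp]: "upt (zv i l m) = zv i l (m + 2)"
proof -
  have t2: "t powi (m + 2) = t powi m * t\<^sup>2"
    using t_nonzero by (simp add: power_int_add)
  show ?thesis
    unfolding upt_def zv_def Zindex_def proj_t_eq fst_conv snd_conv
    unfolding t2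
    by (simp add: power2_eq_square power4_eq_xxxx)
qed

text \<open>The representatives \<open>l'\<close> vary modulo \<open>2 * r i\<close>, while the
  neighbour of colour \<open>j\<close> depends on them modulo \<open>2 * r j\<close>; two neighbours
  arise precisely for \<open>r i = 1\<close> and \<open>r j = 2\<close>.\<close>

lemma nbt_col:
  assumes ij: "i \<in> I" "j \<in> I"
  shows "{w \<in> nbt (zv i l m). fst w = j} = (if C j i < 0 then
      if r i = 1 \<and> r j = 2 then {zv j l (m + 1), zv j (l + 2) (m + 1)} else {zv j (l + shift i j) (m + 1)}
    else {})"
proof -
  have eq: "{w \<in> nbt (zv i l m). fst w = j} =
      {zv j (l' + shift i j) (m + 1) | l'. C j i < 0 \<and> 2 * int (r i) dvd l - l'}" (is "?A = ?B")
  proof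
    show "?A \<subseteq> ?B"
      unfolding nbt_def by (auto simp: zv_eq[OF ij(1)])
    show "?B \<subseteq> ?A"
    proof
      fix w assume "w \<in> ?B"
      then obtain l' where l': "w = zv j (l' + shift i j) (m + 1)" "C j i < 0" "2 * int (r i) dvd l - l'"
        by blast
      then have "zv i l m = zv i l' m"
        by (simp add: zv_eq[OF ij(1)])
      then have "w \<in> nbt (zv i l m)"
        unfolding nbt_def using l' ij by blast
      then show "w \<in> ?A"
        using l'(1) by simp
    qed
  qed
  show ?thesis
  proof (cases "C j i < 0")
    case True
    show ?thesis
    proof (cases "r i = 1 \<and> r j = 2")
      case r: True
      have "zv j l' (m + 1) \<in> {zv j l (m + 1), zv j (l + 2) (m + 1)}" if "2 dvd l - l'" for l'
      proof -
        have "4 dvd l' - l \<or> 4 dvd l' - (l + 2)"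
          using that by presburger
        then show ?thesis
          using r by (auto simp: zv_eq[OF ij(2)])
      qed
      then have "{zv j l' (m + 1) | l'. 2 dvd l - l'} \<subseteq> {zv j l (m + 1), zv j (l + 2) (m + 1)}"
        by blast
      moreover have "2 dvd l - l" "2 dvd l - (l + 2)"
        by presburger+
      then have "{zv j l (m + 1), zv j (l + 2) (m + 1)} \<subseteq> {zv j l' (m + 1) | l'. 2 dvd l - l'}"
        by blast
      ultimately have "{zv j l' (m + 1) | l'. 2 dvd l - l'} = {zv j l (m + 1), zv j (l + 2) (m + 1)}"
        by (rule equalityI)
      then show ?thesis
        unfolding eq using True r by (simp add: shift_def)
    next
      case r: False
      have "zv j (l' + shift i j) (m + 1) = zv j (l + shift i j) (m + 1)" if "2 * int (r i) dvd l - l'" for l'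
      proof -
        have "2 * int (r j) dvd l' - l"
          using that r r_cases[OF ij(1)] r_cases[OF ij(2)] by (auto; presburger)
        then show ?thesis
          by (simp add: zv_eq[OF ij(2)])
      qed
      moreover have "2 * int (r i) dvd l - l"
        by simp
      ultimately have "{zv j (l' + shift i j) (m + 1) | l'. 2 * int (r i) dvd l - l'} = {zv j (l + shift i j) (m + 1)}"
        by blast
      then show ?thesis
        unfolding eq if_not_P[OF r] using True by simp
    qed
  qed (simp add: eq)
qed

lemma zv_distinct: "j \<in> I \<Longrightarrow> r j = 2 \<Longrightarrow> zv j l m \<noteq> zv j (l + 2) m"
  by (simp add: zv_eq)

lemma nbt_E:
  assumes "w \<in> nbt v"
  obtains i j l m where "v = zv i l m" "i \<in> I" "j \<in> I" "C j i < 0" "w = zv j (l + shift i j) (m + 1)"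
  using assms unfolding nbt_def by blast

lemma vertex_system_t: "vertex_system Vt fst degt upt nbt"
proof
  fix v assume "v \<in> Vt"
  then obtain i l m where v: "v = zv i l m" "i \<in> I"
    by (auto simp: Vt_def)
  show "upt v \<in> Vt" "fst (upt v) = fst v" "degt v < degt (upt v)"
    using v by (auto simp: zv_V degt_zv)
  have "nbt v \<subseteq> (\<Union>j\<in>I. {w \<in> nbt (zv i l m). fst w = j})"
  proof
    fix w assume w: "w \<in> nbt v"
    then obtain i' j l' m' where "j \<in> I" "w = zv j (l' + shift i' j) (m' + 1)"
      by (rule nbt_E)
    with w show "w \<in> (\<Union>j\<in>I. {w \<in> nbt (zv i l m). fst w = j})"
      by (simp add: v(1))
  qed
  moreover have "finite \<dots>"
    using nbt_col[OF v(2)] Q.finite_I by simp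
  ultimately show "finite (nbt v)"
    by (rule finite_subset)
  show "nbt v \<subseteq> Vt"
    by (auto elim!: nbt_E simp: zv_V)
  fix w assume "w \<in> nbt v"
  then obtain i' j l' m' where w: "v = zv i' l' m'" "i' \<in> I" "j \<in> I" "C j i' < 0" "w = zv j (l' + shift i' j) (m' + 1)"
    by (rule nbt_E)
  show "fst w \<noteq> fst v"
    using w C_diag[OF w(2)] by auto
  show "degt v < degt w \<and> degt w < degt (upt v)"
    using w by (simp add: degt_zv)
next
  show "inj_on upt Vt"
  proof (rule inj_onI)
    fix v w assume "v \<in> Vt" "w \<in> Vt" and eq: "upt v = upt w"
    then obtain i l m i' l' m' where "v = zv i l m" "w = zv i' l' m'" "i \<in> I"
      unfolding Vt_def by blast
    with eq show "v = w"
      by (auto simp: zv_eq)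
  qed
qed

sublocale T: vertex_system Vt fst degt upt nbt
  by (rule vertex_system_t)

text \<open>Long and short are exchanged compared with \<open>rank2_q\<close>: the six-term solution
  serves \<open>r i = 1\<close>, where the two neighbours of colour \<open>j\<close> differ by the
  shift \<open>l + 2\<close>, and the four-term one serves \<open>r i = 2\<close>.\<close>

lemma rank2_t:
  assumes ij: "i \<in> I" "j \<in> I" "i \<noteq> j"
  shows "T.rank2_fundamental i j (zv i l m)"
proof -
  have v: "zv i l m \<in> Vt" "fst (zv i l m) = i"
    using ij by (auto simp: zv_V)
  show ?thesis
    using ij
  proof (cases rule: C_cases)
    case 1
    then show ?thesis
      using v ij by (intro T.rank2_A1A1) (auto simp: nbt_col)
  next
    case 2
    show ?thesis
    proof (rule T.rank2_A2[OF v ij(3)])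
      show "{x \<in> nbt (zv i l m). fst x = j} = {zv j (l + shift i j) (m + 1)}"
        unfolding nbt_col[OF ij(1,2)] using 2 by auto
      show "{x \<in> nbt (zv j (l + shift i j) (m + 1)). fst x = i} = {upt (zv i l m)}"
        unfolding nbt_col[OF ij(2,1)] using 2 r_cases[OF ij(1)] by (auto simp: zv_eq[OF ij(1)] shift_def)
    qed
  next
    case 3
    show ?thesis
    proof (rule T.rank2_B2_long_twisted[OF v ij(3)])
      show "zv j l (m + 1) \<noteq> zv j (l + 2) (m + 1)"
        using 3 ij by (intro zv_distinct)
      show "{w \<in> nbt (zv i l m). fst w = j} = {zv j l (m + 1), zv j (l + 2) (m + 1)}"
        unfolding nbt_col[OF ij(1,2)] using 3 by auto
      show "{w \<in> nbt (zv j l (m + 1)). fst w = i} = {upt (zv i l m)}"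
          "{w \<in> nbt (zv j (l + 2) (m + 1)). fst w = i} = {upt (zv i l m)}"
        unfolding nbt_col[OF ij(2,1)] using 3 by (auto simp: zv_eq[OF ij(1)] shift_def)
      show "{w \<in> nbt (upt (zv i l m)). fst w = j} = {upt (zv j l (m + 1)), upt (zv j (l + 2) (m + 1))}"
        unfolding upt_zv nbt_col[OF ij(1,2)] using 3 by auto
    qed
  next
    case 4
    show ?thesis
    proof (rule T.rank2_B2_short[OF v ij(3)])
      show "{w \<in> nbt (zv i l m). fst w = j} = {zv j (l + 2) (m + 1)}"
        unfolding nbt_col[OF ij(1,2)] using 4 by (auto simp: shift_def)
      have eq: "zv i (l + 2 + 2) (m + 1 + 1) = upt (zv i l m)" "zv i (l + 2) (m + 1 + 1) = zv i (l + 2) (m + 2)"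
        using 4 by (simp_all add: zv_eq[OF ij(1)])
      show "{w \<in> nbt (zv j (l + 2) (m + 1)). fst w = i} = {upt (zv i l m), zv i (l + 2) (m + 2)}"
        unfolding nbt_col[OF ij(2,1)] eq using 4 by (simp add: insert_commute)
      show "zv i (l + 2) (m + 2) \<noteq> upt (zv i l m)"
        using 4 ij zv_distinct[of i l "m + 2"] by simp
      show "{w \<in> nbt (zv i (l + 2) (m + 2)). fst w = j} = {upt (zv j (l + 2) (m + 1))}"
        unfolding nbt_col[OF ij(1,2)] using 4 by (auto simp: shift_def zv_eq[OF ij(2)])
    qed
  qed
qed

sublocale T: coloured_system Vt fst degt upt nbt I "\<lambda>i j. C j i"
proof
  show "finite_cartan_matrix I (\<lambda>i j. C j i)"
    by (rule finite_cartan_matrix_transpose[OF cartan])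
  fix v assume "v \<in> Vt"
  then obtain i l m where v: "v = zv i l m" "i \<in> I"
    by (auto simp: Vt_def)
  then show "fst v \<in> I"
    by simp
  {
    fix j assume j: "j \<in> I" "j \<noteq> fst v"
    then have ij: "i \<noteq> j"
      using v by auto
    show "int (card {w \<in> nbt v. fst w = j}) = - C (fst v) j"
      unfolding v(1) nbt_col[OF v(2) j(1)] fst_zv
      using v(2) j(1) ij
      by (cases rule: C_cases) (use zv_distinct[OF j(1)] in auto)
  }
  fix i' j assume "i' \<in> I" "j \<in> I" "i' \<noteq> j" "fst v = i'"
  then show "T.rank2_fundamental i' j v"
    using rank2_t[of i' j l m] v by simp
qed

section \<open>Monomials and subalgebras at \<open>q = epsilon\<close>\<close>

definition zexp :: "'i expo \<Rightarrow> 'i expo"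
  where "zexp u = frag_extend (\<lambda>(i, a). frag_of (i, Zindex i a)) (W_coords u)"

lemma zexp_zero: "zexp 0 = 0"
  by (simp add: zexp_def W_coords_zero)

lemma zexp_add: "u \<in> W_lattice \<Longrightarrow> v \<in> W_lattice \<Longrightarrow> zexp (u + v) = zexp u + zexp v"
  by (simp add: zexp_def W_lattice_add frag_extend_add)

lemma zexp_uminus: "u \<in> W_lattice \<Longrightarrow> zexp (- u) = - zexp u"
  using zexp_add[of u "- u"] W_lattice_uminus[of u] by (simp add: zexp_zero eq_neg_iff_add_eq_0 add.commute)

lemma zexp_diff: "u \<in> W_lattice \<Longrightarrow> v \<in> W_lattice \<Longrightarrow> zexp (u - v) = zexp u - zexp v"
  using zexp_add[of u "- v"] W_lattice_uminus[of v] zexp_uminus[of v] by simp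

lemma zexp_sum: "(\<And>x. x \<in> X \<Longrightarrow> f x \<in> W_lattice) \<Longrightarrow> zexp (sum f X) = (\<Sum>x\<in>X. zexp (f x))"
  by (induction X rule: infinite_finite_induct) (simp_all add: zexp_add zexp_zero W_lattice_sum)

lemma zexp_W: "i \<in> I \<Longrightarrow> zexp (Wexp i (q powi l * t powi m)) = frag_of (zv i l m)"
  using W_coords_Wmap[of "frag_of (i, q powi l * t powi m)"] qt_lattice_I[of l m]
  by (simp add: zexp_def Wexp_eq_Wmap zv_def)

lemma W_lattice_W: "i \<in> I \<Longrightarrow> Wexp i (q powi l * t powi m) \<in> W_lattice"
  using Wexp_in_W_lattice qt_lattice_I by blast

text \<open>For \<open>r i = 1\<close> only a product of two consecutive \<open>A\<close> can be
  written in the variables \<open>W\<close>; it is the one in the last term of the three-term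
  generator.\<close>

definition Alift :: "'i \<Rightarrow> int \<Rightarrow> int \<Rightarrow> 'i expo"
  where "Alift i l m = (if r i = 2 then Aexp i (q powi (l + 2) * t powi (m + 1))
    else Aexp i (q powi (l + 2) * t powi (m + 1)) + Aexp i (q powi l * t powi (m + 1)))"

text \<open>Rewrites everything in the variables \<open>W\<close>, on which \<open>zexp\<close> is
  known. The variables \<open>Y\<close> pair up because the two copies of \<open>A\<close> are
  centred at exponents differing by 2.\<close>

lemma Alift_eq:
  assumes i: "i \<in> I"
  shows "Alift i l m = Wexp i (q powi l * t powi m) + Wexp i (q powi (l + 2 * int (r i)) * t powi (m + 2))
    - (\<Sum>j\<in>I. if C j i < 0 then
        if r i = 1 \<and> r j = 2 then Wexp j (q powi l * t powi (m + 1)) + Wexp j (q powi (l + 2) * t powi (m + 1))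
        else Wexp j (q powi (l + shift i j) * t powi (m + 1))
      else 0)"
proof -
  have frac: "q powi l * t powi m / (q ^ k * t) = q powi (l - int k) * t powi (m - 1)"
    "q powi l * t powi m * (q ^ k * t) = q powi (l + int k) * t powi (m + 1)" for l m k
    using qt_mult(4)[of "l - int k" m] qt_mult(3)[of "l + int k" m] qt_mult(5,6)[of l m k]
    by (metis divide_divide_eq_left mult.assoc)+
  have A: "Aexp i (q powi l * t powi m) = Yexp i (q powi (l - int (r i)) * t powi (m - 1))
    + Yexp i (q powi (l + int (r i)) * t powi (m + 1))
    - (\<Sum>j\<in>I. (if C j i = - 1 then Yexp j (q powi l * t powi m) else 0)
      + (if C j i = - 2 then Yexp j (q powi (l - 1) * t powi m) + Yexp j (q powi (l + 1) * t powi m) else 0))" for l m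
    unfolding Aexp_def frac qt_mult sum.inter_filter[OF Q.finite_I] by (simp add: sum.distrib)
  have C: "C j i = - 1 \<and> r j = 2 \<or> C j i = - 2 \<and> r j = 1" if "r i = 2" "j \<in> I" "C j i < 0" for j
    using i that(2) _ by (rule C_cases) (use that C_diag[OF i] in auto)
  have C': "C j i = - 1" if "r i = 1" "j \<in> I" "C j i < 0" for j
    using i that(2) _ by (rule C_cases) (use that C_diag[OF i] in auto)
  let ?X = "\<lambda>l j. (if C j i = - 1 then Yexp j (q powi l * t powi (m + 1)) else 0)
      + (if C j i = - 2 then Yexp j (q powi (l - 1) * t powi (m + 1)) + Yexp j (q powi (l + 1) * t powi (m + 1)) else 0)"
  let ?Z = "\<lambda>j. if C j i < 0 then
        if r i = 1 \<and> r j = 2 then Wexp j (q powi l * t powi (m + 1)) + Wexp j (q powi (l + 2) * t powi (m + 1))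
        else Wexp j (q powi (l + shift i j) * t powi (m + 1))
      else 0"
  show ?thesis
    using r_cases[OF i]
  proof
    assume r: "r i = 2"
    have "?X (l + 2) j = ?Z j" if "j \<in> I" for j
    proof (cases "C j i < 0")
      case True
      then show ?thesis
        using C[OF r that True] r by (auto simp: Wexp_def shift_def qt_mult)
    qed simp
    then have "(\<Sum>j\<in>I. ?X (l + 2) j) = (\<Sum>j\<in>I. ?Z j)"
      by (intro sum.cong refl)
    then show ?thesis
      unfolding Alift_def A using r by (simp add: Wexp_def add.commute[of 4 l] add.commute[of 2 m])
  next
    assume r: "r i = 1"
    have "?X (l + 2) j + ?X l j = ?Z j" if "j \<in> I" for j
    proof (cases "C j i < 0")
      case True
      then show ?thesis
        using C'[OF r that True] r r_cases[OF that]
          by (auto simp: Wexp_def shift_def qt_mult add.commute[of 2 l])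
    qed simp
    then have "(\<Sum>j\<in>I. ?X (l + 2) j) + (\<Sum>j\<in>I. ?X l j) = (\<Sum>j\<in>I. ?Z j)"
      unfolding sum.distrib[symmetric] by (intro sum.cong refl)
    from this[symmetric] show ?thesis
      unfolding Alift_def A using r
      by (simp add: Wexp_def qt_mult add.commute[of 1 l] add.commute[of 3 l] add.commute[of 2 m])
  qed
qed

lemma Alift_lattice:
  assumes i: "i \<in> I"
  shows "Alift i l m \<in> W_lattice"
  unfolding Alift_eq[OF i] using i
  by (intro W_lattice_diff W_lattice_add W_lattice_sum) (auto simp: W_lattice_W W_lattice_add W_lattice_zero)

lemma zexp_Alift:
  assumes i: "i \<in> I"
  shows "zexp (Alift i l m) = T.A (zv i l m)"
proof -
  have "(\<Sum>w\<in>nbt (zv i l m). frag_of w) = (\<Sum>j\<in>I. \<Sum>w\<in>{w \<in> nbt (zv i l m). fst w = j}. frag_of w)"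
    using T.nb_finite[OF zv_V[OF i]] Q.finite_I by (intro sum.group[symmetric]) (auto elim: nbt_E)
  also have "\<dots> = (\<Sum>j\<in>I. if C j i < 0 then
        if r i = 1 \<and> r j = 2 then frag_of (zv j l (m + 1)) + frag_of (zv j (l + 2) (m + 1))
        else frag_of (zv j (l + shift i j) (m + 1))
      else 0)"
    by (intro sum.cong) (auto simp: nbt_col[OF i] zv_distinct)
  also have "\<dots> = (\<Sum>j\<in>I. zexp (if C j i < 0 then
        if r i = 1 \<and> r j = 2 then Wexp j (q powi l * t powi (m + 1)) + Wexp j (q powi (l + 2) * t powi (m + 1))
        else Wexp j (q powi (l + shift i j) * t powi (m + 1))
      else 0))"
    by (intro sum.cong) (auto simp: zexp_add zexp_W W_lattice_W zexp_zero)
  finally have sum: "(\<Sum>w\<in>nbt (zv i l m). frag_of w) = \<dots>" .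
  have "zv i (l + 2 * int (r i)) (m + 2) = upt (zv i l m)"
    by (simp add: zv_eq[OF i])
  then show ?thesis
    unfolding Alift_eq[OF i] T.A_def sum using i
    by (subst zexp_diff zexp_add zexp_sum;
        (intro W_lattice_add W_lattice_sum)?; auto simp: W_lattice_W W_lattice_add W_lattice_zero zexp_W)+
qed

lemma Pi_t_single: "Pi_t (Poly_Mapping.single u p) = Poly_Mapping.single (zexp u) (poly p 0)"
  by (simp add: Pi_t_def zexp_def)

lemma Pi_t_mono: "Pi_t (mono u) = frag_of (zexp u)"
  by (simp add: mono_def Pi_t_single)

lemma Pi_t_scalar: "Pi_t (scalar p * P) = Poly_Mapping.single 0 (poly p 0) * Pi_t P"
  by (simp add: Pi_t_def specialise_scalar)

lemma Pi_t_alpha_mult: "Pi_t (alpha * P) = 0"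
  by (simp add: alpha_def Pi_t_scalar)

lemma K_sub_representable:
  assumes i: "i \<in> I" and P: "P \<in> K_sub i"
  shows "representable P"
  using P unfolding K_sub_def
proof (induction rule: subring_gen.induct)
  case one
  then show ?case
    using representable_Yqt Yqt_one by blast
next
  case (gen x)
  then show ?case
    using K_generators_self_representable[OF i] representable_Yqt Yqt_gens alpha_Yqt by blast
qed (auto intro: representable_diff representable_mult)

lemma alpha_square: "alpha\<^sup>2 - alpha = (scalar [:0, - 1, 1:] :: 'i laurent_alpha)"
  by (simp add: alpha_def scalar_def power2_eq_square mult_single flip: single_diff)

text \<open>An expression outside \<open>Yqt\<close> may be projected directly: it differs from a
  representative by a multiple of \<open>alpha\<^sup>2 - alpha\<close>, which vanishes at
  \<open>alpha = 0\<close> and at \<open>alpha = 1\<close>.\<close>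

lemma representable_E:
  assumes "representable P"
  obtains Q where "Q \<in> Yqt" "denotes P = coset_rel `` {Q}" "Pi_q P = Pi_q Q" "Pi_t P = Pi_t Q" "P \<in> W_integral"
proof -
  obtain Q R where Q: "Q \<in> Yqt" "(alpha\<^sup>2 - alpha) dvd (P - Q)" "P - Q = scalar [:0, - 1, 1:] * R"
    using assms unfolding representable_def alpha_square dvd_def by blast
  have "Pi_q (P - Q) = 0" "Pi_t (P - Q) = 0"
    by (simp_all add: Q(3) Pi_q_scalar Pi_t_scalar)
  moreover have "scalar [:0, - 1, 1:] * R \<in> W_integral"
  proof -
    have "scalar p * R = (\<Sum>u\<in>keys R. Poly_Mapping.single u (p * lookup R u))" for p
      by (subst sum_singles[of R, symmetric]) (simp only: sum_distrib_left scalar_def mult_single add_0)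
    then show ?thesis
      by (auto intro!: W_integral_sum simp: W_integral_single)
  qed
  then have "Q + scalar [:0, - 1, 1:] * R \<in> W_integral"
    using Q(1) Yqt_subset_W_integral by (intro W_integral_add) auto
  then have "P \<in> W_integral"
    by (simp flip: Q(3))
  ultimately show thesis
    using that Q(1) denotes_eq_coset[OF Q(1,2)] by (simp add: Pi_q_diff Pi_t_diff)
qed

lemma K_sub_W_integral: "i \<in> I \<Longrightarrow> P \<in> K_sub i \<Longrightarrow> P \<in> W_integral"
  using K_sub_representable representable_E by metis

text \<open>At \<open>alpha = 0\<close> the middle term of the three-term generator disappears,
  leaving a two-term generator of the dual system.\<close>

lemma Pi_t_self:
  assumes i: "i \<in> I"
  shows "r i = 1 \<Longrightarrow> Pi_t (mono (Wexp i (q powi l * t powi m)) * (1 + alpha * Ainv i (q powi l * t powi m * q\<^sup>2 * t)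
      + Ainv i (q powi l * t powi m * q\<^sup>2 * t) * Ainv i (q powi l * t powi m * t)))
      = frag_of (frag_of (zv i l m)) * (1 + frag_of (- T.A (zv i l m)))" (is "_ \<Longrightarrow> Pi_t ?P = ?R")
    and "r i = 2 \<Longrightarrow> Pi_t (mono (Yexp i (q powi l * t powi m)) * (1 + Ainv i (q powi l * t powi m * q\<^sup>2 * t)))
      = frag_of (frag_of (zv i l m)) * (1 + frag_of (- T.A (zv i l m)))" (is "_ \<Longrightarrow> Pi_t ?Q = ?R")
proof -
  have z: "frag_of (zexp (Wexp i (q powi l * t powi m))) + frag_of (zexp (Wexp i (q powi l * t powi m) - Alift i l m)) = ?R"
    using i by (simp add: zexp_diff zexp_W W_lattice_W Alift_lattice zexp_Alift algebra_simps frag_of_mult)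
  show "Pi_t ?P = ?R" if r: "r i = 1"
  proof -
    have "?P = mono (Wexp i (q powi l * t powi m)) + alpha * (mono (Wexp i (q powi l * t powi m)) *
        Ainv i (q powi (l + 2) * t powi (m + 1))) + mono (Wexp i (q powi l * t powi m) - Alift i l m)"
      unfolding qt_mult Alift_def using r by (simp add: algebra_simps flip: mono_add)
    then show ?thesis
      by (simp only: Pi_t_add Pi_t_alpha_mult Pi_t_mono add_0_right z)
  qed
  show "Pi_t ?Q = ?R" if r: "r i = 2"
  proof -
    have "?Q = mono (Wexp i (q powi l * t powi m)) + mono (Wexp i (q powi l * t powi m) - Alift i l m)"
      unfolding qt_mult Alift_def using r by (simp add: algebra_simps Wexp_def flip: mono_add)
    then show ?thesis
      by (simp only: Pi_t_add Pi_t_mono z)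
  qed
qed

lemma Pi_t_K_sub:
  assumes i: "i \<in> I" and P: "P \<in> K_sub i"
  shows "Pi_t P \<in> T.K i"
proof -
  \<comment> \<open>Membership in \<open>K_sub i\<close> is carried through the induction because
    \<open>Pi_t\<close> is multiplicative only on \<open>W_integral\<close>.\<close>
  have "P \<in> K_sub i \<and> Pi_t P \<in> T.K i"
    using P unfolding K_sub_def
  proof (induction rule: subring_gen.induct)
    case one
    then show ?case
      by (simp add: Pi_t_one T.K_one subring_gen.one)
  next
    case (diff x y)
    then show ?case
      by (simp add: Pi_t_diff T.K_diff subring_gen.diff)
  next
    case (mult x y)
    then have "x \<in> W_integral" "y \<in> W_integral"
      using K_sub_W_integral[OF i] by (auto simp: K_sub_def)
    with mult show ?case
      by (simp add: Pi_t_mult T.K_mult subring_gen.mult)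
  next
    case (gen x)
    have free: "Pi_t (mono (Wexp j a)) \<in> T.K i" "Pi_t (mono (- Wexp j a)) \<in> T.K i"
      if j: "j \<in> I - {i}" and a: "a \<in> qt_lattice" for j a
    proof -
      obtain l m where alm: "a = q powi l * t powi m"
        using a by (rule qt_lattice_E)
      have "frag_of (zv j l m) \<in> T.free i"
        using j zv_V by (intro T.free_frag_of) auto
      then show "Pi_t (mono (Wexp j a)) \<in> T.K i" "Pi_t (mono (- Wexp j a)) \<in> T.K i"
        using j unfolding Pi_t_mono alm
        by (auto simp: zexp_W zexp_uminus W_lattice_W intro: T.K_free' T.free_uminus)
    qed
    have self: "Pi_t x \<in> T.K i" if x: "x \<in> K_generators_self i"
    proof -
      have K: "frag_of (frag_of (zv i l m)) * (1 + frag_of (- T.A (zv i l m))) \<in> T.K i" for l m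
        using T.K_generator[OF zv_V[OF i]] by simp
      show ?thesis
      proof (cases "r i = 1")
        case True
        then consider
          a where "a \<in> qt_lattice" "x = mono (Wexp i a) *
                (1 + alpha * Ainv i (a * q\<^sup>2 * t) + Ainv i (a * q\<^sup>2 * t) * Ainv i (a * t))"
          | a where "x = alpha * mono (Yexp i a) * (1 + Ainv i (a * q * t))"
          using x unfolding K_generators_self_def by auto
        then show ?thesis
        proof cases
          case (1 a)
          obtain l m where "a = q powi l * t powi m"
            using 1(1) by (rule qt_lattice_E)
          then show ?thesis
            unfolding 1(2) using Pi_t_self(1)[OF i True] K by metis
        next
          case (2 a)
          then show ?thesis
            by (simp add: mult.assoc Pi_t_alpha_mult T.K_zero)
        qed
      next
        case False
        then have r: "r i = 2"
          using r_cases[OF i] by simp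
        obtain a where x: "a \<in> qt_lattice" "x = mono (Yexp i a) * (1 + Ainv i (a * q\<^sup>2 * t))"
          using x False unfolding K_generators_self_def by auto
        obtain l m where "a = q powi l * t powi m"
          using x(1) by (rule qt_lattice_E)
        then show ?thesis
          unfolding x(2) using Pi_t_self(2)[OF i r] K by metis
      qed
    qed
    have "Pi_t x \<in> T.K i"
      using gen self free by (auto simp: Pi_t_alpha Pi_t_alpha_mult T.K_zero)
    with gen show ?case
      by (blast intro: subring_gen.gen)
  qed
  then show ?thesis ..
qed

lemma K_subset_Pi_t:
  assumes i: "i \<in> I" and P: "P \<in> T.K i"
  shows "\<exists>k\<in>K_sub i. Pi_t k = P"
  using P unfolding T.K_eq
proof (induction rule: subring_gen.induct)
  case one
  then show ?case
    using Pi_t_one K_sub_one by blast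
next
  case (diff x y)
  then show ?case
    using Pi_t_diff K_sub_diff by metis
next
  case (mult x y)
  then show ?case
    using Pi_t_mult K_sub_mult K_sub_W_integral[OF i] by metis
next
  case (gen x)
  from gen consider v where "v \<in> Vt" "fst v = i" "x = frag_of (frag_of v) * (1 + frag_of (- T.A v))"
    | v where "v \<in> Vt" "fst v \<noteq> i" "x = frag_of (frag_of v)"
    | v where "v \<in> Vt" "fst v \<noteq> i" "x = frag_of (- frag_of v)"
    unfolding T.gens_def by blast
  then show ?case
  proof cases
    case (1 v)
    then obtain l m where v: "v = zv i l m"
      by (auto simp: Vt_def)
    have "\<exists>k\<in>K_generators_self i. Pi_t k = x"
    proof (cases "r i = 1")
      case True
      show ?thesis
        unfolding 1(3) v Pi_t_self(1)[OF i True, symmetric] K_generators_self_def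
        by (rule bexI, rule refl) (use True qt_lattice_I in auto)
    next
      case False
      then have r: "r i = 2"
        using r_cases[OF i] by simp
      show ?thesis
        unfolding 1(3) v Pi_t_self(2)[OF i r, symmetric] K_generators_self_def
        by (rule bexI, rule refl) (use r qt_lattice_I in auto)
    qed
    then show ?thesis
      using K_sub_self by blast
  next
    case (2 v)
    then obtain j l m where v: "v = zv j l m" "j \<in> I - {i}"
      by (auto simp: Vt_def)
    have "Pi_t (mono (Wexp j (q powi l * t powi m))) = x"
      using v by (simp add: 2(3) Pi_t_mono zexp_W)
    then show ?thesis
      using K_sub_gen(1)[OF v(2) qt_lattice_I] by blast
  next
    case (3 v)
    then obtain j l m where v: "v = zv j l m" "j \<in> I - {i}"
      by (auto simp: Vt_def)
    have "Pi_t (mono (- Wexp j (q powi l * t powi m))) = x"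
      using v by (simp add: 3(3) Pi_t_mono zexp_W zexp_uminus W_lattice_W)
    then show ?thesis
      using K_sub_gen(2)[OF v(2) qt_lattice_I] by blast
  qed
qed

text \<open>
  \<open>zexp u\<close> is defined through the coordinates of \<open>u\<close> in the \<open>W\<^bsub>i,a\<^esub>\<close>, which may be negative for
  dominant \<open>u\<close>. Its double is read off from the \<open>Y\<^bsub>i,a\<^esub>\<close>: both factors of \<open>W\<^bsub>i,a\<^esub> = Y\<^bsub>i,aq\<^sup>-\<^sup>1\<^esub> Y\<^bsub>i,aq\<^esub>\<close>
  are sent to the image of \<open>W\<^bsub>i,a\<^esub>\<close>.
\<close>

definition zexp2 :: "'i expo \<Rightarrow> 'i expo"
  where "zexp2 = frag_extend (\<lambda>(i, a). if r i = 2 then frag_cmul 2 (frag_of (i, Zindex i a))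
    else frag_of (i, Zindex i (a * q)))"

lemma zexp2_eq:
  assumes "u \<in> W_lattice"
  shows "zexp2 u = frag_cmul 2 (zexp u)"
proof -
  obtain w where w: "keys w \<subseteq> I \<times> qt_lattice" "u = Wmap w"
    using assms by (auto simp: W_lattice_def)
  have two: "frag_cmul 2 y = y + y" for y :: "'i expo"
    using frag_cmul_distrib[of 1 1 y] by simp
  have "zexp2 (Wmap w) = frag_cmul 2 (frag_extend (\<lambda>(i, a). frag_of (i, Zindex i a)) w)"
    using w(1)
  proof (induction w rule: frag_induction)
    case (one x)
    then obtain i l m where x: "x = (i, q powi l * t powi m)" "i \<in> I"
      by (auto elim: qt_lattice_E)
    have "zexp2 (Wexp i (q powi l * t powi m)) = frag_cmul 2 (frag_of (zv i l m))"
      using r_cases[OF x(2)]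
    proof
      assume r: "r i = 1"
      then have "zv i (l + 2) m = zv i l m"
        by (simp add: zv_eq[OF x(2)])
      then show ?thesis
        using r by (simp add: zexp2_def Wexp_def frag_extend_add qt_mult two add.commute[of 2 l] flip: zv_def)
    next
      assume "r i = 2"
      then show ?thesis
        by (simp add: zexp2_def Wexp_def zv_def)
    qed
    then show ?case
      by (simp add: x(1) zv_def flip: Wexp_eq_Wmap)
  next
    case (diff a b)
    then show ?case
      by (simp add: zexp2_def Wmap_def frag_extend_diff two)
  qed (simp add: zexp2_def Wmap_def)
  then show ?thesis
    using W_coords_Wmap[OF w(1)] by (simp add: w(2) zexp_def)
qed

lemma zexp_nonneg:
  assumes "u \<in> W_lattice" "nonneg u"
  shows "nonneg (zexp u)"
proof -
  have "nonneg (zexp2 u)"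
    unfolding zexp2_def using assms(2) by (intro nonneg_frag_extend) (auto simp: nonneg_def)
  then show ?thesis
    unfolding zexp2_eq[OF assms(1)] by (simp add: nonneg_def)
qed

lemma keys_zexp:
  assumes "u \<in> W_lattice" "keys u \<subseteq> I \<times> qt_lattice" "v \<in> keys (zexp u)"
  obtains i l l' m where "i \<in> I" "(i, q powi l * t powi m) \<in> keys u" "v = zv i l' m"
proof -
  have "v \<in> keys (zexp2 u)"
    using assms(3) by (simp add: zexp2_eq[OF assms(1)])
  then obtain x where x: "x \<in> keys u" "v \<in> keys ((\<lambda>(i, a). if r i = 2 then frag_cmul 2 (frag_of (i, Zindex i a))
      else frag_of (i, Zindex i (a * q))) x)"
    unfolding zexp2_def using keys_frag_extend by fast
  obtain i a where ia: "x = (i, a)" "i \<in> I" "a \<in> qt_lattice"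
    using x(1) assms(2) by auto
  obtain l m where a: "a = q powi l * t powi m"
    using ia(3) by (rule qt_lattice_E)
  have "v = zv i l m \<or> v = zv i (l + 1) m"
    using x(2) by (auto simp: ia(1) a zv_def qt_mult split: if_splits)
  then show thesis
    using that[of i l m] ia x(1) a by auto
qed

end

section \<open>Auxiliary facts for lifting the two solutions\<close>

lemma frag_extend_closed:
  fixes n :: "'b \<Rightarrow>\<^sub>0 int"
  assumes "0 \<in> R" "\<And>x y. x \<in> R \<Longrightarrow> y \<in> R \<Longrightarrow> x + y \<in> R"
    and "nonneg n" "\<And>v. v \<in> keys n \<Longrightarrow> L v \<in> R"
  shows "frag_extend L n \<in> R"
proof -
  have "frag_cmul (int k) x \<in> R" if "x \<in> R" for k x
    by (induction k) (auto simp: frag_cmul_distrib assms that)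
  then have "frag_cmul (lookup n v) (L v) \<in> R" if "v \<in> keys n" for v
    using assms(3,4) that by (metis nonneg_def nonneg_int_cases)
  moreover have "sum f X \<in> R" if "\<And>x. x \<in> X \<Longrightarrow> f x \<in> R" for f and X :: "'b set"
    using that by (induction X rule: infinite_finite_induct) (auto intro: assms)
  ultimately show ?thesis
    by (simp add: frag_extend_def)
qed

text \<open>Additivity is asked only on a submonoid \<open>R\<close> since \<open>zexp\<close> is
  additive on \<open>W_lattice\<close> only. With nonnegative coefficients all partial sums stay in
  \<open>R\<close>.\<close>

lemma frag_extend_hom:
  fixes n :: "'b \<Rightarrow>\<^sub>0 int"
  assumes "\<phi> 0 = 0" "\<And>x y. x \<in> R \<Longrightarrow> y \<in> R \<Longrightarrow> \<phi> (x + y) = \<phi> x + \<phi> y"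
    and R: "0 \<in> R" "\<And>x y. x \<in> R \<Longrightarrow> y \<in> R \<Longrightarrow> x + y \<in> R"
    and "nonneg n" "\<And>v. v \<in> keys n \<Longrightarrow> L v \<in> R"
  shows "\<phi> (frag_extend L n) = frag_extend (\<lambda>v. \<phi> (L v)) n"
proof -
  have "\<phi> (frag_cmul (int k) x) = frag_cmul (int k) (\<phi> x) \<and> frag_cmul (int k) x \<in> R" if "x \<in> R" for k x
    by (induction k) (auto simp: frag_cmul_distrib assms that)
  then have cmul: "\<phi> (frag_cmul (lookup n v) (L v)) = frag_cmul (lookup n v) (\<phi> (L v))"
      "frag_cmul (lookup n v) (L v) \<in> R" if "v \<in> keys n" for v
    using assms(5,6) that by (metis nonneg_def nonneg_int_cases)+
  have sum: "\<phi> (sum f X) = (\<Sum>x\<in>X. \<phi> (f x)) \<and> sum f X \<in> R"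
    if "\<And>x. x \<in> X \<Longrightarrow> f x \<in> R" for f and X :: "'b set"
    using that by (induction X rule: infinite_finite_induct) (auto simp: assms)
  have "\<phi> (frag_extend L n) = (\<Sum>v\<in>keys n. \<phi> (frag_cmul (lookup n v) (L v)))"
    unfolding frag_extend_def by (rule sum[THEN conjunct1]) (rule cmul(2))
  also have "\<dots> = frag_extend (\<lambda>v. \<phi> (L v)) n"
    unfolding frag_extend_def by (intro sum.cong refl cmul(1))
  finally show ?thesis .
qed

lemma scalar_mult: "scalar (p * p') = scalar p * scalar p'"
  by (simp add: scalar_def mult_single)

lemma scalar_add: "scalar (p + p') = scalar p + scalar p'"
  by (simp add: scalar_def single_add)

lemma scalar_subring_gen:
  assumes "(alpha :: 'i laurent_alpha) \<in> G"
  shows "(scalar p :: 'i laurent_alpha) \<in> subring_gen G"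
proof -
  let ?R = "subring_gen G"
  have zero: "0 \<in> ?R"
    using subring_gen.diff[OF subring_gen.one subring_gen.one] by simp
  have add: "x + y \<in> ?R" if "x \<in> ?R" "y \<in> ?R" for x y
    using subring_gen.diff[OF that(1) subring_gen.diff[OF zero that(2)]] by simp
  have scalar_1: "scalar [:1:] = (1 :: 'i laurent_alpha)"
    unfolding scalar_def one_pCons[symmetric] by (rule single_one)
  have int: "scalar [:a:] \<in> ?R" for a
  proof (induction a rule: int_induct[of _ 0])
    case base
    show ?case
      using zero by (simp add: scalar_def)
  next
    case (step1 a)
    have "scalar [:a + 1:] = scalar [:a:] + (1 :: 'i laurent_alpha)"
      unfolding scalar_1[symmetric] scalar_add[symmetric] by simp
    then show ?case
      using step1 add subring_gen.one by metis
  next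
    case (step2 a)
    have "scalar [:a - 1:] = scalar [:a:] - (1 :: 'i laurent_alpha)"
      unfolding eq_diff_eq scalar_1[symmetric] scalar_add[symmetric] by simp
    then show ?case
      using step2 subring_gen.diff subring_gen.one by metis
  qed
  show ?thesis
  proof (induction p)
    case 0
    show ?case
      using zero by (simp add: scalar_def)
  next
    case (pCons a p)
    have "scalar (pCons a p) = scalar [:a:] + alpha * scalar p"
      by (simp add: alpha_def flip: scalar_mult scalar_add)
    then show ?case
      using add[OF int subring_gen.mult[OF subring_gen.gen[OF assms] pCons.IH]] by metis
  qed
qed

lemma single_0_mult: "Poly_Mapping.single 0 c * (P :: ('a::monoid_add) \<Rightarrow>\<^sub>0 int) = frag_cmul c P"
proof -
  have "frag_cmul c (frag_of u) = Poly_Mapping.single u c" for u :: 'a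
    by (rule poly_mapping_eqI) (simp add: lookup_single when_def)
  then have one: "Poly_Mapping.single 0 c * frag_of u = frag_cmul c (frag_of u)" for u :: 'a
    by (simp add: mult_single)
  have diff: "frag_cmul c (P - Q) = frag_cmul c P - frag_cmul c Q" for P Q :: "'a \<Rightarrow>\<^sub>0 int"
    by (rule poly_mapping_eqI) (simp add: lookup_minus right_diff_distrib)
  show ?thesis
    using subset_UNIV[of "keys P"]
    by (induction P rule: frag_induction) (simp_all add: one diff right_diff_distrib)
qed

text \<open>The normalisation is conditional so that for \<open>lam = 0\<close> the second component
  can be the zero element.\<close>

lemma no_dominant_cmul_diff:
  assumes "a \<noteq> 0 \<Longrightarrow> lookup F u = 1" "\<And>e. e \<in> keys F \<Longrightarrow> nonneg e \<Longrightarrow> e = u"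
  shows "no_dominant (frag_cmul a F - Poly_Mapping.single u a)"
  unfolding no_dominant_def
proof
  fix e assume e: "e \<in> keys (frag_cmul a F - Poly_Mapping.single u a)"
  show "\<not> dominant_expo e"
  proof (cases "e = u")
    case True
    then show ?thesis
      using e assms(1) by (auto simp: in_keys_iff lookup_minus)
  next
    case False
    then have "e \<in> keys F"
      using e by (auto simp: in_keys_iff lookup_minus lookup_single_not_eq)
    then show ?thesis
      using assms(2) False unfolding nonneg_def dominant_expo_def by blast
  qed
qed

lemma no_dominant_diff: "no_dominant (P - R) \<Longrightarrow> no_dominant (Q - R) \<Longrightarrow> no_dominant (P - Q)"
  using keys_diff[of "P - R" "Q - R"] unfolding no_dominant_def by auto

context interpolation
begin

section \<open>Existence and uniqueness\<close>

definition params :: "'i expo \<Rightarrow> complex set"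
  where "params u = {c * q ^ k * t ^ l | c k l. c \<in> C_support u \<and> 1 \<le> k \<and> 1 \<le> l}"

text \<open>The additive form of \<open>D_set\<close>: a monomial with exponent \<open>e\<close>
  lies below \<open>u\<close> with admissible parameters iff \<open>u - e\<close> is in this
  monoid.\<close>

definition roots :: "'i expo \<Rightarrow> 'i expo set"
  where "roots u = {sum_list (map (\<lambda>(i, a). Aexp i a) ias) | ias. set ias \<subseteq> I \<times> params u}"

lemma roots_zero: "0 \<in> roots u"
  unfolding roots_def by (intro CollectI exI[of _ "[]"]) simp

lemma roots_add:
  assumes "x \<in> roots u" "y \<in> roots u"
  shows "x + y \<in> roots u"
proof -
  obtain xs ys where "x = sum_list (map (\<lambda>(i, a). Aexp i a) xs)" "set xs \<subseteq> I \<times> params u"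
    "y = sum_list (map (\<lambda>(i, a). Aexp i a) ys)" "set ys \<subseteq> I \<times> params u"
    using assms unfolding roots_def by blast
  then show ?thesis
    unfolding roots_def by (intro CollectI exI[of _ "xs @ ys"]) auto
qed

lemma roots_A: "i \<in> I \<Longrightarrow> a \<in> params u \<Longrightarrow> Aexp i a \<in> roots u"
  unfolding roots_def by (intro CollectI exI[of _ "[(i, a)]"]) auto

lemma params_lattice: "params u \<subseteq> qt_lattice"
proof
  fix a assume "a \<in> params u"
  then obtain c k l where c: "c \<in> qt_lattice" and a: "a = c * q ^ k * t ^ l"
    by (auto simp: params_def C_support_def)
  have "b * t ^ l \<in> qt_lattice" if "b \<in> qt_lattice" for b
    by (induction l) (auto simp: that mult.assoc[symmetric] mult.commute[of t] dest: qt_lattice_t(1))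
  then show "a \<in> qt_lattice"
    unfolding a using qt_lattice_qpow(1)[OF c] by blast
qed

lemma roots_supported:
  assumes "x \<in> roots u"
  shows "supported x"
proof -
  obtain ias where ias: "x = sum_list (map (\<lambda>(i, a). Aexp i a) ias)" "set ias \<subseteq> I \<times> params u"
    using assms unfolding roots_def by blast
  have "supported (sum_list (map (\<lambda>(i, a). Aexp i a) ias))"
    using ias(2)
  proof (induction ias)
    case (Cons p ps)
    then show ?case
      using params_lattice by (auto intro!: supported_add supported_Aexp)
  qed (simp add: supported_zero)
  then show ?thesis
    by (simp add: ias(1))
qed

lemma params_I:
  assumes "(j, q powi x * t powi y) \<in> keys u" "keys u \<subseteq> I \<times> qt_lattice" "x + 1 \<le> l" "y + 1 \<le> m"
  shows "q powi l * t powi m \<in> params u"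
proof -
  have "q powi x * t powi y \<in> C_support u"
    using assms(1,2) by (auto simp: C_support_def in_keys_iff)
  moreover have "q powi l * t powi m = q powi x * t powi y * q ^ nat (l - x) * t ^ nat (m - y)"
  proof -
    have "q powi l = q powi x * q ^ nat (l - x)"
    proof -
      have "l = x + int (nat (l - x))"
        using assms(3) by simp
      then show ?thesis
        by (metis power_int_add power_int_of_nat q_nonzero)
    qed
    moreover have "t powi m = t powi y * t ^ nat (m - y)"
    proof -
      have "m = y + int (nat (m - y))"
        using assms(4) by simp
      then show ?thesis
        by (metis power_int_add power_int_of_nat t_nonzero)
    qed
    ultimately show ?thesis
      by simp
  qed
  moreover have "1 \<le> nat (l - x)" "1 \<le> nat (m - y)"
    using assms(3,4) by auto
  ultimately show ?thesis
    unfolding params_def by blast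
qed

text \<open>The exponent of \<open>t\<close> is free at \<open>t = 1\<close> and is taken one above
  that of a variable of \<open>u\<close>. The exponent of \<open>q\<close> is large enough because
  the centre of \<open>A\<close> lies \<open>r i\<close> above its lower vertex.\<close>

lemma lift_q:
  assumes u: "keys u \<subseteq> I \<times> qt_lattice" and v: "v \<in> Vq" and w: "w \<in> keys (expq u)" "degq w \<le> degq v"
  shows "\<exists>x\<in>roots u. expq x = Q.A v"
proof -
  obtain i l where il: "v = qv i l" "i \<in> I"
    using v by (auto simp: Vq_def)
  obtain j c where c: "(j, c) \<in> keys u" "w = (j, proj_q c)"
    using w(1) keys_frag_extend unfolding expq_def by fastforce
  have "c \<in> qt_lattice"
    using c(1) u by auto
  then obtain x y where xy: "c = q powi x * t powi y"
    by (rule qt_lattice_E)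
  have "w = qv j x"
    by (simp add: c(2) xy proj_q_eq qv_def)
  then have "x + 1 \<le> l + int (r i)"
    using w(2) il r_cases[OF il(2)] by auto
  then have "q powi (l + int (r i)) * t powi (y + 1) \<in> params u"
    using params_I[OF c(1)[unfolded xy] u] by simp
  moreover have "expq (Aexp i (q powi (l + int (r i)) * t powi (y + 1))) = Q.A v"
    using il by (simp add: expq_A)
  ultimately show ?thesis
    using roots_A[OF il(2)] by blast
qed

lemma lift_t:
  assumes u: "keys u \<subseteq> I \<times> qt_lattice" "u \<in> W_lattice"
    and v: "v \<in> Vt" and w: "w \<in> keys (zexp u)" "degt w \<le> degt v"
  shows "\<exists>x\<in>roots u \<inter> W_lattice. zexp x = T.A v"
proof -
  obtain i l m where il: "v = zv i l m" "i \<in> I"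
    using v by (auto simp: Vt_def)
  obtain j x l' y where j: "j \<in> I" "(j, q powi x * t powi y) \<in> keys u" "w = zv j l' y"
    using keys_zexp[OF u(2,1) w(1)] .
  have ym: "y + 1 \<le> m + 1"
    using w(2) il j degt_zv by simp
  \<comment> \<open>Adding \<open>4 * d\<close> to \<open>l\<close> keeps the vertex, since
    \<open>2 * r i\<close> divides 4, and brings the exponent of \<open>q\<close> above
    \<open>x\<close>. Both factors of \<open>Alift\<close>, centred at \<open>l0\<close> and
    \<open>l0 + 2\<close>, then have admissible parameters.\<close>
  define d where "d = max 0 (x + 1 - l)"
  define l0 where "l0 = l + 4 * d"
  have l0: "x + 1 \<le> l0"
    unfolding l0_def d_def by (simp add: max_def)
  have "zv i l0 m = v"
    using r_cases[OF il(2)] by (auto simp: il(1) zv_eq[OF il(2)] l0_def)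
  moreover have "Alift i l0 m \<in> roots u"
    using params_I[OF j(2) u(1) _ ym] l0 il(2) unfolding Alift_def by (auto intro!: roots_A roots_add)
  ultimately show ?thesis
    using Alift_lattice[OF il(2)] zexp_Alift[OF il(2), of l0 m] by blast
qed

text \<open>Besides the solution \<open>F\<close> it provides a section \<open>h\<close>: every
  monomial of \<open>F\<close> is the image of one in \<open>D_set\<close>.\<close>

lemma solution_q:
  assumes u: "keys u \<subseteq> I \<times> qt_lattice" "nonneg u"
  shows "\<exists>F h. (\<forall>e\<in>keys F. u - h e \<in> roots u \<and> expq (h e) = e) \<and> lookup F (expq u) = 1 \<and>
    (\<forall>e\<in>keys F. nonneg e \<longrightarrow> e = expq u) \<and> (\<forall>i\<in>I. F \<in> Q.K i)"
proof -
  have "nonneg (expq u)"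
    unfolding expq_def by (rule nonneg_frag_extend[OF u(2)]) (auto split: prod.split)
  then interpret D: dominant_monomial Vq fst degq upq nbq I C "expq u"
    using keys_expq[OF u(1)] by unfold_locales
  obtain F where F: "\<forall>e\<in>keys F. e \<in> D.cone" "lookup F (expq u) = 1"
    "\<forall>e\<in>keys F. nonneg e \<longrightarrow> e = expq u" "\<forall>i\<in>I. F \<in> Q.K i"
    using D.solution by blast
  have "\<exists>x\<in>roots u. expq x = Q.A v" if "v \<in> D.reg" for v
    using that lift_q[OF u(1)] unfolding D.reg_def by blast
  then obtain L where L: "\<And>v. v \<in> D.reg \<Longrightarrow> L v \<in> roots u" "\<And>v. v \<in> D.reg \<Longrightarrow> expq (L v) = Q.A v"
    by metis
  have "\<exists>y. u - y \<in> roots u \<and> expq y = e" if e: "e \<in> keys F" for e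
  proof -
    have "e \<in> D.cone"
      using F(1) e by blast
    then obtain n where n: "nonneg n" "keys n \<subseteq> D.reg" "e = expq u - Q.AA n"
      by (rule D.cone_E)
    have "frag_extend L n \<in> roots u"
      using n L by (intro frag_extend_closed roots_zero roots_add) auto
    moreover have "expq (frag_extend L n) = frag_extend (\<lambda>v. expq (L v)) n"
      using n(1) by (intro frag_extend_hom[where R = UNIV]) (auto simp: expq_zero expq_add)
    moreover have "\<dots> = Q.AA n"
      using n(2) L(2) by (intro frag_extend_eq) auto
    ultimately show ?thesis
      by (intro exI[of _ "u - frag_extend L n"]) (simp add: n(3) expq_diff)
  qed
  then show ?thesis
    using F by metis
qed

lemma solution_t:
  assumes u: "keys u \<subseteq> I \<times> qt_lattice" "nonneg u" "u \<in> W_lattice"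
  shows "\<exists>F h. (\<forall>e\<in>keys F. u - h e \<in> roots u \<and> h e \<in> W_lattice \<and> zexp (h e) = e) \<and> lookup F (zexp u) = 1 \<and>
    (\<forall>e\<in>keys F. nonneg e \<longrightarrow> e = zexp u) \<and> (\<forall>i\<in>I. F \<in> T.K i)"
proof -
  have "keys (zexp u) \<subseteq> Vt"
  proof
    fix v assume "v \<in> keys (zexp u)"
    then obtain i l l' m where "i \<in> I" "v = zv i l' m"
      by (rule keys_zexp[OF u(3,1)])
    then show "v \<in> Vt"
      by (simp add: zv_V)
  qed
  then interpret D: dominant_monomial Vt fst degt upt nbt I "\<lambda>i j. C j i" "zexp u"
    using zexp_nonneg[OF u(3,2)] by unfold_locales
  obtain F where F: "\<forall>e\<in>keys F. e \<in> D.cone" "lookup F (zexp u) = 1"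
    "\<forall>e\<in>keys F. nonneg e \<longrightarrow> e = zexp u" "\<forall>i\<in>I. F \<in> T.K i"
    using D.solution by blast
  have "\<exists>x\<in>roots u \<inter> W_lattice. zexp x = T.A v" if "v \<in> D.reg" for v
    using that lift_t[OF u(1,3)] unfolding D.reg_def by blast
  then obtain L where L: "\<And>v. v \<in> D.reg \<Longrightarrow> L v \<in> roots u \<inter> W_lattice" "\<And>v. v \<in> D.reg \<Longrightarrow> zexp (L v) = T.A v"
    by metis
  have "\<exists>y. u - y \<in> roots u \<and> y \<in> W_lattice \<and> zexp y = e" if e: "e \<in> keys F" for e
  proof -
    have "e \<in> D.cone"
      using F(1) e by blast
    then obtain n where n: "nonneg n" "keys n \<subseteq> D.reg" "e = zexp u - T.AA n"
      by (rule D.cone_E)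
    have Ln: "frag_extend L n \<in> roots u \<inter> W_lattice"
      using n L by (intro frag_extend_closed) (auto intro: roots_zero roots_add W_lattice_zero W_lattice_add)
    have "zexp (frag_extend L n) = frag_extend (\<lambda>v. zexp (L v)) n"
      using n L by (intro frag_extend_hom[where R = W_lattice])
        (auto simp: zexp_zero zexp_add W_lattice_zero W_lattice_add)
    also have "\<dots> = T.AA n"
      using n(2) L(2) by (intro frag_extend_eq) auto
    finally show ?thesis
      using Ln u(3) by (intro exI[of _ "u - frag_extend L n"]) (simp add: n(3) zexp_diff W_lattice_diff)
  qed
  then show ?thesis
    using F by metis
qed

lemma scalar_Yqt: "scalar p \<in> Yqt"
  unfolding Yqt_def by (rule scalar_subring_gen) simp

lemma scalar_K_sub: "scalar p \<in> K_sub i"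
  unfolding K_sub_def by (rule scalar_subring_gen) simp

lemma Yqt_zero: "0 \<in> Yqt"
  using Yqt_diff[OF Yqt_one Yqt_one] by simp

lemma Yqt_add: "P \<in> Yqt \<Longrightarrow> R \<in> Yqt \<Longrightarrow> P + R \<in> Yqt"
  using Yqt_diff[OF _ Yqt_diff[OF Yqt_zero], of P R] by simp

lemma Yqt_sum: "(\<And>x. x \<in> X \<Longrightarrow> f x \<in> Yqt) \<Longrightarrow> sum f X \<in> Yqt"
  by (induction X rule: infinite_finite_induct) (auto intro: Yqt_zero Yqt_add)

lemma K_sub_add: "P \<in> K_sub i \<Longrightarrow> R \<in> K_sub i \<Longrightarrow> P + R \<in> K_sub i"
  using K_sub_diff[OF _ K_sub_diff[OF K_sub_diff[OF K_sub_one K_sub_one]], of P i R] by simp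

text \<open>Before passing to the quotient a product of several \<open>Y\<close> may cost several
  factors \<open>alpha\<close>. One exponent serves a finite set, and \<open>1 \<le> k\<close> makes
  the factor vanish at \<open>alpha = 0\<close>.\<close>

lemma alpha_power_mono_Yqt:
  assumes "finite X" "\<And>e. e \<in> X \<Longrightarrow> supported e"
  shows "\<exists>k\<ge>1. \<forall>e\<in>X. alpha ^ k * mono e \<in> Yqt"
proof -
  have pow: "alpha ^ k \<in> Yqt" for k
    by (induction k) (auto intro: Yqt_one Yqt_mult alpha_Yqt)
  have one: "\<exists>k. alpha ^ k * mono e \<in> Yqt \<and> alpha ^ k * mono (- e) \<in> Yqt" if "supported e" for e
    using that unfolding supported_def
  proof (induction e rule: frag_induction)
    case zero
    show ?case
      using Yqt_one by (intro exI[of _ 0]) (simp add: mono_def)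
  next
    case (one x)
    then show ?case
      using Yqt_gens(3,4) by (intro exI[of _ 1]) (cases x; simp)
  next
    case (diff a b)
    then obtain k l where "alpha ^ k * mono a \<in> Yqt" "alpha ^ k * mono (- a) \<in> Yqt"
        "alpha ^ l * mono b \<in> Yqt" "alpha ^ l * mono (- b) \<in> Yqt"
      by blast
    then have "(alpha ^ k * mono a) * (alpha ^ l * mono (- b)) \<in> Yqt"
        "(alpha ^ l * mono b) * (alpha ^ k * mono (- a)) \<in> Yqt"
      by (auto intro: Yqt_mult)
    moreover have "(alpha ^ k * mono a) * (alpha ^ l * mono (- b)) = alpha ^ (k + l) * mono (a - b)"
        "(alpha ^ l * mono b) * (alpha ^ k * mono (- a)) = alpha ^ (k + l) * mono (- (a - b))"
      using mono_add[of a "- b"] mono_add[of b "- a"] by (simp_all add: power_add mult_ac)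
    ultimately show ?case
      by metis
  qed
  show ?thesis
    using assms
  proof (induction X rule: finite_induct)
    case (insert e X)
    then obtain k l where k: "1 \<le> k" "\<forall>e\<in>X. alpha ^ k * mono e \<in> Yqt" and l: "alpha ^ l * mono e \<in> Yqt"
      using one[of e] by auto
    have "alpha ^ (k + l) * mono e' \<in> Yqt" if "e' \<in> insert e X" for e'
    proof (cases "e' = e")
      case True
      then show ?thesis
        using Yqt_mult[OF pow[of k] l] by (simp add: power_add mult_ac)
    next
      case False
      then have "alpha ^ l * (alpha ^ k * mono e') \<in> Yqt"
        using k(2) that Yqt_mult[OF pow] by blast
      then show ?thesis
        by (simp add: power_add mult_ac)
    qed
    then show ?case
      using k(1) by (intro exI[of _ "k + l"]) auto
  qed auto
qed

definition combos :: "'i laurent_alpha set \<Rightarrow> 'i laurent_alpha set"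
  where "combos D = {P. \<exists>S c. finite S \<and> S \<subseteq> D \<and> P = (\<Sum>d\<in>S. scalar (c d) * d)}"

lemma combos_zero: "0 \<in> combos D"
  unfolding combos_def by (intro CollectI exI[of _ "{}"]) simp

lemma combos_single:
  assumes "d \<in> D"
  shows "scalar p * d \<in> combos D"
  unfolding combos_def using assms by (intro CollectI exI[of _ "{d}"] exI[of _ "\<lambda>_. p"]) simp

lemma combos_add:
  assumes "P \<in> combos D" "P' \<in> combos D"
  shows "P + P' \<in> combos D"
proof -
  obtain S c S' c' where S: "finite S" "S \<subseteq> D" "P = (\<Sum>d\<in>S. scalar (c d) * d)"
    "finite S'" "S' \<subseteq> D" "P' = (\<Sum>d\<in>S'. scalar (c' d) * d)"
    using assms unfolding combos_def by blast
  have ext: "(\<Sum>d\<in>X. scalar (f d) * d) = (\<Sum>d\<in>S \<union> S'. scalar (if d \<in> X then f d else 0) * d)"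
    if "X \<subseteq> S \<union> S'" for X and f :: "'i laurent_alpha \<Rightarrow> int poly"
    using S(1,4) that by (intro sum.mono_neutral_cong_left) (auto simp: scalar_def)
  have "P + P' = (\<Sum>d\<in>S \<union> S'. scalar ((if d \<in> S then c d else 0) + (if d \<in> S' then c' d else 0)) * d)"
    unfolding S(3,6) ext[OF Un_upper1] ext[OF Un_upper2] scalar_add distrib_right sum.distrib ..
  moreover have "finite (S \<union> S')" "S \<union> S' \<subseteq> D"
    using S by auto
  ultimately show ?thesis
    unfolding combos_def mem_Collect_eq
    by (intro exI[of _ "S \<union> S'"] conjI
        exI[of _ "\<lambda>d. (if d \<in> S then c d else 0) + (if d \<in> S' then c' d else 0)"])
qed

lemma combos_sum: "(\<And>x. x \<in> X \<Longrightarrow> f x \<in> combos D) \<Longrightarrow> sum f X \<in> combos D"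
  by (induction X rule: infinite_finite_induct) (auto intro: combos_zero combos_add)

lemma monomial_expr_D_set:
  assumes "u - e \<in> roots u"
  shows "monomial_expr lam mu e \<in> D_set lam mu u"
proof -
  obtain ias where ias: "u - e = sum_list (map (\<lambda>(i, a). Aexp i a) ias)" "set ias \<subseteq> I \<times> params u"
    using assms unfolding roots_def by blast
  have "prod_list (map (\<lambda>(i, a). Ainv i a) ias) = mono (- sum_list (map (\<lambda>(i, a). Aexp i a) ias))"
  proof (induction ias)
    case Nil
    then show ?case
      by (simp add: mono_def)
  next
    case (Cons p ps)
    obtain i a where "p = (i, a)"
      by (cases p)
    then show ?case
      using Cons mono_add[of "- Aexp i a" "- sum_list (map (\<lambda>(i, a). Aexp i a) ps)"] by simp
  qed
  then have "monomial_expr lam mu e = monomial_expr lam mu u * prod_list (map (\<lambda>(i, a). Ainv i a) ias)"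
    using mono_add[of u "- (u - e)"] by (simp add: monomial_expr_def mult.assoc flip: ias(1))
  then show ?thesis
    unfolding D_set_def using ias(2) unfolding params_def by blast
qed

lemma D_tilde_I: "P \<in> Yqt \<Longrightarrow> P \<in> combos (D_set lam mu u) \<Longrightarrow> coset_rel `` {P} \<in> D_tilde lam mu u"
  unfolding D_tilde_def combos_def mem_Collect_eq by (intro exI[of _ P] conjI refl)

lemma coset_eq:
  assumes "P \<in> Yqt" "R \<in> Yqt" "Pi_q P = Pi_q R" "Pi_t P = Pi_t R"
  shows "coset_rel `` {P} = coset_rel `` {R}"
proof (rule equiv_class_eq[OF equiv_coset_rel])
  show "(P, R) \<in> coset_rel"
    using assms by (simp add: coset_rel_iff)
qed

lemma frakK_projections:
  assumes "F \<in> frakK" "i \<in> I"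
  shows "Pi_q_tilde F \<in> Q.K i" "Pi_t_tilde F \<in> T.K i"
proof -
  obtain k where k: "k \<in> K_sub i" "F = denotes k"
    using assms unfolding frakK_def by blast
  obtain R where "R \<in> Yqt" "denotes k = coset_rel `` {R}" "Pi_q k = Pi_q R" "Pi_t k = Pi_t R"
    using K_sub_representable[OF assms(2) k(1)] by (rule representable_E)
  then show "Pi_q_tilde F \<in> Q.K i" "Pi_t_tilde F \<in> T.K i"
    using Pi_tilde_coset Pi_q_K_sub[OF assms(2) k(1)] Pi_t_K_sub[OF assms(2) k(1)] by (simp_all add: k(2))
qed

lemma frakK_I:
  assumes P: "P \<in> Yqt" and k: "\<And>i. i \<in> I \<Longrightarrow> \<exists>k\<in>K_sub i. Pi_q k = Pi_q P \<and> Pi_t k = Pi_t P"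
  shows "coset_rel `` {P} \<in> frakK"
  unfolding frakK_def
proof
  fix i assume i: "i \<in> I"
  then obtain k where k: "k \<in> K_sub i" "Pi_q k = Pi_q P" "Pi_t k = Pi_t P"
    using k by blast
  obtain R where "R \<in> Yqt" "denotes k = coset_rel `` {R}" "Pi_q k = Pi_q R" "Pi_t k = Pi_t R"
    using K_sub_representable[OF i k(1)] by (rule representable_E)
  then have "denotes k = coset_rel `` {P}"
    using coset_eq[OF P] k by simp
  then show "coset_rel `` {P} \<in> denotes ` K_sub i"
    using k(1) by blast
qed

lemma frakK_unique:
  assumes "I \<noteq> {}" "F \<in> frakK" "F' \<in> frakK" "unique_dominant_monomial m F" "unique_dominant_monomial m F'"
  shows "Pi_q_tilde F = Pi_q_tilde F'" "Pi_t_tilde F = Pi_t_tilde F'"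
proof -
  obtain i where i: "i \<in> I"
    using assms(1) by blast
  let ?P = "Pi_q_tilde F - Pi_q_tilde F'" and ?R = "Pi_t_tilde F - Pi_t_tilde F'"
  have K: "?P \<in> Q.K j" "?R \<in> T.K j" if "j \<in> I" for j
    using frakK_projections assms(2,3) that by (auto intro: Q.K_diff T.K_diff)
  have nd: "no_dominant ?P" "no_dominant ?R"
    using assms(4,5) no_dominant_diff unfolding unique_dominant_monomial_def by blast+
  have "?P = 0"
    \<comment> \<open>A single colour \<open>i\<close> suffices to place all keys of the difference
      on vertices, which is what \<open>Q.K_unique\<close> asks for.\<close>
    using K(1) Q.col_I nd(1) Q.K_keys_V[OF K(1)[OF i]]
    by (intro Q.K_unique) (auto simp: no_dominant_def dominant_expo_def nonneg_def)
  then show "Pi_q_tilde F = Pi_q_tilde F'"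
    by simp
  have "?R = 0"
    using K(2) T.col_I nd(2) T.K_keys_V[OF K(2)[OF i]]
    by (intro T.K_unique) (auto simp: no_dominant_def dominant_expo_def nonneg_def)
  then show "Pi_t_tilde F = Pi_t_tilde F'"
    by simp
qed

lemma Pi_q_lift: "(\<And>e. e \<in> keys F \<Longrightarrow> expq (h e) = e) \<Longrightarrow>
    Pi_q (\<Sum>e\<in>keys F. scalar [:lookup F e:] * mono (h e)) = F"
  by (subst (2) sum_singles[of F, symmetric])
    (simp add: Pi_q_def specialise_sum scalar_def mono_def mult_single flip: expq_def)

lemma Pi_t_lift: "(\<And>e. e \<in> keys F \<Longrightarrow> zexp (h e) = e) \<Longrightarrow>
    Pi_t (\<Sum>e\<in>keys F. scalar [:lookup F e:] * mono (h e)) = F"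
  by (subst (2) sum_singles[of F, symmetric])
    (simp add: Pi_t_def specialise_sum scalar_def mono_def mult_single flip: zexp_def)

lemma exists_solution:
  assumes m: "is_dominant_monomial lam mu u m"
  shows "\<exists>F \<in> frakK \<inter> D_tilde lam mu u. unique_dominant_monomial m F"
proof -
  have mY: "m \<in> Yqt_tilde" "m = denotes (monomial_expr lam mu u)" and u: "keys u \<subseteq> I \<times> qt_lattice" "nonneg u"
    using m unfolding is_dominant_monomial_def is_monomial_def dominant_expo_def nonneg_def by auto
  have su: "supported u"
    using u(1) by (simp add: supported_def)
  obtain R where R: "R \<in> Yqt" "m = coset_rel `` {R}"
    using mY(1) unfolding Yqt_tilde_def by (rule quotientE)
  then have "R \<in> denotes (monomial_expr lam mu u)"
    using mY(2) by (auto simp: coset_rel_iff)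
  then have rep: "representable (monomial_expr lam mu u)"
    unfolding denotes_def representable_def by blast
  have me: "monomial_expr lam mu u = Poly_Mapping.single u [:lam, mu:]"
    by (simp add: monomial_expr_def scalar_def mono_def mult_single)
  obtain R' where R': "R' \<in> Yqt" "m = coset_rel `` {R'}" "Pi_q (monomial_expr lam mu u) = Pi_q R'"
      "Pi_t (monomial_expr lam mu u) = Pi_t R'" "monomial_expr lam mu u \<in> W_integral"
    using representable_E[OF rep] mY(2) by metis
  have W: "u \<in> W_lattice" if "lam \<noteq> 0"
    using R'(5) that by (simp add: me W_integral_single)
  have Pm: "Pi_q_tilde m = Poly_Mapping.single (expq u) (lam + mu)" "Pi_t_tilde m = Poly_Mapping.single (zexp u) lam"
    using R'(3,4) Pi_tilde_coset[OF R'(1)] by (simp_all add: R'(2) me Pi_q_single Pi_t_single)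
  obtain F h where F: "\<And>e. e \<in> keys F \<Longrightarrow> u - h e \<in> roots u" "\<And>e. e \<in> keys F \<Longrightarrow> expq (h e) = e"
      "lookup F (expq u) = 1" "\<And>e. e \<in> keys F \<Longrightarrow> nonneg e \<Longrightarrow> e = expq u" "\<And>i. i \<in> I \<Longrightarrow> F \<in> Q.K i"
    using solution_q[OF u] by metis
  obtain G g where G: "\<And>e. e \<in> keys G \<Longrightarrow> u - g e \<in> roots u" "\<And>e. e \<in> keys G \<Longrightarrow> g e \<in> W_lattice"
      "\<And>e. e \<in> keys G \<Longrightarrow> zexp (g e) = e" "lam \<noteq> 0 \<Longrightarrow> lookup G (zexp u) = 1"
      "\<And>e. e \<in> keys G \<Longrightarrow> nonneg e \<Longrightarrow> e = zexp u" "\<And>i. i \<in> I \<Longrightarrow> G \<in> T.K i"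
  \<comment> \<open>For \<open>lam = 0\<close> the image of \<open>m\<close> at
    \<open>alpha = 0\<close> vanishes and \<open>u\<close> need not lie in \<open>W_lattice\<close>;
    the second component is then 0.\<close>
  proof (cases "lam = 0")
    case True
    then show ?thesis
      using that[of 0 id] T.K_zero by auto
  next
    case False
    obtain G g where "\<forall>e\<in>keys G. u - g e \<in> roots u \<and> g e \<in> W_lattice \<and> zexp (g e) = e"
      "lookup G (zexp u) = 1" "\<forall>e\<in>keys G. nonneg e \<longrightarrow> e = zexp u" "\<forall>i\<in>I. G \<in> T.K i"
      using solution_t[OF u W[OF False]] by blast
    then show ?thesis
      using that[of G g] by blast
  qed
  have "supported (h e)" if "e \<in> keys F" for e
    using supported_diff[OF su roots_supported[OF F(1)[OF that]]] by simp
  then obtain k where k: "1 \<le> k" "\<And>e. e \<in> keys F \<Longrightarrow> alpha ^ k * mono (h e) \<in> Yqt"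
    using alpha_power_mono_Yqt[of "h ` keys F"] by auto
  \<comment> \<open>Modulo \<open>alpha\<^sup>2 = alpha\<close> the factors \<open>alpha ^ k\<close>
    and \<open>1 - alpha\<close> are the idempotents of the two components. The common factor
    \<open>L\<close> makes every term a multiple of a monomial expression with the coefficients
    \<open>lam\<close> and \<open>mu\<close> of \<open>m\<close>, as \<open>D_set\<close>
    demands.\<close>
  define L p1 p2 where "L = [:lam, mu:]" and "p1 = L * [:0, 1:] ^ k" and "p2 = L * (1 - [:0, 1:])"
  have p: "poly p1 1 = lam + mu" "poly p1 0 = 0" "poly p2 1 = 0" "poly p2 0 = lam"
    using k(1) by (auto simp: L_def p1_def p2_def)
  define P1 P2 where "P1 = (\<Sum>e\<in>keys F. scalar [:lookup F e:] * mono (h e))"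
    and "P2 = (\<Sum>e\<in>keys G. scalar [:lookup G e:] * mono (g e))"
  define P where "P = scalar p1 * P1 + scalar p2 * P2"
  have P1: "Pi_q P1 = F" and P2: "Pi_t P2 = G"
    unfolding P1_def P2_def using F(2) G(3) by (simp_all add: Pi_q_lift Pi_t_lift)
  have PP: "Pi_q P = frag_cmul (lam + mu) F" "Pi_t P = frag_cmul lam G"
    unfolding P_def by (simp_all add: Pi_q_add Pi_t_add Pi_q_scalar Pi_t_scalar p P1 P2 single_0_mult)
  have alpha_pow: "scalar ([:0, 1:] ^ k) = (alpha ^ k :: 'i laurent_alpha)"
  proof (induction k)
    case 0
    show ?case
      by (simp add: scalar_def)
  next
    case (Suc k)
    then show ?case
      by (simp only: power_Suc scalar_mult alpha_def)
  qed
  have 1: "scalar p1 * (scalar [:lookup F e:] * mono (h e)) = scalar (L * [:lookup F e:]) * (alpha ^ k * mono (h e))" for e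
    by (simp only: p1_def scalar_mult alpha_pow mult_ac)
  have 2: "scalar p2 * (scalar [:lookup G e:] * mono (g e)) = scalar (p2 * [:lookup G e:]) * mono (g e)" for e
    by (simp only: scalar_mult mult_ac)
  have "P \<in> Yqt"
    unfolding P_def P1_def P2_def sum_distrib_left 1 2
    using k(2) G(2) by (intro Yqt_add Yqt_sum Yqt_mult[OF scalar_Yqt]) (auto intro: mono_W_lattice_Yqt)
  have 3: "scalar p1 * (scalar [:lookup F e:] * mono (h e))
      = scalar ([:lookup F e:] * [:0, 1:] ^ k) * monomial_expr lam mu (h e)" for e
    by (simp only: p1_def L_def monomial_expr_def scalar_mult mult_ac)
  have 4: "scalar p2 * (scalar [:lookup G e:] * mono (g e))
      = scalar ([:lookup G e:] * (1 - [:0, 1:])) * monomial_expr lam mu (g e)" for e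
    by (simp only: p2_def L_def monomial_expr_def scalar_mult mult_ac)
  have "P \<in> combos (D_set lam mu u)"
    unfolding P_def P1_def P2_def sum_distrib_left 3 4
    using F(1) G(1) by (intro combos_add combos_sum combos_single monomial_expr_D_set)
  have "coset_rel `` {P} \<in> frakK"
  proof (rule frakK_I[OF \<open>P \<in> Yqt\<close>])
    fix i assume i: "i \<in> I"
    obtain a b where ab: "a \<in> K_sub i" "Pi_q a = F" "b \<in> K_sub i" "Pi_t b = G"
      using K_subset_Pi_q[OF i F(5)[OF i]] K_subset_Pi_t[OF i G(6)[OF i]] by blast
    \<comment> \<open>The same two idempotents glue preimages of \<open>F\<close> and
      \<open>G\<close> inside \<open>K_sub i\<close>, so each subalgebra contains the element with
      both prescribed images.\<close>
    have "scalar p1 * a + scalar p2 * b \<in> K_sub i"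
      using ab by (intro K_sub_add K_sub_mult scalar_K_sub)
    moreover have "Pi_q (scalar p1 * a + scalar p2 * b) = Pi_q P" "Pi_t (scalar p1 * a + scalar p2 * b) = Pi_t P"
      using ab by (simp_all add: PP Pi_q_add Pi_t_add Pi_q_scalar Pi_t_scalar p single_0_mult)
    ultimately show "\<exists>k\<in>K_sub i. Pi_q k = Pi_q P \<and> Pi_t k = Pi_t P"
      by blast
  qed
  moreover have "unique_dominant_monomial m (coset_rel `` {P})"
    unfolding unique_dominant_monomial_def Pm Pi_tilde_coset[OF \<open>P \<in> Yqt\<close>] PP
    using F(3,4) G(4,5) by (intro conjI no_dominant_cmul_diff)
  ultimately show ?thesis
    using D_tilde_I[OF \<open>P \<in> Yqt\<close> \<open>P \<in> combos _\<close>] by blast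
qed

end

theorem theorem4p4:
  fixes n :: nat
    and I :: "'i set" and C :: "'i \<Rightarrow> 'i \<Rightarrow> int" and r phi :: "'i \<Rightarrow> nat"
    and q t :: complex
    and m :: "'i laurent_alpha set" and lam mu :: int and u :: "'i expo"
  assumes "1 \<le> n"
    and "interpolation I C r phi q t"
    and "card I = n"
    and "interpolation.is_dominant_monomial I r phi q t lam mu u m"
  shows "\<exists>!F. F \<in> interpolation.frakK I C r phi q t \<inter> interpolation.D_tilde I C r phi q t lam mu u
    \<and> interpolation.unique_dominant_monomial I r phi q t m F"
proof -
  interpret interpolation I C r phi q t
    by fact
  have "I \<noteq> {}"
    using assms(1,3) by auto
  obtain F where F: "F \<in> frakK \<inter> D_tilde lam mu u" "unique_dominant_monomial m F"
    using exists_solution[OF assms(4)] by blast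
  show ?thesis
  proof (rule ex1I[of _ F])
    fix F' assume F': "F' \<in> frakK \<inter> D_tilde lam mu u \<and> unique_dominant_monomial m F'"
    obtain P P' where P: "P \<in> Yqt" "F = coset_rel `` {P}" "P' \<in> Yqt" "F' = coset_rel `` {P'}"
      using F(1) F' unfolding D_tilde_def by blast
    have "Pi_q P' = Pi_q P" "Pi_t P' = Pi_t P"
      using frakK_unique[OF \<open>I \<noteq> {}\<close>, of F' F m] F F' P Pi_tilde_coset by auto
    then show "F' = F"
      using coset_eq[OF P(3,1)] by (simp only: P)
  qed (use F in blast)
qed

end
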